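(* Let $G$ be a finitely generated metabelian group. Then: \begin{itemize} \item either $G$ is virtually nilpotent and satisfies $\mathrm{Sep}_G(v)\asymp v^{1-1/d}$, with $d$ being the degree of growth of $G$, \item or there exists a regular map $\mathbb{Z}_2\wr\mathbb{Z}\to G$ and $\mathrm{Sep}_G(v)\succeq \frac{v}{\log v}$. \end{itemize}
   Context: $\mathbb{Z}_2=\mathbb{Z}/2\mathbb{Z}$, and $\mathbb{Z}_2 \wr \mathbb{Z} = \big(\bigoplus_{j\in\mathbb{Z}} \mathbb{Z}_2\big)\rtimes \mathbb{Z}$ is the lamplighter group, where $\mathbb{Z}$ acts by shifting coordinates. Regular maps: let $A$ and $B$ be simplicial graphs with bounded degree (identified with their vertex sets, with graph distances $d_A$, $d_B$). A map $\phi\colon A\to B$ is regular if (R1) there is $K>0$ such that $d_B(\phi(x),\phi(y))\le K\, d_A(x,y)$ for all $x,y\in A$, and (R2) there is $C\ge 1$ such that $|\phi^{-1}(x)|\le C$ for every $x\in B$. A map between finitely generated groups is called regular if it is regular as a map between Cayley graphs with respect to finite generating sets; this does not depend on the choice of the finite generating sets. Separation profile: for a graph $X$ with bounded degree and vertex set $VX$, subsets of vertices are identified with the corresponding induced subgraphs. For a finite $F\subset VX$, $\mathrm{Cut}\,F$ is the minimal size of a subset $C\subset F$ such that every connected component of $F\setminus C$ contains at most $|F|/2$ vertices. The separation profile is the function $\mathbb{N}\to\mathbb{N}$ given by $\mathrm{Sep}_X(v)=\sup_{F\subset VX,\ |F|\le v}\mathrm{Cut}\,F$. For a finitely generated group $G$,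 $\mathrm{Sep}_G$ denotes the separation profile of a Cayley graph of $G$ with respect to a finite generating set; up to the equivalence $\asymp$ below it does not depend on this choice. Comparison: $f\preceq g$ (also written $g\succeq f$) means that there exists $C>0$ such that $f(v)\le C g(Cv)$ for every $v\ge C$; $f\asymp g$ means $f\preceq g$ and $g\preceq f$. The degree of growth of a finitely generated virtually nilpotent group is the integer $d$ such that the cardinality of its balls of radius $n$ (for a word metric) is bounded above and below by positive constant multiples of $n^d$ for all $n\ge1$. *)

theory Defs
  imports Complex_Main "HOL-Library.Extended_Real" "HOL-Algebra.Product_Groups"
begin

section \<open>Graphs, distances and regular maps\<close>

text \<open>The adjacency relation of a simplicial graph is symmetric and irreflexive; see the locale
  below.\<close>

record 'a sgraph =
  vertices :: "'a set"
  adjacency :: "('a \<times> 'a) set"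

locale bounded_degree_graph =
  fixes X :: "'a sgraph"
  assumes adjacency_vertices: "adjacency X \<subseteq> vertices X \<times> vertices X"
    and sym_adjacency: "sym (adjacency X)"
    and irrefl_adjacency: "irrefl (adjacency X)"
    and bounded_degree: "\<exists>D::nat. \<forall>x\<in>vertices X. finite (adjacency X `` {x}) \<and> card (adjacency X `` {x}) \<le> D"

text \<open>The distance is infinite between different connected components.\<close>

definition gdist :: "'a sgraph \<Rightarrow> 'a \<Rightarrow> 'a \<Rightarrow> enat" where
  "gdist X x y = (INF n\<in>{n. (x, y) \<in> adjacency X ^^ n}. enat n)"

definition regular_map :: "'a sgraph \<Rightarrow> 'b sgraph \<Rightarrow> ('a \<Rightarrow> 'b) \<Rightarrow> bool" where
  "regular_map A B \<phi> \<longleftrightarrow>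
     \<phi> ` vertices A \<subseteq> vertices B \<and>
     (\<exists>K::real. K > 0 \<and> (\<forall>x\<in>vertices A. \<forall>y\<in>vertices A.
        ereal_of_enat (gdist B (\<phi> x) (\<phi> y)) \<le> ereal K * ereal_of_enat (gdist A x y))) \<and>
     (\<exists>C::real. C \<ge> 1 \<and> (\<forall>z\<in>vertices B.
        finite {x \<in> vertices A. \<phi> x = z} \<and> real (card {x \<in> vertices A. \<phi> x = z}) \<le> C))"


section \<open>The separation profile\<close>

text \<open>Vertex sets of the connected components of the subgraph induced on \<open>U\<close>.\<close>

definition induced_components :: "'a sgraph \<Rightarrow> 'a set \<Rightarrow> 'a set set" where
  "induced_components X U = (\<lambda>x. (adjacency X \<inter> U \<times> U)\<^sup>* `` {x}) ` U"

definition cut :: "'a sgraph \<Rightarrow> 'a set \<Rightarrow> nat" where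
  "cut X F = Min (card ` {C. C \<subseteq> F \<and>
     (\<forall>K\<in>induced_components X (F - C). real (card K) \<le> real (card F) / 2)})"

definition sep :: "'a sgraph \<Rightarrow> nat \<Rightarrow> nat" where
  "sep X v = (SUP F\<in>{F. F \<subseteq> vertices X \<and> finite F \<and> card F \<le> v}. cut X F)"

text \<open>The two extrema above are attained: \<open>C = F\<close> is always admissible in \<open>cut\<close>, and the
  supremum in \<open>sep\<close> is that of a nonempty set of naturals bounded by \<open>v\<close>.\<close>

lemma cut_le_card:
  assumes "finite F"
  shows "cut X F \<le> card F"
proof -
  have "F \<in> {C. C \<subseteq> F \<and> (\<forall>K\<in>induced_components X (F - C). real (card K) \<le> real (card F) / 2)}"
    by (simp add: induced_components_def)
  moreover have "finite {C. C \<subseteq> F \<and> (\<forall>K\<in>induced_components X (F - C). real (card K) \<le> real (card F) / 2)}"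
    by (rule finite_subset[of _ "Pow F"]) (use assms in auto)
  ultimately show ?thesis
    unfolding cut_def by (intro Min_le) auto
qed

lemma sep_bdd_above: "bdd_above (cut X ` {F. F \<subseteq> vertices X \<and> finite F \<and> card F \<le> v})"
  by (rule bdd_aboveI2[of _ _ v]) (auto intro: le_trans[OF cut_le_card])

text \<open>Profiles are functions on the naturals, so the constant in \<open>f v \<le> C * g (C * v)\<close> is taken
  to be a natural number.\<close>

definition profile_le :: "(nat \<Rightarrow> real) \<Rightarrow> (nat \<Rightarrow> real) \<Rightarrow> bool"  (infix "\<preceq>" 50) where
  "f \<preceq> g \<longleftrightarrow> (\<exists>C::nat. C > 0 \<and> (\<forall>v\<ge>C. f v \<le> real C * g (C * v)))"

definition profile_equiv :: "(nat \<Rightarrow> real) \<Rightarrow> (nat \<Rightarrow> real) \<Rightarrow> bool"  (infix "\<asymp>" 50) where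
  "f \<asymp> g \<longleftrightarrow> f \<preceq> g \<and> g \<preceq> f"


section \<open>Finitely generated groups and Cayley graphs\<close>

definition finite_generating_set :: "('a, 'm) monoid_scheme \<Rightarrow> 'a set \<Rightarrow> bool" where
  "finite_generating_set G S \<longleftrightarrow> finite S \<and> S \<subseteq> carrier G \<and> generate G S = carrier G"

definition finitely_generated_group :: "('a, 'm) monoid_scheme \<Rightarrow> bool" where
  "finitely_generated_group G \<longleftrightarrow> group G \<and> (\<exists>S. finite_generating_set G S)"

definition cayley_graph :: "('a, 'm) monoid_scheme \<Rightarrow> 'a set \<Rightarrow> 'a sgraph" where
  "cayley_graph G S = \<lparr>vertices = carrier G,
     adjacency = {(g, h). g \<in> carrier G \<and> h \<in> carrier G \<and> g \<noteq> h \<and>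
                          (\<exists>s\<in>S. h = g \<otimes>\<^bsub>G\<^esub> s \<or> g = h \<otimes>\<^bsub>G\<^esub> s)}\<rparr>"

lemma bounded_degree_cayley_graph:
  assumes "group G" "finite S" "S \<subseteq> carrier G"
  shows "bounded_degree_graph (cayley_graph G S)"
proof
  interpret group G by fact
  show "adjacency (cayley_graph G S) \<subseteq> vertices (cayley_graph G S) \<times> vertices (cayley_graph G S)"
    by (auto simp: cayley_graph_def)
  show "sym (adjacency (cayley_graph G S))"
    by (auto simp: cayley_graph_def sym_def)
  show "irrefl (adjacency (cayley_graph G S))"
    by (auto simp: cayley_graph_def irrefl_def)
  have "finite (adjacency (cayley_graph G S) `` {g}) \<and>
        card (adjacency (cayley_graph G S) `` {g}) \<le> card S + card S"
    if g: "g \<in> carrier G" for g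
  proof -
    let ?N = "(\<lambda>s. g \<otimes>\<^bsub>G\<^esub> s) ` S \<union> (\<lambda>s. g \<otimes>\<^bsub>G\<^esub> inv\<^bsub>G\<^esub> s) ` S"
    have sub: "adjacency (cayley_graph G S) `` {g} \<subseteq> ?N"
    proof
      fix h assume "h \<in> adjacency (cayley_graph G S) `` {g}"
      then obtain s where h: "h \<in> carrier G" and s: "s \<in> S"
        and "h = g \<otimes>\<^bsub>G\<^esub> s \<or> g = h \<otimes>\<^bsub>G\<^esub> s"
        by (auto simp: cayley_graph_def)
      moreover have "s \<in> carrier G" using s assms(3) by blast
      ultimately have "h = g \<otimes>\<^bsub>G\<^esub> s \<or> h = g \<otimes>\<^bsub>G\<^esub> inv\<^bsub>G\<^esub> s"
        using inv_solve_right' inv_solve_right g by metis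
      with s show "h \<in> ?N" by blast
    qed
    have fin: "finite ?N" using assms(2) by simp
    have "card ?N \<le> card S + card S"
      using assms(2) by (intro order_trans[OF card_Un_le] add_mono card_image_le)
    with card_mono[OF fin sub] finite_subset[OF sub fin] show ?thesis by linarith
  qed
  then show "\<exists>D::nat. \<forall>x\<in>vertices (cayley_graph G S).
      finite (adjacency (cayley_graph G S) `` {x}) \<and> card (adjacency (cayley_graph G S) `` {x}) \<le> D"
    by (intro exI[of _ "card S + card S"]) (simp add: cayley_graph_def)
qed

text \<open>The next two notions do not depend on the finite generating sets that are chosen.\<close>

definition regular_group_map ::
    "('a, 'm) monoid_scheme \<Rightarrow> ('b, 'n) monoid_scheme \<Rightarrow> ('a \<Rightarrow> 'b) \<Rightarrow> bool" where
  "regular_group_map G H \<phi> \<longleftrightarrow>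
     (\<exists>S T. finite_generating_set G S \<and> finite_generating_set H T \<and>
            regular_map (cayley_graph G S) (cayley_graph H T) \<phi>)"

definition growth_degree :: "('a, 'm) monoid_scheme \<Rightarrow> nat \<Rightarrow> bool" where
  "growth_degree G d \<longleftrightarrow>
     (\<exists>S. finite_generating_set G S \<and>
        (\<exists>a b :: real. a > 0 \<and> b > 0 \<and> (\<forall>n\<ge>1.
           let \<beta> = real (card {g \<in> carrier G. gdist (cayley_graph G S) \<one>\<^bsub>G\<^esub> g \<le> enat n})
           in a * real n ^ d \<le> \<beta> \<and> \<beta> \<le> b * real n ^ d)))"

text \<open>The function \<open>v\<close> to the power \<open>1 - 1/d\<close>. Growth degree \<open>0\<close> means that the group is finite,
  hence has bounded separation profile; the formula, meaningless for \<open>d = 0\<close>, is then read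
  as the constant \<open>1\<close>.\<close>

definition growth_profile :: "nat \<Rightarrow> nat \<Rightarrow> real" where
  "growth_profile d v = (if d = 0 then 1 else real v powr (1 - 1 / real d))"


section \<open>Metabelian and virtually nilpotent groups\<close>

definition metabelian :: "('a, 'm) monoid_scheme \<Rightarrow> bool" where
  "metabelian G \<longleftrightarrow> group G \<and> comm_group (G\<lparr>carrier := derived G (carrier G)\<rparr>)"

primrec lower_central :: "('a, 'm) monoid_scheme \<Rightarrow> nat \<Rightarrow> 'a set" where
  "lower_central G 0 = carrier G"
| "lower_central G (Suc n) = generate G
     (\<Union>x\<in>lower_central G n. \<Union>y\<in>carrier G. {x \<otimes>\<^bsub>G\<^esub> y \<otimes>\<^bsub>G\<^esub> inv\<^bsub>G\<^esub> x \<otimes>\<^bsub>G\<^esub> inv\<^bsub>G\<^esub> y})"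

definition nilpotent_group :: "('a, 'm) monoid_scheme \<Rightarrow> bool" where
  "nilpotent_group G \<longleftrightarrow> group G \<and> (\<exists>n. lower_central G n = {\<one>\<^bsub>G\<^esub>})"

definition virtually_nilpotent :: "('a, 'm) monoid_scheme \<Rightarrow> bool" where
  "virtually_nilpotent G \<longleftrightarrow>
     (\<exists>H. subgroup H G \<and> finite (rcosets\<^bsub>G\<^esub> H) \<and> nilpotent_group (G\<lparr>carrier := H\<rparr>))"


section \<open>The lamplighter group\<close>

definition semidirect_product ::
    "('a, 'm) monoid_scheme \<Rightarrow> ('b, 'n) monoid_scheme \<Rightarrow> ('b \<Rightarrow> 'a \<Rightarrow> 'a) \<Rightarrow> ('a \<times> 'b) monoid" where
  "semidirect_product N H \<theta> = \<lparr>carrier = carrier N \<times> carrier H,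
     mult = (\<lambda>(x, h) (y, k). (x \<otimes>\<^bsub>N\<^esub> \<theta> h y, h \<otimes>\<^bsub>H\<^esub> k)),
     one = (\<one>\<^bsub>N\<^esub>, \<one>\<^bsub>H\<^esub>)\<rparr>"

definition lamplighter :: "((int \<Rightarrow> int) \<times> int) monoid" where
  "lamplighter = semidirect_product (sum_group UNIV (\<lambda>_. integer_mod_group 2)) integer_group
     (\<lambda>m f j. f (j - m))"

lemma carrier_lamplighter:
  "carrier lamplighter = {f. (\<forall>j. f j \<in> {0..<2}) \<and> finite {j. f j \<noteq> 0}} \<times> UNIV"
  by (auto simp: lamplighter_def semidirect_product_def carrier_sum_group carrier_integer_mod_group
      PiE_UNIV_domain)

lemma mult_lamplighter:
  "(f, m) \<otimes>\<^bsub>lamplighter\<^esub> (g, n) = (\<lambda>j. (f j + g (j - m)) mod 2, m + n)"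
  by (simp add: lamplighter_def semidirect_product_def restrict_UNIV)

lemma one_lamplighter: "\<one>\<^bsub>lamplighter\<^esub> = (\<lambda>_. 0, 0)"
  by (simp add: lamplighter_def semidirect_product_def restrict_UNIV)

lemma finite_support_shift:
  fixes f :: "int \<Rightarrow> int"
  assumes "finite {j. f j \<noteq> 0}"
  shows "finite {j. f (j - m) \<noteq> 0}"
proof -
  have "{j. f (j - m) \<noteq> 0} = (\<lambda>j. j + m) ` {j. f j \<noteq> 0}"
    by (auto simp: image_iff algebra_simps) (metis diff_add_cancel)
  with assms show ?thesis by simp
qed

lemma group_lamplighter: "group lamplighter"
proof (rule groupI)
  fix x y assume "x \<in> carrier lamplighter" "y \<in> carrier lamplighter"
  then obtain f m g n where xy: "x = (f, m)" "y = (g, n)"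
    and fin: "finite {j. f j \<noteq> 0}" "finite {j. g j \<noteq> 0}"
    by (auto simp: carrier_lamplighter)
  have "finite {j. (f j + g (j - m)) mod 2 \<noteq> 0}"
    by (rule finite_subset[OF _ finite_UnI[OF fin(1) finite_support_shift[OF fin(2), of m]]]) auto
  then show "x \<otimes>\<^bsub>lamplighter\<^esub> y \<in> carrier lamplighter"
    by (auto simp: xy mult_lamplighter carrier_lamplighter)
next
  fix x assume "x \<in> carrier lamplighter"
  then obtain f m where x: "x = (f, m)" and f: "\<And>j. f j \<in> {0..<2}" and fin: "finite {j. f j \<noteq> 0}"
    by (auto simp: carrier_lamplighter)
  show "\<one>\<^bsub>lamplighter\<^esub> \<otimes>\<^bsub>lamplighter\<^esub> x = x"
    using f by (auto simp: x one_lamplighter mult_lamplighter fun_eq_iff)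
  have "((\<lambda>j. f (j + m)), - m) \<in> carrier lamplighter"
    using f finite_support_shift[OF fin, of "- m"] by (auto simp: carrier_lamplighter)
  moreover have "((\<lambda>j. f (j + m)), - m) \<otimes>\<^bsub>lamplighter\<^esub> x = \<one>\<^bsub>lamplighter\<^esub>"
    by (auto simp: x one_lamplighter mult_lamplighter fun_eq_iff)
  ultimately show "\<exists>y\<in>carrier lamplighter. y \<otimes>\<^bsub>lamplighter\<^esub> x = \<one>\<^bsub>lamplighter\<^esub>" by blast
next
  fix x y z assume "x \<in> carrier lamplighter" "y \<in> carrier lamplighter" "z \<in> carrier lamplighter"
  show "x \<otimes>\<^bsub>lamplighter\<^esub> y \<otimes>\<^bsub>lamplighter\<^esub> z = x \<otimes>\<^bsub>lamplighter\<^esub> (y \<otimes>\<^bsub>lamplighter\<^esub> z)"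
    by (cases x; cases y; cases z)
       (simp add: mult_lamplighter fun_eq_iff mod_simps algebra_simps)
qed (simp add: carrier_lamplighter one_lamplighter)

end

theory Submission
  imports Defs "HOL-Computational_Algebra.Computational_Algebra" "HOL-Algebra.FiniteProduct"
begin

text \<open>Let \<open>A\<close> be the derived subgroup of \<open>G\<close>, viewed as a module over the abelianization. The dichotomy is
  whether some \<open>t\<close> in \<open>G\<close> and \<open>a\<close> in \<open>A\<close> satisfy no relation \<open>p(t) a = 0\<close> with a nonzero polynomial \<open>p\<close> whose
  coefficients lie in \<open>{-1, 0, 1}\<close>.

  If there is such a pair, the sums of distinct translates \<open>t ^ j a\<close> are pairwise different, so that
  sending a lamp configuration \<open>f\<close> and a position \<open>m\<close> to \<open>(\<Sum>j. f j * t ^ j a) t ^ m\<close> is an injective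
  Lipschitz map from the lamplighter group to \<open>G\<close>. The images of the configurations supported in an
  interval of length \<open>n\<close> are joined by paths of length \<open>O(n)\<close> with low congestion, which yields
  \<open>v / log v\<close>.

  Otherwise \<open>A\<close> is a finitely generated abelian group, and the relations of the powers of \<open>t\<close> force all
  eigenvalues of \<open>t\<close> on \<open>A\<close> onto the unit circle. By Kronecker's theorem some power of \<open>t\<close> acts
  unipotently, so that \<open>G\<close> has a nilpotent subgroup \<open>H\<close> of finite index that is generated by \<open>A\<close> and
  by elements \<open>s\<^sub>1, \<dots>, s\<^sub>k\<close> independent modulo \<open>A\<close>. The generators of \<open>A\<close>, the commutators of the
  \<open>s\<^sub>i\<close>, and their images under products of the operators \<open>s\<^sub>i - 1\<close> carry weights, and the ball of
  radius \<open>n\<close> in \<open>H\<close> is, up to constants, the set of products of \<open>s\<^sub>1 ^ m\<^sub>1 \<dots> s\<^sub>k ^ m\<^sub>k\<close> with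
  \<open>\<bar>m\<^sub>i\<bar> \<le> n\<close> and of elements of \<open>A\<close> in which the exponent of an item of weight \<open>w\<close> is at most \<open>n ^ w\<close>.
  Hence the growth is exactly of degree \<open>d\<close>, and the profile \<open>v powr (1 - 1 / d)\<close> follows from sphere
  cuts around a net and from the congestion of geodesics in balls.\<close>

section \<open>Kronecker's theorem on roots of unity\<close>

text \<open>The coefficients -1, 0, 1 are those of a difference of two 0/1 polynomials, so the
  absence of such a relation is exactly the injectivity of finite sums of distinct translates. In
  the opposite case the same restriction makes the extreme coefficients of every relation units,
  which turns a mere relation into finite generation of \<open>A\<close>: the leading coefficient
  expresses the next translate, the constant one the previous translate. The hypothesis concerns
  every element of \<open>G\<close>, hence also all powers of \<open>t\<close>; roots of such
  polynomials have modulus below 2, and a number all of whose powers stay below 2 lies in the closed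
  unit disc. The delicate point of the other half is that matching growth bounds have to be
  exhibited although \<open>A\<close> may have torsion and the weighted items may be dependent.
  Prices that scale with \<open>n\<close> control the collection of words and give the upper bound;
  approximating powers with exponent \<open>n ^ w\<close> by iterated commutators gives the lower
  one. Both are expressed by the same boxes, which are counted without choosing a basis.\<close>

lemma finite_range_collision:
  fixes f :: "nat \<Rightarrow> 'a"
  assumes "finite (range f)"
  obtains i j where "i < j" "f i = f j"
proof -
  have "\<not> inj f" using assms finite_imageD[of f UNIV] by auto
  then obtain x y where xy: "x \<noteq> y" "f x = f y" unfolding inj_def by blast
  show thesis
  proof (cases "x < y")
    case True
    then show ?thesis using that[of x y] xy by simp
  next
    case False
    then show ?thesis using that[of y x] xy by simp
  qed
qed

lemma sum_mset_sum_swap: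
  fixes f :: "'a \<Rightarrow> 'b \<Rightarrow> 'c :: comm_monoid_add"
  shows "(\<Sum>x\<in>#R. \<Sum>k\<in>K. f x k) = (\<Sum>k\<in>K. \<Sum>x\<in>#R. f x k)"
  by (induction R) (auto simp: sum.distrib)

lemma sum_mset_diff:
  fixes f g :: "'a \<Rightarrow> 'c :: ab_group_add"
  shows "(\<Sum>x\<in>#R. f x - g x) = (\<Sum>x\<in>#R. f x) - (\<Sum>x\<in>#R. g x)"
  by (induction R) auto

definition power_sum :: "complex multiset \<Rightarrow> nat \<Rightarrow> complex" where
  "power_sum R n = (\<Sum>x\<in>#R. x ^ n)"

text \<open>Newton's identities as a generating function. The series of power sums is the sum of 1 /
  (1 - x X) over the roots, and X F' / F is the sum of - x X / (1 - x X); together they give the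
  number of roots. Multiplying by \<open>F\<close> avoids division.\<close>

lemma power_sum_generating_function:
  defines "F \<equiv> \<lambda>R. (\<Prod>x\<in>#R. 1 - fps_const x * fps_X :: complex fps)"
  shows "Abs_fps (power_sum R) * F R = of_nat (size R) * F R - fps_X * fps_deriv (F R)"
proof (induction R)
  case empty
  have "Abs_fps (power_sum {#}) = 0"
    by (simp add: fps_eq_iff power_sum_def)
  then show ?case by (simp add: F_def)
next
  case (add x R)
  have geo: "Abs_fps (\<lambda>n. x ^ n) * (1 - fps_const x * fps_X) = 1"
  proof -
    have "Abs_fps (\<lambda>n. x ^ n) - fps_X * (fps_const x * Abs_fps (\<lambda>n. x ^ n)) = 1"
      by (auto simp: fps_eq_iff fps_X_mult_nth power_eq_if split: if_splits)
    then show ?thesis by (simp add: algebra_simps)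
  qed
  have S: "Abs_fps (power_sum (add_mset x R)) = Abs_fps (\<lambda>n. x ^ n) + Abs_fps (power_sum R)"
    by (simp add: fps_eq_iff power_sum_def)
  have F: "F (add_mset x R) = (1 - fps_const x * fps_X) * F R"
    by (simp add: F_def)
  define u where "u = fps_const x * (fps_X :: complex fps)"
  have du: "fps_X * fps_deriv (1 - u) = - u"
    by (simp add: u_def algebra_simps)
  have "Abs_fps (power_sum (add_mset x R)) * F (add_mset x R)
      = (Abs_fps (\<lambda>n. x ^ n) * (1 - u)) * F R + (1 - u) * (Abs_fps (power_sum R) * F R)"
    unfolding S F u_def by (simp add: algebra_simps)
  also have "\<dots> = F R + (1 - u) * (of_nat (size R) * F R - fps_X * fps_deriv (F R))"
    using geo add.IH by (simp add: u_def)
  also have "\<dots> = of_nat (size (add_mset x R)) * ((1 - u) * F R)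
       - ((1 - u) * (fps_X * fps_deriv (F R)) + (fps_X * fps_deriv (1 - u)) * F R)"
    unfolding du by (simp add: algebra_simps)
  also have "\<dots> = of_nat (size (add_mset x R)) * ((1 - u) * F R) - fps_X * fps_deriv ((1 - u) * F R)"
    by (simp add: algebra_simps)
  finally show ?case unfolding F u_def .
qed

text \<open>Reversal carries the integrality of the coefficients over to the series \<open>F\<close>
  of Newton's identities. A root 0 is lost under reversal and contributes the factor 1 on both
  sides.\<close>

lemma fps_of_reflect_linear_factors:
  "fps_of_poly (reflect_poly (\<Prod>x\<in>#R. [:- x, 1:])) = (\<Prod>x\<in>#R. 1 - fps_const x * fps_X :: complex fps)"
proof (induction R)
  case (add x R)
  have "fps_of_poly (reflect_poly [:- x, 1:]) = 1 - fps_const x * (fps_X :: complex fps)"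
    by (cases "x = 0") (auto simp: reflect_poly_def fps_of_poly_pCons algebra_simps)
  then show ?case using add by (simp add: reflect_poly_mult fps_of_poly_mult del: reflect_poly_pCons mult_pCons_left)
qed simp

text \<open>\<open>F\<close> has constant term 1, so the n-th coefficient of Newton's identity
  expresses the n-th power sum, without division, through earlier ones and the coefficients of
  \<open>F\<close>.\<close>

lemma power_sum_Ints:
  fixes p :: "int poly"
  assumes p: "map_poly of_int p = (\<Prod>x\<in>#R. [:- x, 1:])"
  shows "power_sum R n \<in> \<int>"
proof (induction n rule: less_induct)
  case (less n)
  define F where "F = (\<Prod>x\<in>#R. 1 - fps_const x * fps_X :: complex fps)"
  have F: "F = fps_of_poly (reflect_poly (map_poly of_int p))"
    unfolding F_def p fps_of_reflect_linear_factors ..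
  have FI: "fps_nth F k \<in> \<int>" for k
    unfolding F by (auto simp: coeff_reflect_poly coeff_map_poly)
  have F0: "fps_nth F 0 = 1"
    unfolding F_def by (induction R) auto
  have "Abs_fps (power_sum R) * F = of_nat (size R) * F - fps_X * fps_deriv F"
    unfolding F_def by (rule power_sum_generating_function)
  then have "fps_nth (Abs_fps (power_sum R) * F) n = fps_nth (of_nat (size R) * F - fps_X * fps_deriv F) n"
    by simp
  also have "\<dots> \<in> \<int>"
    by (auto simp: FI fps_X_mult_nth fps_of_nat[symmetric] simp del: fps_of_nat intro!: Ints_mult Ints_diff)
  finally have tot: "(\<Sum>i=0..n. power_sum R i * fps_nth F (n - i)) \<in> \<int>"
    by (simp add: fps_mult_nth)
  have "(\<Sum>i=0..n. power_sum R i * fps_nth F (n - i))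
      = (\<Sum>i\<in>{0..<n}. power_sum R i * fps_nth F (n - i)) + power_sum R n"
    by (simp add: F0 atLeastLessThanSuc_atLeastAtMost[symmetric] sum.atLeastLessThan_Suc)
  moreover have "(\<Sum>i\<in>{0..<n}. power_sum R i * fps_nth F (n - i)) \<in> \<int>"
    using less FI by (intro Ints_sum Ints_mult) auto
  ultimately show ?case using tot by (metis Ints_diff add_diff_cancel_left')
qed

text \<open>The power sums of the roots are bounded integers that satisfy a linear recurrence, hence they
  are eventually periodic; a Vandermonde argument turns the period into \<open>x ^ M = 1\<close>.\<close>

lemma kronecker_roots_of_unity:
  fixes p :: "int poly"
  assumes p: "map_poly of_int p = (\<Prod>x\<in>#R. [:- x, 1:])"
    and R: "\<And>x :: complex. x \<in># R \<Longrightarrow> norm x \<le> 1 \<and> x \<noteq> 0"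
  shows "\<exists>M\<ge>1. \<forall>x\<in>#R. x ^ M = 1"
proof -
  define r where "r = size R"
  let ?q = "\<Prod>x\<in>#R. [:- x, 1:]"
  have deg: "degree ?q = r"
    unfolding r_def
  proof (induction R)
    case (add x R)
    have "(\<Prod>x\<in>#R. [:- x, 1:]) \<noteq> 0" by (auto simp: prod_mset_zero_iff)
    with add show ?case by (simp add: degree_mult_eq del: mult_pCons_left)
  qed simp
  have lead: "coeff ?q r = 1"
    unfolding deg[symmetric] by (induction R) (auto simp: lead_coeff_mult simp del: mult_pCons_left)
  have root: "poly ?q x = 0" if "x \<in># R" for x
    using that by (induction R) auto
  have bound: "norm (power_sum R n) \<le> real r" for n
  proof -
    have "norm (power_sum R n) \<le> (\<Sum>x\<in>#R. norm (x ^ n))"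
      unfolding power_sum_def by (induction R) (auto intro: norm_triangle_le)
    also have "\<dots> \<le> (\<Sum>x\<in>#R. 1)"
      by (intro sum_mset_mono) (auto simp: norm_power R intro!: power_le_one)
    finally show ?thesis by (simp add: r_def)
  qed
  have "\<exists>k::int. power_sum R n = of_int k \<and> k \<in> {- int r..int r}" for n
  proof -
    obtain k :: int where k: "power_sum R n = of_int k"
      using power_sum_Ints[OF p] Ints_cases by blast
    then have "\<bar>of_int k :: real\<bar> \<le> real r" using bound[of n] by simp
    then have "\<bar>k\<bar> \<le> int r" by linarith
    then show ?thesis using k by auto
  qed
  then obtain s where s: "\<And>n. power_sum R n = of_int (s n)" "\<And>n. s n \<in> {- int r..int r}" by metis
  \<comment> \<open>A window of \<open>r\<close> consecutive power sums is a state of the recurrence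
    \<open>rec\<close>, and only finitely many states exist because the sums are integers of modulus
    at most \<open>r\<close>.\<close>
  have "range (\<lambda>n. map (\<lambda>i. s (n + i)) [0..<r]) \<subseteq> {xs. set xs \<subseteq> {- int r..int r} \<and> length xs = r}"
    using s(2) by auto
  then have "finite (range (\<lambda>n. map (\<lambda>i. s (n + i)) [0..<r]))"
    by (rule finite_subset) (simp add: finite_lists_length_eq)
  then obtain n n' where nn: "n < n'" "map (\<lambda>i. s (n + i)) [0..<r] = map (\<lambda>i. s (n' + i)) [0..<r]"
    by (rule finite_range_collision)
  \<comment> \<open>Each root annihilates the polynomial; multiply by \<open>x ^ m\<close> and sum
    over the roots.\<close>
  have rec: "power_sum R (m + r) = - (\<Sum>k<r. coeff ?q k * power_sum R (m + k))" for m
  proof -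
    have "0 = (\<Sum>x\<in>#R. x ^ m * poly ?q x)"
    proof -
      have "(\<Sum>x\<in>#R. x ^ m * poly ?q x) = (\<Sum>x\<in>#R. 0)"
        by (intro arg_cong[of _ _ sum_mset] image_mset_cong) (simp add: root)
      then show ?thesis by simp
    qed
    also have "\<dots> = (\<Sum>x\<in>#R. \<Sum>k\<le>r. coeff ?q k * x ^ (m + k))"
      by (simp add: poly_altdef deg sum_distrib_left power_add algebra_simps)
    also have "\<dots> = (\<Sum>k\<le>r. coeff ?q k * power_sum R (m + k))"
      unfolding power_sum_def by (simp add: sum_mset_sum_swap sum_mset_distrib_left)
    finally show ?thesis
      using lead by (simp add: lessThan_Suc_atMost[symmetric] add_eq_0_iff)
  qed
  have eq: "power_sum R (n + i) = power_sum R (n' + i)" for i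
  proof (induction i rule: less_induct)
    case (less i)
    show ?case
    proof (cases "i < r")
      case True
      then have "map (\<lambda>i. s (n + i)) [0..<r] ! i = map (\<lambda>i. s (n' + i)) [0..<r] ! i" using nn(2) by simp
      then show ?thesis using True s(1) by simp
    next
      case False
      then obtain j where j: "i = j + r" by (metis le_add_diff_inverse2 not_less)
      have "power_sum R (n + j + r) = power_sum R (n' + j + r)"
        unfolding rec using less j by (auto intro!: sum.cong simp: add.assoc)
      then show ?thesis by (simp add: j add.assoc)
    qed
  qed
  define M where "M = n' - n"
  have van: "(\<Sum>x\<in>#R. poly h x * (x ^ n * (x ^ M - 1))) = 0" for h
  proof -
    have "(\<Sum>x\<in>#R. poly h x * (x ^ n * (x ^ M - 1)))
        = (\<Sum>x\<in>#R. \<Sum>k\<le>degree h. coeff h k * (x ^ (n' + k) - x ^ (n + k)))"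
    proof (intro arg_cong[of _ _ sum_mset] image_mset_cong)
      fix x assume "x \<in># R"
      have n': "n' = n + M" using nn by (simp add: M_def)
      show "poly h x * (x ^ n * (x ^ M - 1)) = (\<Sum>k\<le>degree h. coeff h k * (x ^ (n' + k) - x ^ (n + k)))"
        unfolding n' poly_altdef sum_distrib_right by (intro sum.cong) (auto simp: algebra_simps power_add)
    qed
    also have "\<dots> = (\<Sum>k\<le>degree h. coeff h k * (power_sum R (n' + k) - power_sum R (n + k)))"
      unfolding power_sum_def
      by (simp add: sum_mset_sum_swap sum_mset_diff[symmetric] sum_mset_distrib_left)
    finally show ?thesis by (simp add: eq)
  qed
  have "x ^ M = 1" if x: "x \<in># R" for x
  proof -
    \<comment> \<open>Interpolation polynomial that vanishes at all other roots. Inserted in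
      \<open>van\<close> it isolates \<open>x\<close> with its multiplicity, and
      \<open>x ^ n\<close> cancels because \<open>x\<close> is nonzero.\<close>
    define h where "h = (\<Prod>y\<in>set_mset R - {x}. [:- y, 1:])"
    have h0: "poly h y = 0" if "y \<in># R" "y \<noteq> x" for y
      using that by (auto simp: h_def poly_prod)
    have hx: "poly h x \<noteq> 0" by (auto simp: h_def poly_prod)
    have "(\<Sum>y\<in>#R. poly h y * (y ^ n * (y ^ M - 1))) = (\<Sum>y\<in>#R. if y = x then poly h x * (x ^ n * (x ^ M - 1)) else 0)"
      by (intro arg_cong[of _ _ sum_mset] image_mset_cong) (auto simp: h0)
    also have "\<dots> = of_nat (count R x) * (poly h x * (x ^ n * (x ^ M - 1)))"
      by (simp add: sum_mset_delta)
    finally have "of_nat (count R x) * (poly h x * (x ^ n * (x ^ M - 1))) = 0"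
      using van[of h] by simp
    moreover have "count R x \<noteq> 0" using x by simp
    ultimately show ?thesis using hx R[OF x] by simp
  qed
  moreover have "M \<ge> 1" using nn by (simp add: M_def)
  ultimately show ?thesis by blast
qed

section \<open>Polynomials with coefficients -1, 0, 1 and divisors of powers of X^M - 1\<close>

abbreviation (input) unity_poly :: "nat \<Rightarrow> int poly" where
  "unity_poly M \<equiv> monom 1 M - 1"

text \<open>These are the differences of two polynomials with coefficients 0 and 1, that is, of two
  lamp configurations.\<close>

definition small_coeffs :: "int poly \<Rightarrow> bool" where
  "small_coeffs p \<longleftrightarrow> (\<forall>i. coeff p i \<in> {-1, 0, 1})"

lemma of_int_poly_mult:
  "map_poly of_int (p * q) = (map_poly of_int p * map_poly of_int q :: 'a :: comm_ring_1 poly)"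
  by (rule poly_eqI) (simp add: coeff_map_poly coeff_mult)

text \<open>From modulus 2 on, the leading term beats the geometric sum of the lower ones, which is
  at most \<open>norm z ^ d - 1\<close>. Applied to all powers of a number, the bound confines it to
  the unit disc.\<close>

lemma small_coeffs_root_bound:
  fixes z :: complex
  assumes p: "small_coeffs p" "p \<noteq> 0" and z: "poly (map_poly of_int p) z = 0"
  shows "norm z < 2"
proof (rule ccontr)
  assume "\<not> norm z < 2"
  then have z2: "norm z \<ge> 2" by simp
  define d where "d = degree p"
  have lead: "coeff p d = 1 \<or> coeff p d = -1"
    using p unfolding small_coeffs_def d_def by (metis insertE leading_coeff_0_iff singletonD)
  have deg: "degree (map_poly of_int p :: complex poly) = d"
    unfolding d_def by (rule degree_map_poly) auto
  have "0 = (\<Sum>i\<le>d. of_int (coeff p i) * z ^ i)"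
    using z by (simp add: poly_altdef deg coeff_map_poly)
  then have "of_int (coeff p d) * z ^ d = - (\<Sum>i<d. of_int (coeff p i) * z ^ i)"
    by (simp add: lessThan_Suc_atMost[symmetric] add_eq_0_iff2)
  then have "norm (of_int (coeff p d) * z ^ d) = norm (\<Sum>i<d. of_int (coeff p i) * z ^ i)"
    by simp
  also have "\<dots> \<le> (\<Sum>i<d. norm z ^ i)"
  proof (rule sum_norm_le)
    fix i
    have "\<bar>coeff p i\<bar> \<le> 1" using p(1)[unfolded small_coeffs_def, rule_format, of i] by auto
    then have "norm (of_int (coeff p i) :: complex) \<le> 1" by simp
    then show "norm (of_int (coeff p i) * z ^ i) \<le> norm z ^ i"
      by (simp add: norm_mult norm_power mult_left_le_one_le)
  qed
  also have "\<dots> = (norm z ^ d - 1) / (norm z - 1)"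
    using z2 by (subst geometric_sum) auto
  also have "\<dots> \<le> norm z ^ d - 1"
  proof -
    have "1 \<le> norm z ^ d" using z2 by (intro one_le_power) simp
    then have "(norm z ^ d - 1) * 1 \<le> (norm z ^ d - 1) * (norm z - 1)"
      using z2 by (intro mult_left_mono) auto
    then show ?thesis using z2 by (simp add: divide_le_eq)
  qed
  finally show False using lead by (auto simp: norm_mult norm_power)
qed

text \<open>Kronecker's theorem gives \<open>x ^ M = 1\<close> for every root, so over the complex
  numbers each linear factor divides X^M - 1; the exponent \<open>k\<close> takes care of
  multiplicities.\<close>

lemma monic_roots_in_unit_disc_dvd:
  fixes p :: "int poly"
  assumes lead: "lead_coeff p = 1"
    and roots: "\<And>z :: complex. poly (map_poly of_int p) z = 0 \<Longrightarrow> norm z \<le> 1 \<and> z \<noteq> 0"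
  shows "\<exists>M\<ge>1. \<exists>k. p dvd unity_poly M ^ k"
proof -
  let ?p = "map_poly of_int p :: complex poly"
  have deg: "degree ?p = degree p" by (rule degree_map_poly) auto
  have lead': "lead_coeff ?p = 1" using lead by (simp add: deg coeff_map_poly)
  then have "?p \<noteq> 0" by auto
  from alg_closed_imp_factorization[OF this] obtain R where
    R: "size R = degree ?p" "?p = (\<Prod>x\<in>#R. [:- x, 1:])"
    using lead' by auto
  have rt: "poly ?p x = 0" if "x \<in># R" for x
    unfolding R(2) using that by (induction R) auto
  obtain M where M: "M \<ge> 1" "\<And>x. x \<in># R \<Longrightarrow> x ^ M = 1"
    using kronecker_roots_of_unity[OF R(2)] roots rt by blast
  have "(\<Prod>x\<in>#R. [:- x, 1:]) dvd (monom 1 M - 1 :: complex poly) ^ size R"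
    using M(2)
  proof (induction R)
    case (add x R)
    have "[:- x, 1:] dvd (monom 1 M - 1 :: complex poly)"
      using add.prems by (simp add: poly_eq_0_iff_dvd[symmetric] poly_monom)
    then show ?case using add by (simp add: mult_dvd_mono del: mult_pCons_left)
  qed simp
  then have dvdC: "?p dvd (monom 1 M - 1) ^ size R" using R(2) by simp
  \<comment> \<open>Descent to the integers: \<open>p\<close> is monic, so pseudo-division is honest
    division, and a remainder of smaller degree that \<open>p\<close> divides over the complex
    numbers is zero.\<close>
  obtain q r where qr: "pseudo_divmod (unity_poly M ^ size R) p = (q, r)" by fastforce
  have p0: "p \<noteq> 0" using lead by auto
  have eq: "unity_poly M ^ size R = p * q + r" and r: "r = 0 \<or> degree r < degree p"
    using pseudo_divmod[OF p0 qr] lead by auto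
  have "?p dvd map_poly of_int (unity_poly M ^ size R)"
  proof -
    have "map_poly of_int (unity_poly M ^ n) = (monom 1 M - 1 :: complex poly) ^ n" for n
    proof (induction n)
      case (Suc n)
      have "map_poly of_int (unity_poly M) = (monom 1 M - 1 :: complex poly)"
        by (intro poly_eqI) (simp add: coeff_map_poly coeff_diff)
      then show ?case using Suc
        by (simp add: of_int_poly_mult)
    qed auto
    then show ?thesis using dvdC by simp
  qed
  then have "?p dvd map_poly of_int (p * q + r)" by (simp add: eq)
  moreover have "map_poly of_int (p * q + r) = ?p * map_poly of_int q + (map_poly of_int r :: complex poly)"
    unfolding of_int_poly_mult[symmetric] by (rule poly_eqI) (simp add: coeff_map_poly)
  ultimately have "?p dvd map_poly of_int r"
    by (metis dvd_add_right_iff dvd_triv_left)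
  have "r = 0"
  proof (rule ccontr)
    assume "r \<noteq> 0"
    have dr: "degree (map_poly of_int r :: complex poly) = degree r" by (rule degree_map_poly) auto
    have "map_poly of_int r \<noteq> (0 :: complex poly)"
      using \<open>r \<noteq> 0\<close> by (simp add: map_poly_eq_0_iff)
    with \<open>?p dvd map_poly of_int r\<close> have "degree ?p \<le> degree (map_poly of_int r :: complex poly)"
      by (rule dvd_imp_degree_le)
    then show False using r \<open>r \<noteq> 0\<close> deg dr by auto
  qed
  then have "p dvd unity_poly M ^ size R" using eq by simp
  then show ?thesis using M(1) by blast
qed

lemma dvd_smult_iff_unit:
  fixes p :: "int poly"
  assumes "is_unit c" shows "p dvd smult c q \<longleftrightarrow> p dvd q"
proof -
  have "c * c = 1" using assms by (auto simp: abs_if split: if_splits)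
  then show ?thesis by (metis dvd_smult smult_1_left smult_smult)
qed

lemma monom_minus_one_dvd:
  "(unity_poly a) dvd (unity_poly (a * b))"
proof -
  have "monom 1 a - 1 dvd (monom 1 a :: int poly) ^ b - 1"
    by (simp add: power_diff_1_eq)
  then show ?thesis by (simp add: monom_power mult.commute)
qed

text \<open>Merges the exponents found for finitely many elements: periods are multiplied,
  multiplicities added.\<close>

lemma monom_minus_one_power_dvd:
  "unity_poly a ^ k dvd unity_poly (a * b) ^ (k + l)"
  by (rule dvd_trans[OF dvd_power_same[OF monom_minus_one_dvd] le_imp_power_dvd]) simp

text \<open>A primitive element \<open>g\<close> of minimal degree in the rational span of \<open>I\<close> is monic up to sign, and
  the relations in \<open>x ^ N\<close> for all \<open>N\<close> force its roots into the unit disc. Kronecker's theorem then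
  puts \<open>c (x ^ M - 1) ^ k\<close> into \<open>I\<close> for some integer \<open>c\<close>, which is removed by a pigeonhole argument
  modulo \<open>c\<close>.\<close>

lemma ideal_contains_cyclotomic_power:
  fixes I :: "int poly set"
  assumes add: "\<And>f g. f \<in> I \<Longrightarrow> g \<in> I \<Longrightarrow> f + g \<in> I"
    and mult: "\<And>f g. f \<in> I \<Longrightarrow> g * f \<in> I"
    and rel: "\<And>N. N \<ge> 1 \<Longrightarrow> \<exists>P. small_coeffs P \<and> coeff P 0 \<noteq> 0 \<and> pcompose P (monom 1 N) \<in> I"
  shows "\<exists>M\<ge>1. \<exists>k. unity_poly M ^ k \<in> I"
proof -
  have smult: "smult c f \<in> I" if "f \<in> I" for c f
    using mult[OF that, of "[:c:]"] by simp
  have diff: "f - g \<in> I" if "f \<in> I" "g \<in> I" for f g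
    using add[OF that(1) smult[OF that(2), of "-1"]] by simp
  obtain P where P: "small_coeffs P" "coeff P 0 \<noteq> 0" "P \<in> I"
    using rel[of 1] by (auto simp: monom_altdef)
  have unit_of_small: "c = 1 \<or> c = -1" if "c \<in> {-1, 0, 1}" "c \<noteq> 0" for c :: int using that by auto
  have "P \<noteq> 0" using P(2) by auto
  then have leadP: "lead_coeff P = 1 \<or> lead_coeff P = -1"
    using P(1) unit_of_small unfolding small_coeffs_def by (meson leading_coeff_0_iff)
  have P0: "coeff P 0 = 1 \<or> coeff P 0 = -1"
    using P(1,2) unit_of_small unfolding small_coeffs_def by blast
  have "\<exists>p. p \<in> I \<and> p \<noteq> 0" using P(3) \<open>P \<noteq> 0\<close> by blast
  then obtain p where p: "p \<in> I" "p \<noteq> 0" and pmin: "\<And>f. f \<in> I \<Longrightarrow> f \<noteq> 0 \<Longrightarrow> degree p \<le> degree f"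
    using ex_has_least_nat[of "\<lambda>f. f \<in> I \<and> f \<noteq> 0" _ degree] by (metis (mono_tags, lifting))
  \<comment> \<open>The pseudo-remainder lies in \<open>I\<close> and has smaller degree than
    \<open>p\<close>, so minimality forces it to be zero.\<close>
  have pdvd: "\<exists>e. p dvd smult (lead_coeff p ^ e) f" if f: "f \<in> I" for f
  proof -
    obtain q r where qr: "pseudo_divmod f p = (q, r)" by fastforce
    let ?e = "Suc (degree f) - degree p"
    have eq: "smult (lead_coeff p ^ ?e) f = p * q + r" and r: "r = 0 \<or> degree r < degree p"
      using pseudo_divmod[OF p(2) qr] by auto
    have "r = smult (lead_coeff p ^ ?e) f - q * p" using eq by (simp add: mult.commute)
    then have "r \<in> I" using smult[OF f] mult[OF p(1)] diff by simp
    then have "r = 0" using r pmin by force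
    then show ?thesis using eq by (metis add_0_right dvd_triv_left)
  qed
  define g0 where "g0 = primitive_part p"
  have contP: "content P = 1"
  proof -
    have "content P dvd lead_coeff P" by (rule content_dvd_coeff)
    then have "content P dvd 1" using leadP by (metis dvd_minus_iff)
    then have "normalize (content P) = 1" by (rule is_unit_normalize)
    then show ?thesis by (metis normalize_content)
  qed
  obtain e where e: "p dvd smult (lead_coeff p ^ e) P" using pdvd[OF P(3)] by blast
  \<comment> \<open>Gauss's lemma: passing to primitive parts strips the power of
    \<open>lead_coeff p\<close>, and \<open>P\<close> is primitive because its leading coefficient
    is a unit. Hence the leading coefficient of \<open>g0\<close> is a unit too.\<close>
  have "g0 dvd P"
  proof -
    obtain q where q: "smult (lead_coeff p ^ e) P = p * q" using e by blast
    have "primitive_part (smult (lead_coeff p ^ e) P) = g0 * primitive_part q"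
      unfolding q g0_def by (rule primitive_part_mult)
    then have "smult (unit_factor (lead_coeff p ^ e)) P = g0 * primitive_part q"
      using contP by (simp add: primitive_part_smult primitive_part_prim)
    moreover have "is_unit (unit_factor (lead_coeff p ^ e))"
      by (rule unit_factor_is_unit) (use p(2) in auto)
    ultimately show ?thesis
      by (metis dvd_triv_left dvd_smult_iff_unit)
  qed
  then obtain h where h: "P = g0 * h" by blast
  have "lead_coeff P = lead_coeff g0 * lead_coeff h" unfolding h by (rule lead_coeff_mult)
  then have leadg0: "lead_coeff g0 = 1 \<or> lead_coeff g0 = -1"
    using leadP by (metis zmult_eq_1_iff minus_mult_left mult_minus1 equation_minus_iff)
  define c where "c = content p * lead_coeff g0"
  define g where "g = smult (lead_coeff g0) g0"
  have gl: "lead_coeff g = 1" using leadg0 by (auto simp: g_def)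
  have c0: "c \<noteq> 0" using p(2) leadg0 by (auto simp: c_def)
  have pg: "p = smult c g"
    using leadg0 content_times_primitive_part[of p] by (auto simp: c_def g_def g0_def)
  have root: "poly (map_poly of_int f) z = 0" if z: "poly (map_poly of_int g) z = 0" and f: "f \<in> I" for f and z :: complex
  proof -
    obtain e q where "smult (lead_coeff p ^ e) f = p * q" using pdvd[OF f] by blast
    then have "map_poly of_int ([:lead_coeff p ^ e:] * f) = (map_poly of_int ([:c:] * g * q) :: complex poly)"
      by (simp add: pg)
    then have "poly (map_poly of_int ([:lead_coeff p ^ e:] * f)) z = 0"
      using z by (simp add: of_int_poly_mult del: mult_pCons_left)
    then show ?thesis using p(2) by (simp add: of_int_poly_mult map_poly_pCons del: mult_pCons_left)
  qed
  have roots: "norm z \<le> 1 \<and> z \<noteq> 0" if z: "poly (map_poly of_int g) z = 0" for z :: complex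
  proof
    show "z \<noteq> 0"
      using root[OF z P(3)] P(2) by (auto simp: poly_0_coeff_0 coeff_map_poly)
    \<comment> \<open>\<open>z ^ N\<close> is a root of \<open>Q\<close>, because Q(X^N) lies in
      \<open>I\<close> and hence vanishes at \<open>z\<close>.\<close>
    have "norm z ^ N < 2" if N1: "N \<ge> 1" for N
    proof -
      obtain Q where Q: "small_coeffs Q" "coeff Q 0 \<noteq> 0" "pcompose Q (monom 1 N) \<in> I" using rel[OF N1] by blast
      have "map_poly of_int (pcompose Q (monom 1 N)) = pcompose (map_poly of_int Q) (monom (1::complex) N)"
      proof (induction Q)
        case (pCons a Q)
        have "map_poly of_int (pcompose (pCons a Q) (monom 1 N)) =
              map_poly of_int [:a:] + (map_poly of_int (monom 1 N * pcompose Q (monom 1 N)) :: complex poly)"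
          unfolding pcompose_pCons by (rule poly_eqI) (simp add: coeff_map_poly)
        then show ?case using pCons by (simp add: of_int_poly_mult pcompose_pCons map_poly_pCons map_poly_monom)
      qed simp
      then have "poly (map_poly of_int Q) (z ^ N) = 0"
        using root[OF z Q(3)] by (simp add: poly_pcompose poly_monom)
      moreover have "Q \<noteq> 0" using Q(2) by auto
      ultimately have "norm (z ^ N) < 2" using small_coeffs_root_bound[OF Q(1)] by blast
      then show ?thesis by (simp only: norm_power)
    qed
    then show "norm z \<le> 1"
    proof (rule_tac ccontr)
      assume *: "\<And>N. N \<ge> 1 \<Longrightarrow> norm z ^ N < 2" and "\<not> norm z \<le> 1"
      then obtain N where "2 < norm z ^ N" using real_arch_pow[of "norm z" 2] by auto
      then show False using *[of N] by (cases N) auto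
    qed
  qed
  obtain M k where M: "M \<ge> 1" "g dvd unity_poly M ^ k"
    using monic_roots_in_unit_disc_dvd[OF gl roots] by blast
  \<comment> \<open>The ideal quotient of \<open>I\<close> by the power of X^M - 1. It contains
    \<open>P\<close>, which is monic up to sign, and the nonzero constant \<open>c\<close>, so the
    integer polynomials modulo \<open>J\<close> form a finite ring.\<close>
  define J where "J = {f. f * unity_poly M ^ k \<in> I}"
  have J_add: "f + f' \<in> J" if "f \<in> J" "f' \<in> J" for f f'
    using that add by (auto simp: J_def distrib_right)
  have J_mult: "f' * f \<in> J" if "f \<in> J" for f f'
    using mult[of "f * unity_poly M ^ k" f'] that by (simp add: J_def mult.assoc)
  have J_diff: "f - f' \<in> J" if "f \<in> J" "f' \<in> J" for f f'
    using that diff by (auto simp: J_def left_diff_distrib)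
  have PJ: "P \<in> J" using mult[OF P(3), of "unity_poly M ^ k"] by (simp add: J_def mult.commute)
  have cJ: "[:c:] \<in> J"
  proof -
    obtain h where "unity_poly M ^ k = g * h" using M(2) by blast
    then have "[:c:] * unity_poly M ^ k = h * p" by (simp add: pg mult.commute)
    then show ?thesis using mult[OF p(1), of h] by (simp only: J_def mem_Collect_eq)
  qed
  \<comment> \<open>Representatives modulo \<open>J\<close>: the degree is reduced by
    \<open>P\<close>, the coefficients by \<open>c\<close>. The interval is symmetric because
    \<open>mod c\<close> takes the sign of \<open>c\<close>.\<close>
  define R where "R = {f. (\<forall>i\<ge>degree P. coeff f i = 0) \<and> (\<forall>i. coeff f i \<in> {-\<bar>c\<bar>..\<bar>c\<bar>})}"
  have finR: "finite R"
  proof (rule finite_subset)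
    show "R \<subseteq> Poly ` {xs. set xs \<subseteq> {-\<bar>c\<bar>..\<bar>c\<bar>} \<and> length xs \<le> degree P}"
    proof
      fix f assume f: "f \<in> R"
      have "length (coeffs f) \<le> degree P"
      proof (cases "f = 0")
        case False
        then have "degree f < degree P" using f leading_coeff_0_iff unfolding R_def by (metis (mono_tags, lifting) mem_Collect_eq not_le)
        then show ?thesis using False by (simp add: length_coeffs)
      qed simp
      moreover have "set (coeffs f) \<subseteq> {-\<bar>c\<bar>..\<bar>c\<bar>}"
      proof
        fix x assume "x \<in> set (coeffs f)"
        then have "x \<in> range (coeff f)" by (simp add: range_coeff)
        then show "x \<in> {-\<bar>c\<bar>..\<bar>c\<bar>}" using f unfolding R_def by auto
      qed
      ultimately show "f \<in> Poly ` {xs. set xs \<subseteq> {-\<bar>c\<bar>..\<bar>c\<bar>} \<and> length xs \<le> degree P}"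
        by (intro image_eqI[of _ _ "coeffs f"]) auto
    qed
  qed (simp add: finite_lists_length_le)
  have "\<exists>r\<in>R. f - r \<in> J" for f
  proof -
    obtain q r where qr: "pseudo_divmod f P = (q, r)" by fastforce
    let ?e = "lead_coeff P ^ (Suc (degree f) - degree P)"
    have eq: "smult ?e f = P * q + r" and r: "r = 0 \<or> degree r < degree P"
      using pseudo_divmod[OF \<open>P \<noteq> 0\<close> qr] by auto
    have "?e * ?e = 1" using leadP by (auto simp: power_mult_distrib[symmetric])
    then have f: "f = smult ?e q * P + smult ?e r"
      using arg_cong[OF eq, of "smult ?e"] by (simp add: smult_add_right mult.commute)
    define r1 where "r1 = smult ?e r"
    define r2 where "r2 = map_poly (\<lambda>x. x mod c) r1"
    define r3 where "r3 = map_poly (\<lambda>x. x div c) r1"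
    have r13: "r1 - r2 = r3 * [:c:]"
      by (rule poly_eqI) (simp add: r2_def r3_def coeff_map_poly minus_mod_eq_mult_div)
    have "f - r2 = smult ?e q * P + r3 * [:c:]"
      unfolding r13[symmetric] using f by (simp add: r1_def)
    then have "f - r2 \<in> J" using J_add[OF J_mult[OF PJ] J_mult[OF cJ]] by (simp only:)
    moreover have "r2 \<in> R"
    proof -
      have "coeff r i = 0" if "i \<ge> degree P" for i
        using r that coeff_eq_0[of r i] by auto
      moreover have "x mod c \<in> {-\<bar>c\<bar>..\<bar>c\<bar>}" for x :: int
        using abs_mod_less[OF c0, of x] by auto
      ultimately show ?thesis by (simp add: R_def r2_def r1_def coeff_map_poly)
    qed
    ultimately show ?thesis by blast
  qed
  then obtain \<rho> where \<rho>: "\<And>f. \<rho> f \<in> R" "\<And>f. f - \<rho> f \<in> J" by metis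
  have "range (\<lambda>n. \<rho> (monom 1 n)) \<subseteq> R" using \<rho> by auto
  then have "finite (range (\<lambda>n. \<rho> (monom 1 n)))" using finR finite_subset by blast
  then obtain i j where ij: "i < j" "\<rho> (monom 1 i) = \<rho> (monom 1 j)"
    by (rule finite_range_collision)
  \<comment> \<open>X is invertible modulo \<open>J\<close>: the constant coefficient of
    \<open>P\<close> is a unit and is congruent to a multiple of X.\<close>
  have cancel: "f \<in> J" if xf: "monom 1 i * f \<in> J" for f i
    using xf
  proof (induction i)
    case (Suc i)
    obtain p0 h where ph: "P = pCons p0 h" by (cases P)
    let ?f = "monom 1 i * f"
    have "monom 1 (Suc i) * f = [:0, 1:] * ?f" by (simp add: monom_Suc)
    then have x: "[:0, 1:] * ?f \<in> J" using Suc.prems by simp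
    have "P = [:p0:] + h * [:0, 1:]" by (simp add: ph)
    then have "smult p0 ?f = ?f * P - h * ([:0, 1:] * ?f)" by (simp add: algebra_simps)
    then have "smult p0 ?f \<in> J" using J_diff[OF J_mult[OF PJ] J_mult[OF x]] by simp
    then have "smult p0 (smult p0 ?f) \<in> J" using J_mult[of "smult p0 ?f" "[:p0:]"] by simp
    moreover have "p0 * p0 = 1" using P0 ph by auto
    ultimately have "?f \<in> J" by simp
    then show ?case by (rule Suc.IH)
  qed simp
  define L where "L = j - i"
  have "monom 1 j - monom 1 i \<in> J"
    using J_diff[OF \<rho>(2)[of "monom 1 j"] \<rho>(2)[of "monom 1 i"]] ij(2) by simp
  moreover have "monom 1 j - monom 1 i = monom 1 i * unity_poly L"
    using ij(1) by (simp add: L_def mult_monom right_diff_distrib)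
  ultimately have L: "L \<ge> 1" "unity_poly L \<in> J" using cancel ij(1) by (auto simp: L_def)
  have "unity_poly L * unity_poly M ^ k \<in> I" using L(2) by (simp add: J_def)
  moreover have "unity_poly L * unity_poly M ^ k dvd unity_poly (L * M) ^ Suc k"
    using monom_minus_one_dvd[of L M] monom_minus_one_dvd[of M L]
    by (auto intro!: mult_dvd_mono dvd_power_same simp: mult.commute)
  ultimately have "unity_poly (L * M) ^ Suc k \<in> I"
    using mult by (metis dvdE mult.commute)
  moreover have "L * M \<ge> 1" using L(1) M(1) by (simp add: Suc_leI)
  ultimately show ?thesis by blast
qed

section \<open>Cuts\<close>

abbreviation component :: "'a sgraph \<Rightarrow> 'a set \<Rightarrow> 'a \<Rightarrow> 'a set" where
  "component X U x \<equiv> (adjacency X \<inter> U \<times> U)\<^sup>* `` {x}"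

lemma component_subset: "x \<in> U \<Longrightarrow> component X U x \<subseteq> U"
proof
  fix y assume x: "x \<in> U" and "y \<in> component X U x"
  then have "(x, y) \<in> (adjacency X \<inter> U \<times> U)\<^sup>*" by simp
  then show "y \<in> U" by (induction rule: rtrancl_induct) (use x in auto)
qed

lemma component_mono: "U \<subseteq> U' \<Longrightarrow> component X U x \<subseteq> component X U' x"
  by (intro Image_mono rtrancl_mono) auto

lemma component_eq:
  assumes "sym (adjacency X)" "y \<in> component X U x"
  shows "component X U y = component X U x"
proof -
  have s: "sym ((adjacency X \<inter> U \<times> U)\<^sup>*)"
    using assms(1) by (intro sym_rtrancl) (auto simp: sym_def)
  then have "(y, x) \<in> (adjacency X \<inter> U \<times> U)\<^sup>*" "(x, y) \<in> (adjacency X \<inter> U \<times> U)\<^sup>*"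
    using assms(2) by (auto dest: symD)
  then show ?thesis by (auto intro: rtrancl_trans)
qed

lemma induced_components_disjoint:
  assumes "sym (adjacency X)"
  shows "pairwise disjnt (induced_components X U)"
proof (rule pairwiseI)
  fix K K' assume K: "K \<in> induced_components X U" "K' \<in> induced_components X U" "K \<noteq> K'"
  then obtain x x' where x: "K = component X U x" "K' = component X U x'"
    unfolding induced_components_def by blast
  show "disjnt K K'"
  proof (rule ccontr)
    assume "\<not> disjnt K K'"
    then obtain y where "y \<in> K" "y \<in> K'" by (auto simp: disjnt_def)
    then have "component X U y = K" "component X U y = K'"
      using component_eq[OF assms] x by metis+
    then show False using K(3) by simp
  qed
qed

lemma cut_witness:
  assumes "finite F"
  obtains C where "C \<subseteq> F" "card C = cut X F" "\<And>x. x \<in> F - C \<Longrightarrow> 2 * card (component X (F - C) x) \<le> card F"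
proof -
  let ?A = "{C. C \<subseteq> F \<and> (\<forall>K\<in>induced_components X (F - C). real (card K) \<le> real (card F) / 2)}"
  have "F \<in> ?A" by (simp add: induced_components_def)
  moreover have "finite ?A" by (rule finite_subset[of _ "Pow F"]) (use assms in auto)
  ultimately have "cut X F \<in> card ` ?A" unfolding cut_def by (intro Min_in) auto
  then obtain C where C: "C \<in> ?A" "cut X F = card C" by blast
  have "2 * card (component X (F - C) x) \<le> card F" if "x \<in> F - C" for x
  proof -
    have "component X (F - C) x \<in> induced_components X (F - C)"
      using that unfolding induced_components_def by blast
    then have "real (card (component X (F - C) x)) \<le> real (card F) / 2" using C(1) by blast
    then show ?thesis by linarith
  qed
  then show thesis using C by (intro that[of C]) auto
qed

lemma cut_le:
  assumes "finite F" "C \<subseteq> F" "\<And>x. x \<in> F - C \<Longrightarrow> 2 * card (component X (F - C) x) \<le> card F"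
  shows "cut X F \<le> card C"
proof -
  have "real (card K) \<le> real (card F) / 2" if K: "K \<in> induced_components X (F - C)" for K
  proof -
    obtain x where "x \<in> F - C" "K = component X (F - C) x"
      using K by (auto simp: induced_components_def)
    with assms(3)[of x] have "2 * card K \<le> card F" by simp
    then show ?thesis by linarith
  qed
  moreover have "finite {C. C \<subseteq> F \<and> (\<forall>K\<in>induced_components X (F - C). real (card K) \<le> real (card F) / 2)}"
    by (rule finite_subset[of _ "Pow F"]) (use assms in auto)
  ultimately show ?thesis
    unfolding cut_def using assms(2) by (intro Min_le) auto
qed

lemma cut_le_sep:
  assumes "F \<subseteq> vertices X" "finite F" "card F \<le> v"
  shows "cut X F \<le> sep X v"
  unfolding sep_def by (rule cSUP_upper[OF _ sep_bdd_above]) (use assms in auto)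

lemma sep_le:
  assumes "\<And>F. F \<subseteq> vertices X \<Longrightarrow> finite F \<Longrightarrow> card F \<le> v \<Longrightarrow> cut X F \<le> b"
  shows "sep X v \<le> b"
  unfolding sep_def by (rule cSUP_least) (use assms in auto)

text \<open>Each round cuts only the components that are still too large. They are disjoint, so
  there are at most \<open>2 ^ Suc k\<close> of them, and each costs at most \<open>sep X v\<close>;
  the total at most doubles. Cuts finer than halving serve \<open>congestion_bound\<close>, which
  compares the pieces with a subset of \<open>F\<close>.\<close>

lemma iterated_cut:
  assumes sym: "sym (adjacency X)" and F: "F \<subseteq> vertices X" "finite F" "card F \<le> v"
  shows "\<exists>C\<subseteq>F. card C \<le> 2 ^ Suc k * sep X v \<and> (\<forall>x\<in>F - C. 2 ^ k * card (component X (F - C) x) \<le> card F)"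
proof (induction k)
  case 0
  have "card (component X F x) \<le> card F" if "x \<in> F" for x
    using component_subset[OF that] F(2) by (rule card_mono[rotated])
  then show ?case by (intro exI[of _ "{}"]) auto
next
  case (Suc k)
  let ?s = "sep X v"
  obtain C where C: "C \<subseteq> F" "card C \<le> 2 ^ Suc k * ?s"
    "\<And>x. x \<in> F - C \<Longrightarrow> 2 ^ k * card (component X (F - C) x) \<le> card F"
  proof -
    from Suc obtain C where "C \<subseteq> F \<and> card C \<le> 2 ^ Suc k * sep X v \<and>
        (\<forall>x\<in>F - C. 2 ^ k * card (component X (F - C) x) \<le> card F)"
      by (elim exE)
    then show thesis by (intro that[of C]) simp_all
  qed
  define B where "B = {K \<in> induced_components X (F - C). 2 ^ Suc k * card K > card F}"
  have KF: "K \<subseteq> F - C" if "K \<in> B" for K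
    using that component_subset[of _ "F - C" X] unfolding B_def induced_components_def by blast
  have finB: "finite B" by (rule finite_subset[of _ "Pow F"]) (use KF F(2) in auto)
  have finK: "finite K" if "K \<in> B" for K using KF[OF that] F(2) finite_subset by blast
  have "\<exists>D. D \<subseteq> K \<and> card D \<le> ?s \<and> (\<forall>x\<in>K - D. 2 * card (component X (K - D) x) \<le> card K)" if K: "K \<in> B" for K
  proof -
    obtain D where D: "D \<subseteq> K" "card D = cut X K" "\<And>x. x \<in> K - D \<Longrightarrow> 2 * card (component X (K - D) x) \<le> card K"
      using cut_witness[OF finK[OF K]] by blast
    have "K \<subseteq> F" using KF[OF K] by blast
    then have "card K \<le> v" using card_mono[OF F(2), of K] F(3) by simp
    then have "cut X K \<le> ?s" using KF[OF K] F finK[OF K] by (intro cut_le_sep) auto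
    then show ?thesis using D by (intro exI[of _ D]) simp
  qed
  then obtain D where D: "\<And>K. K \<in> B \<Longrightarrow> D K \<subseteq> K" "\<And>K. K \<in> B \<Longrightarrow> card (D K) \<le> ?s"
    "\<And>K x. K \<in> B \<Longrightarrow> x \<in> K - D K \<Longrightarrow> 2 * card (component X (K - D K) x) \<le> card K"
    by metis
  have cardB: "card B \<le> 2 ^ Suc k"
  proof (cases "card F = 0")
    case True
    then have "F = {}" using F(2) by simp
    then have "B = {}" unfolding B_def induced_components_def by simp
    then show ?thesis by simp
  next
    case False
    have "card B * card F = (\<Sum>K\<in>B. card F)" by simp
    also have "\<dots> \<le> (\<Sum>K\<in>B. 2 ^ Suc k * card K)" by (intro sum_mono) (auto simp: B_def)
    also have "\<dots> = 2 ^ Suc k * (\<Sum>K\<in>B. card K)" by (simp add: sum_distrib_left)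
    also have "(\<Sum>K\<in>B. card K) = card (\<Union>B)"
    proof (rule card_Union_disjoint[symmetric])
      show "pairwise disjnt B"
        by (rule pairwise_subset[OF induced_components_disjoint[OF sym]]) (auto simp: B_def)
    qed (rule finK)
    also have "\<dots> \<le> card F" using KF F(2) by (intro card_mono) auto
    finally show ?thesis using False by simp
  qed
  define C' where "C' = C \<union> (\<Union>K\<in>B. D K)"
  have "card C' \<le> card C + card (\<Union>K\<in>B. D K)" unfolding C'_def by (rule card_Un_le)
  also have "card (\<Union>K\<in>B. D K) \<le> (\<Sum>K\<in>B. card (D K))" by (rule card_UN_le[OF finB])
  also have "\<dots> \<le> (\<Sum>K\<in>B. ?s)" by (intro sum_mono D(2))
  also have "\<dots> \<le> 2 ^ Suc k * ?s" using cardB by simp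
  finally have "card C' \<le> 2 ^ Suc (Suc k) * ?s" using C(2) by simp
  moreover have "C' \<subseteq> F" using C(1) D(1) KF unfolding C'_def by blast
  moreover have "2 ^ Suc k * card (component X (F - C') x) \<le> card F" if x: "x \<in> F - C'" for x
  proof -
    let ?K = "component X (F - C) x"
    have x': "x \<in> F - C" using x by (auto simp: C'_def)
    have K: "?K \<in> induced_components X (F - C)" using x' unfolding induced_components_def by blast
    have finK': "finite ?K" using component_subset[OF x', of X] F(2) by (meson finite_Diff finite_subset)
    show ?thesis
    proof (cases "?K \<in> B")
      case False
      then have "2 ^ Suc k * card ?K \<le> card F" using K by (simp add: B_def)
      moreover have "card (component X (F - C') x) \<le> card ?K"
        by (intro card_mono finK' component_mono) (auto simp: C'_def)
      ultimately show ?thesis by (meson le_trans mult_le_mono2)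
    next
      case True
      have xK: "x \<in> ?K - D ?K" using True x by (auto simp: C'_def)
      \<comment> \<open>A path that avoids \<open>C'\<close> cannot leave \<open>?K\<close> without
        meeting \<open>C\<close>, and it avoids the separator \<open>D ?K\<close> as well.\<close>
      have "component X (F - C') x \<subseteq> component X (?K - D ?K) x"
      proof
        fix y assume "y \<in> component X (F - C') x"
        then have "(x, y) \<in> (adjacency X \<inter> (F - C') \<times> (F - C'))\<^sup>*" by simp
        then have "(x, y) \<in> (adjacency X \<inter> (?K - D ?K) \<times> (?K - D ?K))\<^sup>* \<and> y \<in> ?K - D ?K"
        proof (induction rule: rtrancl_induct)
          case base
          then show ?case using xK by simp
        next
          case (step y z)
          have "(y, z) \<in> adjacency X \<inter> (F - C) \<times> (F - C)" using step.hyps(2) by (auto simp: C'_def)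
          then have "z \<in> ?K" using step.IH by (auto intro: rtrancl_into_rtrancl)
          moreover have "z \<notin> D ?K" using step.hyps(2) True by (auto simp: C'_def)
          ultimately have "(y, z) \<in> adjacency X \<inter> (?K - D ?K) \<times> (?K - D ?K)" using step by blast
          then show ?case using step.IH by (auto intro: rtrancl_into_rtrancl)
        qed
        then show "y \<in> component X (?K - D ?K) x" by simp
      qed
      then have "card (component X (F - C') x) \<le> card (component X (?K - D ?K) x)"
        using component_subset[OF xK, of X] finK' by (intro card_mono) (auto intro: finite_subset)
      then have "2 * card (component X (F - C') x) \<le> card ?K" using D(3)[OF True xK] by linarith
      then have "2 ^ k * (2 * card (component X (F - C') x)) \<le> 2 ^ k * card ?K" by (rule mult_le_mono2)
      also have "\<dots> \<le> card F" by (rule C(3)[OF x'])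
      finally show ?thesis by simp
    qed
  qed
  ultimately show ?case by blast
qed

text \<open>\<open>B x y\<close> is a set that contains a path from \<open>x\<close> to \<open>y\<close>, and \<open>T\<close> bounds the number of these paths
  through a vertex. A set \<open>C\<close> that cuts \<open>F\<close> into pieces of size at most \<open>card I / 2\<close> meets at least half
  of the paths.\<close>

lemma congestion_bound:
  assumes sym: "sym (adjacency X)" and F: "F \<subseteq> vertices X" "finite F" "card F \<le> v"
    and I: "I \<subseteq> F" "card F \<le> L * card I" and k: "2 * L \<le> 2 ^ k"
    and path: "\<And>x y C. x \<in> I \<Longrightarrow> y \<in> I \<Longrightarrow> C \<subseteq> F \<Longrightarrow> B x y \<inter> C = {} \<Longrightarrow> y \<in> component X (F - C) x"
    and start: "\<And>x y. x \<in> I \<Longrightarrow> y \<in> I \<Longrightarrow> x \<in> B x y"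
    and T: "\<And>c. c \<in> F \<Longrightarrow> card {(x, y) \<in> I \<times> I. c \<in> B x y} \<le> T"
  shows "card I ^ 2 \<le> 2 ^ (k + 2) * (sep X v * T)"
proof -
  obtain C where C: "C \<subseteq> F" "card C \<le> 2 ^ Suc k * sep X v"
    "\<And>x. x \<in> F - C \<Longrightarrow> 2 ^ k * card (component X (F - C) x) \<le> card F"
  proof -
    from iterated_cut[OF sym F, of k] obtain C where "C \<subseteq> F \<and> card C \<le> 2 ^ Suc k * sep X v \<and>
        (\<forall>x\<in>F - C. 2 ^ k * card (component X (F - C) x) \<le> card F)"
      by (elim exE)
    then show thesis by (intro that[of C]) simp_all
  qed
  have finI: "finite I" using I(1) F(2) finite_subset by blast
  have finC: "finite C" using C(1) F(2) finite_subset by blast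
  have comp: "2 * card (component X (F - C) x) \<le> card I" if x: "x \<in> I - C" for x
  proof (cases "L = 0")
    case True
    then show ?thesis using I F(2) x by auto
  next
    case False
    have "2 * L * card (component X (F - C) x) \<le> 2 ^ k * card (component X (F - C) x)"
      using k by (rule mult_le_mono1)
    also have "\<dots> \<le> L * card I" using C(3)[of x] x I by auto
    finally show ?thesis using False by (simp add: mult.assoc mult.left_commute)
  qed
  have fincomp: "finite (component X (F - C) x)" if "x \<in> I - C" for x
  proof (rule finite_subset)
    show "component X (F - C) x \<subseteq> F - C" using that I(1) by (intro component_subset) auto
  qed (use F(2) in simp)
  let ?P = "Sigma (I - C) (\<lambda>x. component X (F - C) x)"
  let ?Q = "\<Union>c\<in>C. {(x, y) \<in> I \<times> I. c \<in> B x y}"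
  have cover: "I \<times> I \<subseteq> ?P \<union> ?Q"
  proof (rule subrelI)
    fix x y assume "(x, y) \<in> I \<times> I"
    then have xy: "x \<in> I" "y \<in> I" by auto
    show "(x, y) \<in> ?P \<union> ?Q"
    proof (cases "B x y \<inter> C = {}")
      case True
      moreover have "x \<notin> C" using True start[OF xy] by blast
      ultimately have "(x, y) \<in> ?P" using path[OF xy C(1)] xy(1) by simp
      then show ?thesis by (rule UnI1)
    next
      case False
      then have "(x, y) \<in> ?Q" using xy by auto
      then show ?thesis by (rule UnI2)
    qed
  qed
  have finP: "finite ?P" using finI fincomp by (intro finite_SigmaI) auto
  have finQ: "finite ?Q" by (rule finite_subset[of _ "I \<times> I"]) (use finI in auto)
  have "card I ^ 2 = card (I \<times> I)" by (simp add: power2_eq_square card_cartesian_product)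
  also have "\<dots> \<le> card (?P \<union> ?Q)" using cover finP finQ by (intro card_mono) auto
  also have "\<dots> \<le> card ?P + card ?Q" by (rule card_Un_le)
  finally have "2 * card I ^ 2 \<le> 2 * card ?P + 2 * card ?Q" by simp
  moreover have "2 * card ?P \<le> card I ^ 2"
  proof -
    have "card ?P = (\<Sum>x\<in>I - C. card (component X (F - C) x))"
      using finI fincomp by (intro card_SigmaI) auto
    then have "2 * card ?P = (\<Sum>x\<in>I - C. 2 * card (component X (F - C) x))" by (simp add: sum_distrib_left)
    also have "\<dots> \<le> (\<Sum>x\<in>I - C. card I)" by (intro sum_mono comp)
    also have "\<dots> \<le> card I * card I" using finI by (simp add: card_mono)
    finally show ?thesis by (simp add: power2_eq_square)
  qed
  moreover have "card ?Q \<le> 2 ^ Suc k * sep X v * T"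
  proof -
    have "card ?Q \<le> (\<Sum>c\<in>C. card {(x, y) \<in> I \<times> I. c \<in> B x y})" by (rule card_UN_le[OF finC])
    also have "\<dots> \<le> (\<Sum>c\<in>C. T)" using C(1) T by (intro sum_mono) auto
    also have "\<dots> = card C * T" by simp
    also have "\<dots> \<le> 2 ^ Suc k * sep X v * T" using C(2) by (rule mult_le_mono1)
    finally show ?thesis .
  qed
  ultimately show ?thesis by (simp add: mult.assoc)
qed

section \<open>Word balls\<close>

primrec word_ball :: "('a, 'm) monoid_scheme \<Rightarrow> 'a set \<Rightarrow> nat \<Rightarrow> 'a set" where
  "word_ball G S 0 = {\<one>\<^bsub>G\<^esub>}"
| "word_ball G S (Suc n) = word_ball G S n \<union>
     (\<lambda>(g, s). g \<otimes>\<^bsub>G\<^esub> s) ` (word_ball G S n \<times> (S \<union> m_inv G ` S))"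

context group begin

lemma word_ball_carrier: "S \<subseteq> carrier G \<Longrightarrow> word_ball G S n \<subseteq> carrier G"
  by (induction n) auto

lemma word_ball_closed: "S \<subseteq> carrier G \<Longrightarrow> g \<in> word_ball G S n \<Longrightarrow> g \<in> carrier G"
  using word_ball_carrier by blast

lemma finite_word_ball: "finite S \<Longrightarrow> finite (word_ball G S n)"
  by (induction n) auto

lemma word_ball_mono: "m \<le> n \<Longrightarrow> word_ball G S m \<subseteq> word_ball G S n"
  by (induction n arbitrary: m) (auto simp: le_Suc_eq)

lemma word_ball_one: "\<one> \<in> word_ball G S n"
  by (induction n) auto

lemma word_ball_SucI:
  "g \<in> word_ball G S n \<Longrightarrow> s \<in> S \<union> m_inv G ` S \<Longrightarrow> g \<otimes> s \<in> word_ball G S (Suc n)"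
  by (auto intro!: image_eqI[of _ "\<lambda>(g, s). g \<otimes> s" "(g, s)"])

lemma word_ball_SucE:
  assumes "g \<in> word_ball G S (Suc n)"
  obtains "g \<in> word_ball G S n" | h s where "h \<in> word_ball G S n" "s \<in> S \<union> m_inv G ` S" "g = h \<otimes> s"
  using assms by auto

lemma word_ball_letter:
  assumes "S \<subseteq> carrier G" "s \<in> S \<union> m_inv G ` S" shows "s \<in> word_ball G S 1"
proof -
  have "s \<in> carrier G" using assms by auto
  then show ?thesis using word_ball_SucI[OF word_ball_one assms(2), of 0] by simp
qed

lemma word_ball_mult:
  assumes S: "S \<subseteq> carrier G" and g: "g \<in> word_ball G S m" and h: "h \<in> word_ball G S n"
  shows "g \<otimes> h \<in> word_ball G S (m + n)"
  using h
proof (induction n arbitrary: h)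
  case 0
  then show ?case using g word_ball_closed[OF S g] by simp
next
  case (Suc n)
  from Suc.prems show ?case
  proof (cases rule: word_ball_SucE)
    case 1
    then show ?thesis using Suc.IH word_ball_mono[of "m + n" "m + Suc n"] by auto
  next
    case (2 k s)
    have "s \<in> carrier G" "k \<in> carrier G" "g \<in> carrier G" using 2 S g word_ball_closed[OF S] by auto
    then have "g \<otimes> h = (g \<otimes> k) \<otimes> s" using 2 by (simp add: m_assoc)
    then show ?thesis using word_ball_SucI[OF Suc.IH[OF 2(1)] 2(2)] by simp
  qed
qed

lemma word_ball_inv:
  assumes S: "S \<subseteq> carrier G" and g: "g \<in> word_ball G S n"
  shows "inv g \<in> word_ball G S n"
  using g
proof (induction n arbitrary: g)
  case 0
  then show ?case by simp
next
  case (Suc n)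
  from Suc.prems show ?case
  proof (cases rule: word_ball_SucE)
    case 1
    then show ?thesis using Suc.IH by simp
  next
    case (2 k s)
    have c: "s \<in> carrier G" "k \<in> carrier G" using 2 S word_ball_closed[OF S] by auto
    have "inv s \<in> S \<union> m_inv G ` S" using 2(2) S by (auto simp: subset_iff)
    then have "inv s \<otimes> inv k \<in> word_ball G S (1 + n)"
      using Suc.IH[OF 2(1)] by (intro word_ball_mult[OF S] word_ball_letter[OF S])
    then show ?thesis using 2 c by (simp add: inv_mult_group)
  qed
qed

lemma word_ball_pow:
  assumes "S \<subseteq> carrier G" "g \<in> word_ball G S n"
  shows "g [^] k \<in> word_ball G S (k * n)"
proof (induction k)
  case (Suc k)
  then show ?case using word_ball_mult[OF assms(1) Suc assms(2)] by (simp add: add.commute)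
qed simp

lemma word_ball_int_pow:
  fixes k :: int
  assumes "S \<subseteq> carrier G" "g \<in> word_ball G S n"
  shows "g [^] k \<in> word_ball G S (nat \<bar>k\<bar> * n)"
proof -
  have g: "g \<in> carrier G" using word_ball_closed assms by blast
  show ?thesis
  proof (cases k rule: int_cases2)
    case (nonneg n)
    then show ?thesis using word_ball_pow[OF assms] by (simp add: int_pow_int)
  next
    case (nonpos n)
    then show ?thesis using word_ball_inv[OF assms(1) word_ball_pow[OF assms]] g
      by (simp add: int_pow_neg int_pow_int)
  qed
qed

lemma word_ball_subst:
  assumes T: "T \<subseteq> carrier G" and S: "S \<subseteq> word_ball G T L" and g: "g \<in> word_ball G S n"
  shows "g \<in> word_ball G T (L * n)"
  using g
proof (induction n arbitrary: g)
  case 0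
  then show ?case by simp
next
  case (Suc n)
  from Suc.prems show ?case
  proof (cases rule: word_ball_SucE)
    case 1
    then show ?thesis using Suc.IH word_ball_mono[of "L * n" "L * Suc n"] by auto
  next
    case (2 k s)
    have "s \<in> word_ball G T L" using 2(2) S word_ball_inv[OF T] by auto
    then show ?thesis using word_ball_mult[OF T Suc.IH[OF 2(1)]] 2(3) by (simp add: add.commute)
  qed
qed

lemma word_ball_generate_ex:
  assumes S: "S \<subseteq> carrier G" and g: "g \<in> generate G S"
  shows "\<exists>n. g \<in> word_ball G S n"
  using g
proof (induction rule: generate.induct)
  case one
  then show ?case using word_ball_one by blast
next
  case (incl h)
  then show ?case using word_ball_letter[OF S] by blast
next
  case (inv h)
  then show ?case using word_ball_letter[OF S] by blast
next
  case (eng h1 h2)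
  then show ?case using word_ball_mult[OF S] by blast
qed

lemma finite_subset_word_ball:
  assumes S: "S \<subseteq> carrier G" and T: "finite T" "T \<subseteq> generate G S"
  shows "\<exists>n. T \<subseteq> word_ball G S n"
  using T
proof (induction T rule: finite_induct)
  case (insert x T)
  then obtain n where "T \<subseteq> word_ball G S n" by auto
  moreover obtain m where "x \<in> word_ball G S m"
    using word_ball_generate_ex[OF S] insert.prems by blast
  ultimately have "insert x T \<subseteq> word_ball G S (m + n)"
    using subsetD[OF word_ball_mono[of n "m + n"]] subsetD[OF word_ball_mono[of m "m + n"]] by auto
  then show ?case by blast
qed simp

lemma cayley_adjacency_iff:
  assumes S: "S \<subseteq> carrier G"
  shows "(g, h) \<in> adjacency (cayley_graph G S) \<longleftrightarrow>
    g \<in> carrier G \<and> h \<in> carrier G \<and> g \<noteq> h \<and> (\<exists>s\<in>S \<union> m_inv G ` S. h = g \<otimes> s)"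
proof -
  have "(\<exists>s\<in>S. h = g \<otimes> s \<or> g = h \<otimes> s) \<longleftrightarrow> (\<exists>s\<in>S \<union> m_inv G ` S. h = g \<otimes> s)"
    if "g \<in> carrier G" "h \<in> carrier G"
  proof -
    have "g = h \<otimes> s \<longleftrightarrow> h = g \<otimes> inv s" if "s \<in> S" for s
      using that S \<open>g \<in> carrier G\<close> \<open>h \<in> carrier G\<close> by (auto simp: m_assoc subset_iff)
    then show ?thesis by blast
  qed
  then show ?thesis by (auto simp: cayley_graph_def)
qed

lemma word_ball_relpow:
  assumes S: "S \<subseteq> carrier G"
  shows "g \<in> word_ball G S n \<longleftrightarrow> (\<exists>k\<le>n. (\<one>, g) \<in> adjacency (cayley_graph G S) ^^ k)"
proof (induction n arbitrary: g)
  case 0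
  then show ?case by auto
next
  case (Suc n)
  let ?A = "adjacency (cayley_graph G S)"
  show ?case
  proof
    assume "g \<in> word_ball G S (Suc n)"
    then show "\<exists>k\<le>Suc n. (\<one>, g) \<in> ?A ^^ k"
    proof (cases rule: word_ball_SucE)
      case 1
      then show ?thesis using Suc by (meson le_SucI)
    next
      case (2 h s)
      obtain k where k: "k \<le> n" "(\<one>, h) \<in> ?A ^^ k" using Suc 2(1) by blast
      have h: "h \<in> carrier G" "s \<in> carrier G" using 2 S word_ball_closed[OF S] by auto
      show ?thesis
      proof (cases "h = g")
        case True
        then show ?thesis using k by (meson le_SucI)
      next
        case False
        then have "(h, g) \<in> ?A" using 2 h by (auto simp: cayley_adjacency_iff[OF S])
        then have "(\<one>, g) \<in> ?A ^^ Suc k" using k(2) by auto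
        then show ?thesis using k(1) Suc_le_mono by blast
      qed
    qed
  next
    assume "\<exists>k\<le>Suc n. (\<one>, g) \<in> ?A ^^ k"
    then obtain k where k: "k \<le> Suc n" "(\<one>, g) \<in> ?A ^^ k" by blast
    show "g \<in> word_ball G S (Suc n)"
    proof (cases "k \<le> n")
      case True
      then have "g \<in> word_ball G S n" using Suc k(2) by blast
      then show ?thesis by simp
    next
      case False
      then have "k = Suc n" using k(1) by simp
      then obtain h where h: "(\<one>, h) \<in> ?A ^^ n" "(h, g) \<in> ?A" using k(2) by auto
      then have "h \<in> word_ball G S n" using Suc by blast
      moreover obtain s where "s \<in> S \<union> m_inv G ` S" "g = h \<otimes> s"
        using h(2) unfolding cayley_adjacency_iff[OF S] by blast
      ultimately show ?thesis using word_ball_SucI by blast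
    qed
  qed
qed

lemma gdist_le_iff: "gdist X x y \<le> enat n \<longleftrightarrow> (\<exists>k\<le>n. (x, y) \<in> adjacency X ^^ k)"
proof -
  \<comment> \<open>A strict bound on an infimum directly yields a witness.\<close>
  have "gdist X x y \<le> enat n \<longleftrightarrow> gdist X x y < enat (Suc n)"
    by (cases "gdist X x y") auto
  also have "\<dots> \<longleftrightarrow> (\<exists>k\<le>n. (x, y) \<in> adjacency X ^^ k)"
    unfolding gdist_def INF_less_iff by (auto simp: less_Suc_eq_le)
  finally show ?thesis .
qed

lemma word_ball_eq_gdist:
  assumes S: "S \<subseteq> carrier G"
  shows "{g \<in> carrier G. gdist (cayley_graph G S) \<one> g \<le> enat n} = word_ball G S n"
  using word_ball_closed[OF S] by (auto simp: gdist_le_iff word_ball_relpow[OF S])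

lemma sym_cayley: "sym (adjacency (cayley_graph G S))"
  by (auto simp: cayley_graph_def sym_def)

end

section \<open>Separation profiles of groups of polynomial growth\<close>

lemma profile_leI:
  assumes "C > 0" "\<And>v. v \<ge> C \<Longrightarrow> f v \<le> real C * g (C * v)"
  shows "f \<preceq> g"
  using assms unfolding profile_le_def by blast

context group begin

abbreviation translate :: "'a \<Rightarrow> 'a set \<Rightarrow> 'a set" where
  "translate x W \<equiv> (\<lambda>g. x \<otimes> g) ` W"

lemma card_translate:
  assumes "x \<in> carrier G" "W \<subseteq> carrier G"
  shows "card (translate x W) = card W"
  using assms by (intro card_image inj_onI) (auto simp: subset_iff)

text \<open>The path is kept as its vertex set and starts at the identity, so that one choice for
  \<open>g\<close> serves all left translates; quantifying over \<open>U\<close> lets the translate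
  be used inside any set that contains it.\<close>

lemma word_path:
  assumes S: "S \<subseteq> carrier G" and g: "g \<in> word_ball G S n"
  shows "\<exists>W\<subseteq>word_ball G S n. finite W \<and> card W \<le> Suc n \<and> \<one> \<in> W \<and> g \<in> W \<and>
    (\<forall>x\<in>carrier G. \<forall>U. translate x W \<subseteq> U \<longrightarrow> x \<otimes> g \<in> component (cayley_graph G S) U x)"
  using g
proof (induction n arbitrary: g)
  case 0
  then show ?case by (intro exI[of _ "{\<one>}"]) auto
next
  case (Suc n)
  from Suc.prems show ?case
  proof (cases rule: word_ball_SucE)
    case 1
    from Suc.IH[OF this] obtain W where W: "W \<subseteq> word_ball G S n \<and> finite W \<and> card W \<le> Suc n \<and> \<one> \<in> W \<and> g \<in> W \<and>
      (\<forall>x\<in>carrier G. \<forall>U. translate x W \<subseteq> U \<longrightarrow> x \<otimes> g \<in> component (cayley_graph G S) U x)" by (elim exE)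
    then show ?thesis by (intro exI[of _ W]) auto
  next
    case (2 h s)
    from Suc.IH[OF 2(1)] obtain W where W: "W \<subseteq> word_ball G S n \<and> finite W \<and> card W \<le> Suc n \<and> \<one> \<in> W \<and> h \<in> W \<and>
      (\<forall>x\<in>carrier G. \<forall>U. translate x W \<subseteq> U \<longrightarrow> x \<otimes> h \<in> component (cayley_graph G S) U x)" by (elim exE)
    have c: "h \<in> carrier G" "s \<in> carrier G" "g \<in> carrier G" using 2 S word_ball_closed[OF S] Suc.prems by auto
    have "x \<otimes> g \<in> component (cayley_graph G S) U x" if x: "x \<in> carrier G" and U: "translate x (insert g W) \<subseteq> U" for x U
    proof -
      have hU: "x \<otimes> h \<in> component (cayley_graph G S) U x" "x \<otimes> h \<in> U" "x \<otimes> g \<in> U" using W x U by auto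
      show ?thesis
      proof (cases "x \<otimes> h = x \<otimes> g")
        case True
        then show ?thesis using hU by simp
      next
        case False
        have "x \<otimes> g = x \<otimes> h \<otimes> s" using 2(3) x c by (simp add: m_assoc)
        then have "(x \<otimes> h, x \<otimes> g) \<in> adjacency (cayley_graph G S)"
          unfolding cayley_adjacency_iff[OF S] using False 2(2) x c by auto
        then have "(x \<otimes> h, x \<otimes> g) \<in> adjacency (cayley_graph G S) \<inter> U \<times> U" using hU by blast
        then show ?thesis using hU(1) by (auto intro: rtrancl_into_rtrancl)
      qed
    qed
    moreover have "card (insert g W) \<le> Suc (Suc n)" using W by (simp add: card_insert_if)
    moreover have "insert g W \<subseteq> word_ball G S (Suc n)" using W Suc.prems by auto
    ultimately show ?thesis using W by (intro exI[of _ "insert g W"]) simp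
  qed
qed

text \<open>\<open>U\<close> misses the sphere of radius \<open>Suc R\<close>, and a path out of the
  ball would have to step on it.\<close>

lemma component_in_translate:
  assumes S: "S \<subseteq> carrier G" and z: "z \<in> carrier G"
    and x: "x \<in> translate z (word_ball G S R)" and U: "U \<inter> translate z (word_ball G S (Suc R)) \<subseteq> translate z (word_ball G S R)"
  shows "component (cayley_graph G S) U x \<subseteq> translate z (word_ball G S R)"
proof
  fix y assume "y \<in> component (cayley_graph G S) U x"
  then have "(x, y) \<in> (adjacency (cayley_graph G S) \<inter> U \<times> U)\<^sup>*" by simp
  then show "y \<in> translate z (word_ball G S R)"
  proof (induction rule: rtrancl_induct)
    case base
    show ?case by (rule x)
  next
    case (step y w)
    obtain g where g: "g \<in> word_ball G S R" "y = z \<otimes> g" using step.IH by blast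
    obtain s where s: "s \<in> S \<union> m_inv G ` S" "w = y \<otimes> s" and w: "w \<in> U"
      using step.hyps(2) unfolding Int_iff cayley_adjacency_iff[OF S] by blast
    have "s \<in> carrier G" "g \<in> carrier G" using s S word_ball_closed[OF S g(1)] by auto
    then have "w = z \<otimes> (g \<otimes> s)" using g s z by (simp add: m_assoc)
    then have "w \<in> translate z (word_ball G S (Suc R))" using word_ball_SucI[OF g(1) s(1)] by blast
    then show ?case using U w by blast
  qed
qed

text \<open>For a maximal set \<open>Z\<close> of points of \<open>F\<close> with disjoint \<open>\<rho>\<close>-balls, the \<open>2 \<rho>\<close>-balls cover \<open>F\<close>. Around each
  point of \<open>Z\<close>, some sphere of radius between \<open>2 \<rho>\<close> and \<open>4 \<rho>\<close> contains at most a fraction \<open>1 / (2 \<rho>)\<close> of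
  the points of \<open>F\<close> in the \<open>4 \<rho>\<close>-ball; the union of these spheres is the cut.\<close>

lemma cut_le_of_doubling:
  assumes S: "S \<subseteq> carrier G" "finite S" and F: "finite F" "F \<subseteq> carrier G"
    and big: "2 * card (word_ball G S (4 * \<rho>)) \<le> card F"
  shows "2 * \<rho> * cut (cayley_graph G S) F * card (word_ball G S \<rho>) \<le> card F * card (word_ball G S (5 * \<rho>))"
proof -
  let ?W = "word_ball G S"
  let ?X = "cayley_graph G S"
  note Wc = word_ball_carrier[OF S(1)]
  note finW = finite_word_ball[OF S(2)]
  define Fam where "Fam = {Z. Z \<subseteq> F \<and> (\<forall>z\<in>Z. \<forall>z'\<in>Z. z \<noteq> z' \<longrightarrow> translate z (?W \<rho>) \<inter> translate z' (?W \<rho>) = {})}"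
  have "finite Fam" by (rule finite_subset[of _ "Pow F"]) (use F in \<open>auto simp: Fam_def\<close>)
  moreover have "{} \<in> Fam" by (simp add: Fam_def)
  ultimately obtain Z where Z: "Z \<in> Fam" and Zmax: "\<And>Y. Y \<in> Fam \<Longrightarrow> Z \<subseteq> Y \<Longrightarrow> Z = Y"
    using finite_has_maximal[of Fam] by blast
  have ZF: "Z \<subseteq> F" using Z by (simp add: Fam_def)
  have finZ: "finite Z" using ZF F(1) finite_subset by blast
  have cover: "\<exists>z\<in>Z. x \<in> translate z (?W (2 * \<rho>))" if x: "x \<in> F" for x
  proof (cases "x \<in> Z")
    case True
    then show ?thesis using word_ball_one x F by (intro bexI[of _ x] image_eqI[of _ _ \<one>]) auto
  next
    case False
    then have "insert x Z \<notin> Fam" using Zmax[of "insert x Z"] by blast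
    then obtain z where z: "z \<in> Z" "translate x (?W \<rho>) \<inter> translate z (?W \<rho>) \<noteq> {}"
      using Z x unfolding Fam_def by blast
    then obtain g h where gh: "g \<in> ?W \<rho>" "h \<in> ?W \<rho>" "x \<otimes> g = z \<otimes> h" by auto
    have c: "x \<in> carrier G" "z \<in> carrier G" "g \<in> carrier G" "h \<in> carrier G"
      using x z ZF F gh Wc by auto
    have "z \<otimes> (h \<otimes> inv g) = x \<otimes> g \<otimes> inv g" using gh(3) c by (simp add: m_assoc[symmetric])
    then have "x = z \<otimes> (h \<otimes> inv g)" using c by (simp add: m_assoc)
    moreover have "h \<otimes> inv g \<in> ?W (\<rho> + \<rho>)"
      using gh by (intro word_ball_mult[OF S(1)] word_ball_inv[OF S(1)])
    ultimately show ?thesis using z(1) by (auto simp: mult_2)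
  qed
  \<comment> \<open>The disjoint small balls around these centres all lie in the ball of radius
    \<open>5 * \<rho>\<close> around \<open>x\<close>; comparing sizes bounds the multiplicity of
    the cover.\<close>
  have mult: "card {z \<in> Z. x \<in> translate z (?W (4 * \<rho>))} * card (?W \<rho>) \<le> card (?W (5 * \<rho>))" if x: "x \<in> F" for x
  proof -
    let ?Y = "{z \<in> Z. x \<in> translate z (?W (4 * \<rho>))}"
    have xc: "x \<in> carrier G" using x F by blast
    have "card (\<Union>z\<in>?Y. translate z (?W \<rho>)) = (\<Sum>z\<in>?Y. card (translate z (?W \<rho>)))"
      using finZ finW Z by (intro card_UN_disjoint) (auto simp: Fam_def)
    also have "\<dots> = (\<Sum>z\<in>?Y. card (?W \<rho>))"
      using ZF F Wc by (intro sum.cong refl card_translate) auto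
    finally have "card ?Y * card (?W \<rho>) = card (\<Union>z\<in>?Y. translate z (?W \<rho>))" by simp
    also have "\<dots> \<le> card (translate x (?W (5 * \<rho>)))"
    proof (rule card_mono)
      show "(\<Union>z\<in>?Y. translate z (?W \<rho>)) \<subseteq> translate x (?W (5 * \<rho>))"
      proof clarify
        fix z g h assume z: "z \<in> Z" and g: "g \<in> ?W \<rho>" and h: "h \<in> ?W (4 * \<rho>)" and xz: "x = z \<otimes> h"
        have c: "z \<in> carrier G" "g \<in> carrier G" "h \<in> carrier G" using z ZF F g h Wc by auto
        have "z \<otimes> g = z \<otimes> h \<otimes> (inv h \<otimes> g)" using c by (simp add: m_assoc[symmetric]) (simp add: m_assoc)
        moreover have "inv h \<otimes> g \<in> ?W (4 * \<rho> + \<rho>)"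
          using g h by (intro word_ball_mult[OF S(1)] word_ball_inv[OF S(1)])
        ultimately show "z \<otimes> g \<in> translate (z \<otimes> h) (?W (5 * \<rho>))" by (auto simp: algebra_simps)
      qed
    qed (use finW in auto)
    also have "\<dots> = card (?W (5 * \<rho>))" by (rule card_translate[OF xc Wc])
    finally show ?thesis .
  qed
  define Sph where "Sph z R = F \<inter> (translate z (?W (Suc R)) - translate z (?W R))" for z R
  have "\<exists>R\<in>{2 * \<rho>..<4 * \<rho>}. 2 * \<rho> * card (Sph z R) \<le> card (F \<inter> translate z (?W (4 * \<rho>)))"
    if rho: "\<rho> > 0" for z
  proof (rule ccontr)
    assume "\<not> ?thesis"
    then have *: "card (F \<inter> translate z (?W (4 * \<rho>))) < 2 * \<rho> * card (Sph z R)" if "R \<in> {2 * \<rho>..<4 * \<rho>}" for R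
      using that by (meson not_le)
    have "(\<Sum>R\<in>{2 * \<rho>..<4 * \<rho>}. card (F \<inter> translate z (?W (4 * \<rho>)))) < (\<Sum>R\<in>{2 * \<rho>..<4 * \<rho>}. 2 * \<rho> * card (Sph z R))"
      using * rho by (intro sum_strict_mono) auto
    then have "card (F \<inter> translate z (?W (4 * \<rho>))) < (\<Sum>R\<in>{2 * \<rho>..<4 * \<rho>}. card (Sph z R))"
      by (simp add: sum_distrib_left[symmetric])
    also have "\<dots> = card (\<Union>R\<in>{2 * \<rho>..<4 * \<rho>}. Sph z R)"
    proof (rule card_UN_disjoint[symmetric])
      show "\<forall>i\<in>{2 * \<rho>..<4 * \<rho>}. \<forall>j\<in>{2 * \<rho>..<4 * \<rho>}. i \<noteq> j \<longrightarrow> Sph z i \<inter> Sph z j = {}"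
      proof (intro ballI impI)
        fix i j :: nat assume "i \<noteq> j"
        have disj: "Sph z i \<inter> Sph z j = {}" if "i < j" for i j
        proof -
          have "translate z (?W (Suc i)) \<subseteq> translate z (?W j)"
            by (intro image_mono word_ball_mono) (use that in simp)
          then show ?thesis unfolding Sph_def by blast
        qed
        show "Sph z i \<inter> Sph z j = {}" using disj[of i j] disj[of j i] \<open>i \<noteq> j\<close> by (cases "i < j") auto
      qed
    qed (use F in \<open>auto simp: Sph_def\<close>)
    also have "\<dots> \<le> card (F \<inter> translate z (?W (4 * \<rho>)))"
    proof (rule card_mono)
      show "(\<Union>R\<in>{2 * \<rho>..<4 * \<rho>}. Sph z R) \<subseteq> F \<inter> translate z (?W (4 * \<rho>))"
      proof clarify
        fix x R assume R: "R \<in> {2 * \<rho>..<4 * \<rho>}" "x \<in> Sph z R"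
        have "translate z (?W (Suc R)) \<subseteq> translate z (?W (4 * \<rho>))"
          using R by (intro image_mono word_ball_mono) auto
        then show "x \<in> F \<inter> translate z (?W (4 * \<rho>))" using R(2) unfolding Sph_def by blast
      qed
    qed (use F in auto)
    finally show False by simp
  qed
  then have "\<exists>R. \<rho> > 0 \<longrightarrow> R \<in> {2 * \<rho>..<4 * \<rho>} \<and> 2 * \<rho> * card (Sph z R) \<le> card (F \<inter> translate z (?W (4 * \<rho>)))" for z
    by blast
  then obtain R where R: "\<And>z. \<rho> > 0 \<Longrightarrow> R z \<in> {2 * \<rho>..<4 * \<rho>}"
    "\<And>z. \<rho> > 0 \<Longrightarrow> 2 * \<rho> * card (Sph z (R z)) \<le> card (F \<inter> translate z (?W (4 * \<rho>)))" by metis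
  show ?thesis
  proof (cases "\<rho> = 0")
    case True
    then show ?thesis by simp
  next
    case False
    then have rho: "\<rho> > 0" by simp
    define C where "C = (\<Union>z\<in>Z. Sph z (R z))"
    have CF: "C \<subseteq> F" by (auto simp: C_def Sph_def)
    have "cut ?X F \<le> card C"
    proof (rule cut_le[OF F(1) CF])
      fix x assume x: "x \<in> F - C"
      then obtain z where z: "z \<in> Z" "x \<in> translate z (?W (2 * \<rho>))" using cover by blast
      have zc: "z \<in> carrier G" using z ZF F by blast
      have sub: "translate z (?W (2 * \<rho>)) \<subseteq> translate z (?W (R z))"
        using R(1)[OF rho, of z] by (intro image_mono word_ball_mono) auto
      have "(F - C) \<inter> translate z (?W (Suc (R z))) \<subseteq> translate z (?W (R z))"
        using z(1) by (auto simp: C_def Sph_def)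
      then have "component ?X (F - C) x \<subseteq> translate z (?W (R z))"
        by (rule component_in_translate[OF S(1) zc subsetD[OF sub z(2)]])
      also have "\<dots> \<subseteq> translate z (?W (4 * \<rho>))"
        using R(1)[OF rho, of z] by (intro image_mono word_ball_mono) auto
      finally have "card (component ?X (F - C) x) \<le> card (translate z (?W (4 * \<rho>)))"
        using finW by (intro card_mono) auto
      then show "2 * card (component ?X (F - C) x) \<le> card F"
        using big card_translate[OF zc Wc, of "4 * \<rho>"] by linarith
    qed
    then have "2 * \<rho> * cut ?X F \<le> 2 * \<rho> * card C" by simp
    also have "\<dots> \<le> 2 * \<rho> * (\<Sum>z\<in>Z. card (Sph z (R z)))"
      unfolding C_def using finZ by (intro mult_le_mono2 card_UN_le)
    also have "\<dots> = (\<Sum>z\<in>Z. 2 * \<rho> * card (Sph z (R z)))" by (simp add: sum_distrib_left)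
    also have "\<dots> \<le> (\<Sum>z\<in>Z. card (F \<inter> translate z (?W (4 * \<rho>))))" by (intro sum_mono R(2) rho)
    \<comment> \<open>Double counting of the incidences between points of \<open>F\<close> and
      balls.\<close>
    also have "\<dots> = (\<Sum>z\<in>Z. \<Sum>x\<in>F. if x \<in> translate z (?W (4 * \<rho>)) then 1 else 0)"
      using F(1) by (intro sum.cong refl) (simp add: sum.If_cases)
    also have "\<dots> = (\<Sum>x\<in>F. \<Sum>z\<in>Z. if x \<in> translate z (?W (4 * \<rho>)) then 1 else 0)" by (rule sum.swap)
    also have "\<dots> = (\<Sum>x\<in>F. card {z \<in> Z. x \<in> translate z (?W (4 * \<rho>))})"
      using finZ by (intro sum.cong refl) (simp add: sum.If_cases Int_def conj_commute)
    finally have "2 * \<rho> * cut ?X F * card (?W \<rho>) \<le> (\<Sum>x\<in>F. card {z \<in> Z. x \<in> translate z (?W (4 * \<rho>))}) * card (?W \<rho>)"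
      by (rule mult_le_mono1)
    also have "\<dots> = (\<Sum>x\<in>F. card {z \<in> Z. x \<in> translate z (?W (4 * \<rho>))} * card (?W \<rho>))" by (simp add: sum_distrib_right)
    also have "\<dots> \<le> (\<Sum>x\<in>F. card (?W (5 * \<rho>)))" by (intro sum_mono mult)
    finally show ?thesis by simp
  qed
qed

definition growth_bounds :: "'a set \<Rightarrow> nat \<Rightarrow> real \<Rightarrow> real \<Rightarrow> bool" where
  "growth_bounds S d a b \<longleftrightarrow> a > 0 \<and> b > 0 \<and>
     (\<forall>n\<ge>1. a * real n ^ d \<le> real (card (word_ball G S n)) \<and> real (card (word_ball G S n)) \<le> b * real n ^ d)"

text \<open>The radius is of order \<open>card F powr (1 / d)\<close>, the largest order that
  \<open>cut_le_of_doubling\<close> allows; the cut is then of order \<open>card F / \<rho>\<close>,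
  as the quotient of the ball sizes is bounded.\<close>

lemma sep_upper_polynomial_growth:
  assumes S: "S \<subseteq> carrier G" "finite S" and growth: "growth_bounds S d a b" and d: "d > 0"
  shows "(\<lambda>v. real (sep (cayley_graph G S) v)) \<preceq> growth_profile d"
proof -
  let ?W = "word_ball G S"
  let ?X = "cayley_graph G S"
  have ab: "a > 0" "b > 0" and lo: "\<And>n. n \<ge> 1 \<Longrightarrow> a * real n ^ d \<le> real (card (?W n))"
    and up: "\<And>n. n \<ge> 1 \<Longrightarrow> real (card (?W n)) \<le> b * real n ^ d"
    using growth by (auto simp: growth_bounds_def)
  \<comment> \<open>\<open>c * \<rho> ^ d\<close> bounds twice the size of the ball of radius
    \<open>4 * \<rho>\<close>, so \<open>c * \<rho> ^ d \<le> card F\<close> provides the premise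
    \<open>big\<close>.\<close>
  define c where "c = 2 * b * 4 ^ d"
  have c: "c > 0" using ab by (simp add: c_def)
  define e where "e = 1 - 1 / real d"
  have e: "e \<ge> 0" using d by (simp add: e_def)
  define K where "K = max c (b * 5 ^ d / a * c powr (1 / real d))"
  have cutF: "real (cut ?X F) \<le> K * real (card F) powr e" if F: "finite F" "F \<subseteq> carrier G" "F \<noteq> {}" for F
  proof -
    define N where "N = real (card F)"
    have N: "N \<ge> 1" using F by (simp add: N_def Suc_leI card_gt_0_iff)
    define q where "q = (N / c) powr (1 / real d)"
    define \<rho> where "\<rho> = nat \<lfloor>q\<rfloor>"
    have q0: "q > 0" using N c by (simp add: q_def)
    have Ne: "N powr e \<ge> 1" using N e by (simp add: ge_one_powr_ge_zero)
    show ?thesis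
    proof (cases "q < 1")
      \<comment> \<open>No radius at least 1 is available, but then \<open>card F < c\<close> and
        the trivial cut suffices.\<close>
      case True
      then have "q ^ d < 1" using q0 d by (simp add: power_less_one_iff)
      moreover have "q ^ d = N / c"
        using N c d by (simp add: q_def powr_realpow[symmetric] powr_powr)
      ultimately have "N < c" using c by simp
      moreover have "real (cut ?X F) \<le> N" using cut_le_card[OF F(1)] by (simp add: N_def)
      ultimately have "real (cut ?X F) \<le> c * 1" by simp
      also have "\<dots> \<le> K * N powr e" using Ne c by (intro mult_mono) (auto simp: K_def)
      finally show ?thesis by (simp add: N_def)
    next
      case False
      then have "\<lfloor>q\<rfloor> \<ge> 1" by linarith
      then have "real \<rho> = of_int \<lfloor>q\<rfloor>" "\<rho> \<ge> 1" unfolding \<rho>_def by linarith+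
      with \<open>\<lfloor>q\<rfloor> \<ge> 1\<close> have rho: "\<rho> \<ge> 1" "real \<rho> \<le> q" "q \<le> 2 * real \<rho>"
        by linarith+
      have "real \<rho> ^ d \<le> q ^ d" using rho by (intro power_mono) auto
      also have "q ^ d = N / c"
        using N c d by (simp add: q_def powr_realpow[symmetric] powr_powr)
      finally have "c * real \<rho> ^ d \<le> N" using c by (simp add: field_simps)
      moreover have "2 * real (card (?W (4 * \<rho>))) \<le> c * real \<rho> ^ d"
        using up[of "4 * \<rho>"] rho by (simp add: c_def power_mult_distrib)
      ultimately have "2 * card (?W (4 * \<rho>)) \<le> card F" unfolding N_def by linarith
      then have "2 * \<rho> * cut ?X F * card (?W \<rho>) \<le> card F * card (?W (5 * \<rho>))"
        by (rule cut_le_of_doubling[OF S F(1,2)])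
      then have "real (2 * \<rho> * cut ?X F * card (?W \<rho>)) \<le> real (card F * card (?W (5 * \<rho>)))" by (simp only: of_nat_le_iff)
      then have *: "(2 * real \<rho>) * real (cut ?X F) * real (card (?W \<rho>)) \<le> N * real (card (?W (5 * \<rho>)))"
        by (simp add: N_def)
      have "q * real (cut ?X F) * (a * real \<rho> ^ d) \<le> (2 * real \<rho>) * real (cut ?X F) * real (card (?W \<rho>))"
        using rho q0 lo[of \<rho>] ab by (intro mult_mono) auto
      also note *
      also have "N * real (card (?W (5 * \<rho>))) \<le> N * (b * 5 ^ d * real \<rho> ^ d)"
        using up[of "5 * \<rho>"] rho N by (intro mult_left_mono) (auto simp: power_mult_distrib)
      finally have "(q * real (cut ?X F) * a) * real \<rho> ^ d \<le> (N * b * 5 ^ d) * real \<rho> ^ d"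
        by (simp add: mult.assoc mult.left_commute)
      then have "q * real (cut ?X F) * a \<le> N * b * 5 ^ d"
        using rho by (subst (asm) mult_le_cancel_right_pos) auto
      then have "real (cut ?X F) \<le> b * 5 ^ d / a * (N / q)"
        using ab q0 by (simp add: field_simps)
      also have "N / q = c powr (1 / real d) * N powr e"
        using N c by (simp add: q_def e_def powr_divide powr_diff)
      also have "b * 5 ^ d / a * (c powr (1 / real d) * N powr e) \<le> K * N powr e"
      proof -
        have "b * 5 ^ d / a * c powr (1 / real d) \<le> K" unfolding K_def by (rule max.cobounded2)
        then have "(b * 5 ^ d / a * c powr (1 / real d)) * N powr e \<le> K * N powr e"
          by (intro mult_right_mono) auto
        then show ?thesis by (simp only: mult.assoc)
      qed
      finally show ?thesis by (simp add: N_def)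
    qed
  qed
  have K: "K > 0" using c by (simp add: K_def)
  define C where "C = nat \<lceil>K\<rceil> + 1"
  have C: "real C \<ge> K" unfolding C_def by linarith
  show ?thesis
  proof (rule profile_leI[of C])
    fix v assume v: "v \<ge> C"
    have v1: "v \<ge> 1" using v by (simp add: C_def)
    have "cut ?X F \<le> nat \<lfloor>K * real v powr e\<rfloor>" if F: "F \<subseteq> vertices ?X" "finite F" "card F \<le> v" for F
    proof (cases "F = {}")
      case True
      then show ?thesis using cut_le_card[of "{}" ?X] by simp
    next
      case False
      have "real (cut ?X F) \<le> K * real (card F) powr e"
        using cutF F False by (simp add: cayley_graph_def)
      also have "\<dots> \<le> K * real v powr e" using F e K by (intro mult_left_mono powr_mono2) auto
      finally show ?thesis by (simp add: le_nat_floor)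
    qed
    then have "sep ?X v \<le> nat \<lfloor>K * real v powr e\<rfloor>" by (rule sep_le)
    then have "real (sep ?X v) \<le> real (nat \<lfloor>K * real v powr e\<rfloor>)" by simp
    also have "\<dots> \<le> K * real v powr e" using K by (simp add: of_nat_nat)
    also have "\<dots> \<le> real C * real (C * v) powr e"
      using C e K v1 by (intro mult_mono powr_mono2) (auto simp: C_def)
    finally show "real (sep ?X v) \<le> real C * growth_profile d (C * v)"
      using d by (simp add: growth_profile_def e_def)
  qed (simp add: C_def)
qed

text \<open>The paths are left translates of one chosen path for each displacement, so a pair whose
  path passes through \<open>c\<close> is recovered from its displacement and the position of
  \<open>c\<close> on the chosen path. This leaves at most \<open>Suc (2 * n)\<close> pairs per
  displacement. The ball of radius \<open>3 * n\<close> contains all the paths.\<close>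

lemma ball_congestion:
  assumes S: "S \<subseteq> carrier G" "finite S"
    and L: "card (word_ball G S (3 * n)) \<le> L * card (word_ball G S n)" "2 * L \<le> 2 ^ k"
    and v: "card (word_ball G S (3 * n)) \<le> v"
  shows "card (word_ball G S n) ^ 2 \<le> 2 ^ (k + 2) * (sep (cayley_graph G S) v * (card (word_ball G S (2 * n)) * Suc (2 * n)))"
proof -
  let ?W = "word_ball G S"
  let ?X = "cayley_graph G S"
  note Wc = word_ball_carrier[OF S(1)]
  note finW = finite_word_ball[OF S(2)]
  have "\<forall>g. \<exists>W. g \<in> ?W (2 * n) \<longrightarrow> W \<subseteq> ?W (2 * n) \<and> finite W \<and> card W \<le> Suc (2 * n) \<and> \<one> \<in> W \<and> g \<in> W \<and>
    (\<forall>x\<in>carrier G. \<forall>U. translate x W \<subseteq> U \<longrightarrow> x \<otimes> g \<in> component ?X U x)"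
    using word_path[OF S(1)] by meson
  then obtain P where P: "\<forall>g. g \<in> ?W (2 * n) \<longrightarrow> P g \<subseteq> ?W (2 * n) \<and> finite (P g) \<and> card (P g) \<le> Suc (2 * n) \<and> \<one> \<in> P g \<and> g \<in> P g \<and>
    (\<forall>x\<in>carrier G. \<forall>U. translate x (P g) \<subseteq> U \<longrightarrow> x \<otimes> g \<in> component ?X U x)"
    by (rule choice[THEN exE])
  define B where "B x y = translate x (P (inv x \<otimes> y))" for x y
  have diff: "inv x \<otimes> y \<in> ?W (2 * n)" if "x \<in> ?W n" "y \<in> ?W n" for x y
    using word_ball_mult[OF S(1) word_ball_inv[OF S(1) that(1)] that(2)] by (simp add: mult_2)
  show ?thesis
  proof (rule congestion_bound[where F = "?W (3 * n)" and I = "?W n" and B = B and L = L and X = ?X])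
    show "sym (adjacency ?X)" by (rule sym_cayley)
    show "?W (3 * n) \<subseteq> vertices ?X" using Wc by (simp add: cayley_graph_def)
    show "?W n \<subseteq> ?W (3 * n)" by (rule word_ball_mono) simp
  next
    fix x y C assume xy: "x \<in> ?W n" "y \<in> ?W n" and C: "C \<subseteq> ?W (3 * n)" "B x y \<inter> C = {}"
    have c: "x \<in> carrier G" "y \<in> carrier G" using xy Wc by auto
    have "B x y \<subseteq> ?W (3 * n)"
    proof
      fix w assume "w \<in> B x y"
      then obtain g where "g \<in> ?W (2 * n)" "w = x \<otimes> g" using P diff[OF xy] unfolding B_def by blast
      then show "w \<in> ?W (3 * n)" using word_ball_mult[OF S(1) xy(1)] by (metis add_mult_distrib mult_1 numeral_3_eq_3 add_2_eq_Suc' one_add_one mult_Suc numeral_2_eq_2)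
    qed
    then have "translate x (P (inv x \<otimes> y)) \<subseteq> ?W (3 * n) - C" using C(2) unfolding B_def by blast
    then have "x \<otimes> (inv x \<otimes> y) \<in> component ?X (?W (3 * n) - C) x" using P diff[OF xy] c by blast
    moreover have "x \<otimes> (inv x \<otimes> y) = y" using c by (simp add: m_assoc[symmetric])
    ultimately show "y \<in> component ?X (?W (3 * n) - C) x" by simp
  next
    fix x y assume xy: "x \<in> ?W n" "y \<in> ?W n"
    have "\<one> \<in> P (inv x \<otimes> y)" using P diff[OF xy] by blast
    moreover have "x \<in> carrier G" using xy(1) Wc by blast
    ultimately show "x \<in> B x y" unfolding B_def by (intro image_eqI[of _ _ \<one>]) auto
  next
    fix c assume cW: "c \<in> ?W (3 * n)"
    let ?Q = "{(x, y) \<in> ?W n \<times> ?W n. c \<in> B x y}"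
    let ?f = "\<lambda>(x, y). (inv x \<otimes> y, inv x \<otimes> c)"
    have cc: "c \<in> carrier G" using cW Wc by auto
    have "inj_on ?f ?Q"
    proof (rule inj_onI, clarify)
      fix x y x' y' assume *: "x \<in> ?W n" "y \<in> ?W n" "x' \<in> ?W n" "y' \<in> ?W n" "inv x \<otimes> y = inv x' \<otimes> y'" "inv x \<otimes> c = inv x' \<otimes> c"
      then have c: "x \<in> carrier G" "y \<in> carrier G" "x' \<in> carrier G" "y' \<in> carrier G" using Wc by auto
      have "inv x = inv x'" using *(6) c cc by simp
      then have "x = x'" using c by (metis inv_inv)
      then show "x = x' \<and> y = y'" using *(5) c by simp
    qed
    moreover have "?f ` ?Q \<subseteq> Sigma (?W (2 * n)) P"
    proof clarify
      fix x y assume xy: "x \<in> ?W n" "y \<in> ?W n" "c \<in> B x y"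
      then obtain g where g: "g \<in> P (inv x \<otimes> y)" "c = x \<otimes> g" unfolding B_def by blast
      have "g \<in> carrier G" using g(1) P diff[OF xy(1,2)] Wc by blast
      moreover have "x \<in> carrier G" using xy Wc by auto
      ultimately have "inv x \<otimes> c = g" using g(2) by (simp add: m_assoc[symmetric])
      then show "inv x \<otimes> y \<in> ?W (2 * n) \<and> inv x \<otimes> c \<in> P (inv x \<otimes> y)" using g(1) diff[OF xy(1,2)] by simp
    qed
    moreover have finS: "finite (Sigma (?W (2 * n)) P)" using P finW by (intro finite_SigmaI) auto
    ultimately have "card ?Q \<le> card (Sigma (?W (2 * n)) P)" by (rule card_inj_on_le)
    also have "\<dots> = (\<Sum>g\<in>?W (2 * n). card (P g))" using P finW by (intro card_SigmaI) auto
    also have "\<dots> \<le> (\<Sum>g\<in>?W (2 * n). Suc (2 * n))" using P by (intro sum_mono) blast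
    finally show "card ?Q \<le> card (?W (2 * n)) * Suc (2 * n)" by simp
  qed (use L v finW in auto)
qed

text \<open>With \<open>n\<close> about \<open>v powr (1 / d)\<close>, the congestion inequality
  compares \<open>n ^ (2 * d)\<close> with the profile times \<open>n ^ d * n\<close>, which leaves
  \<open>n ^ (d - 1)\<close>.\<close>

lemma sep_lower_polynomial_growth:
  assumes S: "S \<subseteq> carrier G" "finite S" and growth: "growth_bounds S d a b" and d: "d > 0"
  shows "growth_profile d \<preceq> (\<lambda>v. real (sep (cayley_graph G S) v))"
proof -
  let ?W = "word_ball G S"
  let ?X = "cayley_graph G S"
  have ab: "a > 0" "b > 0" and lo: "\<And>n. n \<ge> 1 \<Longrightarrow> a * real n ^ d \<le> real (card (?W n))"
    and up: "\<And>n. n \<ge> 1 \<Longrightarrow> real (card (?W n)) \<le> b * real n ^ d"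
    using growth by (auto simp: growth_bounds_def)
  \<comment> \<open>\<open>L\<close> bounds the quotient of the sizes of the balls of radius
    \<open>3 * n\<close> and \<open>n\<close>.\<close>
  define L where "L = nat \<lceil>b * 3 ^ d / a\<rceil>"
  define k where "k = 2 * L"
  have k: "2 * L \<le> 2 ^ k" unfolding k_def by (rule less_imp_le[OF less_exp])
  define K where "K = 2 ^ (k + 2) * (b * 2 ^ d) * 3 / a ^ 2"
  have key: "real n ^ (d - 1) \<le> K * real (sep ?X v)" if n: "n \<ge> 1" and v: "b * 3 ^ d * real n ^ d \<le> real v" for n v
  proof -
    have "real (card (?W (3 * n))) \<le> (b * 3 ^ d / a) * (a * real n ^ d)"
      using up[of "3 * n"] n ab by (simp add: power_mult_distrib)
    also have "\<dots> \<le> real L * real (card (?W n))"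
    proof (intro mult_mono)
      show "b * 3 ^ d / a \<le> real L" unfolding L_def by linarith
    qed (use lo[OF n] ab in auto)
    finally have "card (?W (3 * n)) \<le> L * card (?W n)" by (simp only: of_nat_mult[symmetric] of_nat_le_iff)
    moreover have "real (card (?W (3 * n))) \<le> real v"
      using up[of "3 * n"] n v by (simp add: power_mult_distrib)
    then have "card (?W (3 * n)) \<le> v" by simp
    ultimately have "card (?W n) ^ 2 \<le> 2 ^ (k + 2) * (sep ?X v * (card (?W (2 * n)) * Suc (2 * n)))"
      using ball_congestion[OF S _ k] by blast
    then have "real (card (?W n) ^ 2) \<le> real (2 ^ (k + 2) * (sep ?X v * (card (?W (2 * n)) * Suc (2 * n))))"
      by (simp only: of_nat_le_iff)
    then have *: "real (card (?W n)) ^ 2 \<le> 2 ^ (k + 2) * (real (sep ?X v) * (real (card (?W (2 * n))) * (2 * real n + 1)))"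
      by (simp add: algebra_simps)
    have "(a * real n ^ d) ^ 2 \<le> real (card (?W n)) ^ 2" using lo[OF n] ab by (intro power_mono) auto
    also note *
    also have "2 ^ (k + 2) * (real (sep ?X v) * (real (card (?W (2 * n))) * (2 * real n + 1)))
        \<le> 2 ^ (k + 2) * (real (sep ?X v) * ((b * 2 ^ d * real n ^ d) * (3 * real n)))"
      using up[of "2 * n"] n ab by (intro mult_left_mono mult_mono) (auto simp: power_mult_distrib)
    finally have "a ^ 2 * (real n ^ d * (real n * real n ^ (d - 1))) \<le> a ^ 2 * (real n ^ d * (real n * (K * real (sep ?X v))))"
      using d ab by (simp add: K_def power2_eq_square power_eq_if mult_ac)
    then show ?thesis using n ab by simp
  qed
  have K: "K > 0" using ab by (simp add: K_def)
  define C where "C = nat \<lceil>max K (b * 3 ^ d * 2 ^ d)\<rceil> + 1"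
  have C: "real C \<ge> K" "real C \<ge> b * 3 ^ d * 2 ^ d" unfolding C_def by linarith+
  show ?thesis
  proof (rule profile_leI[of C])
    fix v assume "v \<ge> C"
    then have v: "real v \<ge> 1" by (simp add: C_def)
    define q where "q = real v powr (1 / real d)"
    define n where "n = nat \<lceil>q\<rceil>"
    have q: "q \<ge> 1" using v by (simp add: q_def ge_one_powr_ge_zero)
    have n: "n \<ge> 1" "q \<le> real n" "real n \<le> 2 * q" using q unfolding n_def by linarith+
    have qd: "q ^ d = real v" using v d by (simp add: q_def powr_realpow[symmetric] powr_powr)
    have "real n ^ d \<le> (2 * q) ^ d" using n by (intro power_mono) auto
    then have nd: "real n ^ d \<le> 2 ^ d * real v" by (simp add: power_mult_distrib qd)
    have "b * 3 ^ d * real n ^ d \<le> b * 3 ^ d * (2 ^ d * real v)" using nd ab by (intro mult_left_mono) auto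
    also have "\<dots> = (b * 3 ^ d * 2 ^ d) * real v" by simp
    also have "\<dots> \<le> real C * real v" using C by (intro mult_right_mono) auto
    finally have "real n ^ (d - 1) \<le> K * real (sep ?X (C * v))" using key[OF n(1)] by simp
    moreover have "real v powr (1 - 1 / real d) = q ^ (d - 1)"
      using q v d by (simp add: q_def powr_realpow[symmetric] powr_powr of_nat_diff field_simps)
    moreover have "q ^ (d - 1) \<le> real n ^ (d - 1)" using n q by (intro power_mono) auto
    moreover have "K * real (sep ?X (C * v)) \<le> real C * real (sep ?X (C * v))"
      using C by (intro mult_right_mono) auto
    ultimately show "growth_profile d v \<le> real C * real (sep ?X (C * v))"
      using d by (simp add: growth_profile_def)
  qed (simp add: C_def)
qed

text \<open>Bounded balls bound the size of all finite subsets of the carrier, so the group is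
  finite; the lower bound comes from a single vertex.\<close>

lemma sep_bounded_growth:
  assumes S: "S \<subseteq> carrier G" "finite S" and gen: "generate G S = carrier G" and growth: "growth_bounds S 0 a b"
  shows "(\<lambda>v. real (sep (cayley_graph G S) v)) \<asymp> growth_profile 0"
proof -
  let ?X = "cayley_graph G S"
  have up: "real (card (word_ball G S n)) \<le> b" if "n \<ge> 1" for n
    using growth that by (auto simp: growth_bounds_def)
  have fin: "finite (carrier G) \<and> card (carrier G) \<le> nat \<lceil>b\<rceil>"
  proof (rule finite_if_finite_subsets_card_bdd)
    show "card H \<le> nat \<lceil>b\<rceil>" if "H \<subseteq> carrier G" "finite H" for H
    proof -
      obtain n where "H \<subseteq> word_ball G S n" using finite_subset_word_ball[OF S(1), of H] \<open>H \<subseteq> carrier G\<close> \<open>finite H\<close> gen by auto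
      then have "H \<subseteq> word_ball G S (Suc n)" by auto
      then have "real (card H) \<le> real (card (word_ball G S (Suc n)))"
        using finite_word_ball[OF S(2), of "Suc n"] by (simp only: of_nat_le_iff card_mono)
      also have "\<dots> \<le> b" by (rule up) simp
      finally show ?thesis by linarith
    qed
  qed
  define C where "C = card (carrier G) + 1"
  have sepC: "sep ?X v \<le> C" for v
  proof (rule sep_le)
    fix F assume F: "F \<subseteq> vertices ?X" "finite F"
    have "cut ?X F \<le> card F" by (rule cut_le_card[OF F(2)])
    also have "\<dots> \<le> card (carrier G)" using F fin by (intro card_mono) (auto simp: cayley_graph_def)
    finally show "cut ?X F \<le> C" by (simp add: C_def)
  qed
  have "(\<lambda>v. real (sep ?X v)) \<preceq> growth_profile 0"
  proof (intro profile_leI[of C])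
    fix v
    have "real (sep ?X v) \<le> real C" by (simp only: of_nat_le_iff sepC)
    then show "real (sep ?X v) \<le> real C * growth_profile 0 (C * v)" by (simp add: growth_profile_def)
  qed (simp add: C_def)
  moreover have "growth_profile 0 \<preceq> (\<lambda>v. real (sep ?X v))"
  proof (rule profile_leI[of 1])
    fix v :: nat assume v: "v \<ge> 1"
    obtain D where D: "D \<subseteq> {\<one>}" "card D = cut ?X {\<one>}" "\<And>x. x \<in> {\<one>} - D \<Longrightarrow> 2 * card (component ?X ({\<one>} - D) x) \<le> card {\<one>}"
      by (rule cut_witness[of "{\<one>}" ?X]) auto
    \<comment> \<open>The point itself must be removed, since a component of size 1 exceeds half of
      1.\<close>
    have "\<one> \<in> D"
    proof (rule ccontr)
      assume nD: "\<one> \<notin> D"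
      have "\<one> \<in> component ?X ({\<one>} - D) \<one>" by simp
      moreover have "finite (component ?X ({\<one>} - D) \<one>)"
        using component_subset[of \<one> "{\<one>} - D" ?X] nD by (auto intro: finite_subset)
      ultimately have "card (component ?X ({\<one>} - D) \<one>) \<ge> 1" by (metis One_nat_def Suc_leI card_gt_0_iff empty_iff)
      then show False using D(3)[of \<one>] nD by simp
    qed
    then have "cut ?X {\<one>} = 1" using D(1,2) by (metis card_1_singleton_iff insert_absorb subset_singletonD singletonD empty_iff One_nat_def)
    moreover have "cut ?X {\<one>} \<le> sep ?X v" using v by (intro cut_le_sep) (auto simp: cayley_graph_def)
    ultimately show "growth_profile 0 v \<le> real 1 * real (sep ?X (1 * v))" by (simp add: growth_profile_def)
  qed simp
  ultimately show ?thesis by (simp add: profile_equiv_def)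
qed

end

section \<open>The module structure on an abelian normal subgroup\<close>

text \<open>Any abelian subgroup that contains all commutators; it is normal because
  \<open>conj g a\<close> is a commutator times \<open>a\<close>. The application is to the derived
  subgroup.\<close>

locale metabelian_pair = group G for G (structure) +
  fixes A :: "'a set"
  assumes subgroup_A: "subgroup A G"
    and comm_A: "a \<in> A \<Longrightarrow> b \<in> A \<Longrightarrow> a \<otimes> b = b \<otimes> a"
    and commutator_A: "g \<in> carrier G \<Longrightarrow> h \<in> carrier G \<Longrightarrow> g \<otimes> h \<otimes> inv g \<otimes> inv h \<in> A"
begin

abbreviation conj :: "'a \<Rightarrow> 'a \<Rightarrow> 'a" where
  "conj g a \<equiv> g \<otimes> a \<otimes> inv g"

lemma A_closed [simp]: "a \<in> A \<Longrightarrow> a \<in> carrier G"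
  using subgroup.mem_carrier[OF subgroup_A] .

lemma A_mult [simp]: "a \<in> A \<Longrightarrow> b \<in> A \<Longrightarrow> a \<otimes> b \<in> A"
  using subgroup.m_closed[OF subgroup_A] .

lemma A_inv [simp]: "a \<in> A \<Longrightarrow> inv a \<in> A"
  using subgroup.m_inv_closed[OF subgroup_A] .

lemma A_one [simp]: "\<one> \<in> A"
  using subgroup.one_closed[OF subgroup_A] .

lemma A_nat_pow [simp]: "a \<in> A \<Longrightarrow> a [^] (n :: nat) \<in> A"
  by (induction n) auto

lemma A_int_pow [simp]: "a \<in> A \<Longrightarrow> a [^] (n :: int) \<in> A"
  by (cases n rule: int_cases2) (auto simp: int_pow_int int_pow_neg)

lemma A_lcomm: "a \<in> A \<Longrightarrow> b \<in> A \<Longrightarrow> c \<in> A \<Longrightarrow> a \<otimes> (b \<otimes> c) = b \<otimes> (a \<otimes> c)"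
  by (metis A_closed comm_A m_assoc)

lemmas A_ac = comm_A A_lcomm

lemma A_int_pow_mult: "a \<in> A \<Longrightarrow> b \<in> A \<Longrightarrow> (a \<otimes> b) [^] (n :: int) = a [^] n \<otimes> b [^] n"
  by (rule int_pow_mult_distrib) (auto simp: comm_A)

lemma A_inv_mult: "a \<in> A \<Longrightarrow> b \<in> A \<Longrightarrow> inv (a \<otimes> b) = inv a \<otimes> inv b"
  by (simp add: inv_mult_group comm_A)

lemma inv_cancel [simp]:
  assumes "g \<in> carrier G" "x \<in> carrier G"
  shows "inv g \<otimes> (g \<otimes> x) = x" "g \<otimes> (inv g \<otimes> x) = x"
  using assms by (simp_all add: m_assoc[symmetric])

lemma conj_eq_commutator: "g \<in> carrier G \<Longrightarrow> a \<in> carrier G \<Longrightarrow> conj g a = (g \<otimes> a \<otimes> inv g \<otimes> inv a) \<otimes> a"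
  by (simp add: m_assoc)

lemma conj_A [simp]: "g \<in> carrier G \<Longrightarrow> a \<in> A \<Longrightarrow> conj g a \<in> A"
  by (subst conj_eq_commutator) (auto simp: commutator_A)

lemma conj_mult: "g \<in> carrier G \<Longrightarrow> a \<in> carrier G \<Longrightarrow> b \<in> carrier G \<Longrightarrow> conj g (a \<otimes> b) = conj g a \<otimes> conj g b"
  by (simp add: m_assoc inv_solve_left)

lemma conj_one [simp]: "g \<in> carrier G \<Longrightarrow> conj g \<one> = \<one>"
  by simp

lemma conj_inv: "g \<in> carrier G \<Longrightarrow> a \<in> carrier G \<Longrightarrow> conj g (inv a) = inv (conj g a)"
  by (simp add: m_assoc inv_mult_group)

lemma conj_conj: "g \<in> carrier G \<Longrightarrow> h \<in> carrier G \<Longrightarrow> a \<in> carrier G \<Longrightarrow> conj g (conj h a) = conj (g \<otimes> h) a"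
  by (simp add: m_assoc inv_mult_group)

lemma conj_pow_Suc:
  fixes j :: nat
  assumes "t \<in> carrier G" "b \<in> carrier G"
  shows "conj t (conj (t [^] j) b) = conj (t [^] Suc j) b"
  unfolding nat_pow_Suc2[OF assms(1)] using assms by (intro conj_conj) auto

lemma conj_nat_pow: "g \<in> carrier G \<Longrightarrow> a \<in> carrier G \<Longrightarrow> conj g (a [^] (n :: nat)) = conj g a [^] n"
  by (induction n) (auto simp: conj_mult)

lemma conj_int_pow: "g \<in> carrier G \<Longrightarrow> a \<in> carrier G \<Longrightarrow> conj g (a [^] (n :: int)) = conj g a [^] n"
  by (cases n rule: int_cases2) (auto simp: int_pow_int int_pow_neg conj_nat_pow conj_inv)

lemma conj_by_A: "a \<in> A \<Longrightarrow> b \<in> A \<Longrightarrow> conj a b = b"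
  by (subst comm_A) (auto simp: m_assoc)

text \<open>The two products differ by a commutator, which lies in \<open>A\<close> and acts
  trivially on the abelian group \<open>A\<close>. The action thus factors through the
  abelianization, and all operators on \<open>A\<close> commute.\<close>

lemma conj_commute:
  assumes "g \<in> carrier G" "h \<in> carrier G" "a \<in> A"
  shows "conj g (conj h a) = conj h (conj g a)"
proof -
  let ?c = "g \<otimes> h \<otimes> inv g \<otimes> inv h"
  have "g \<otimes> h = ?c \<otimes> (h \<otimes> g)" using assms by (simp add: m_assoc inv_solve_left)
  then have "conj g (conj h a) = conj (?c \<otimes> (h \<otimes> g)) a"
    using assms conj_conj[of g h a] by simp
  also have "\<dots> = conj ?c (conj (h \<otimes> g) a)"
    using assms by (intro conj_conj[symmetric]) auto
  also have "\<dots> = conj (h \<otimes> g) a"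
    using assms by (intro conj_by_A) (auto simp: commutator_A)
  also have "\<dots> = conj h (conj g a)"
    using assms by (intro conj_conj[symmetric]) auto
  finally show ?thesis .
qed

lemma conj_cancel [simp]:
  assumes "g \<in> carrier G" "a \<in> carrier G"
  shows "conj g (conj (inv g) a) = a" "conj (inv g) (conj g a) = a"
  using conj_conj[of g "inv g" a] conj_conj[of "inv g" g a] assms by simp_all

lemma conj_eq_one_iff: "g \<in> carrier G \<Longrightarrow> a \<in> carrier G \<Longrightarrow> conj g a = \<one> \<longleftrightarrow> a = \<one>"
  by (metis conj_cancel(2) conj_one inv_closed)

lemma conj_generate_subset:
  assumes H: "subgroup H G" and g: "g \<in> carrier G" and B: "B \<subseteq> carrier G"
    and x: "x \<in> generate G B" and conj: "\<And>b. b \<in> B \<Longrightarrow> conj g b \<in> H"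
  shows "conj g x \<in> H"
  using x
proof (induction rule: generate.induct)
  case one
  then show ?case using g subgroup.one_closed[OF H] by simp
next
  case (incl h)
  then show ?case by (rule conj)
next
  case (inv h)
  then have "conj g (inv h) = inv (conj g h)" using g B by (intro conj_inv) auto
  then show ?case using conj[OF inv] subgroup.m_inv_closed[OF H] by simp
next
  case (eng h1 h2)
  have "h1 \<in> carrier G" "h2 \<in> carrier G" using eng generate_in_carrier[OF B] by auto
  then show ?case using eng subgroup.m_closed[OF H] conj_mult[OF g] by simp
qed

text \<open>In additive notation, \<open>act t p a\<close> is \<open>p(t) a\<close>, where \<open>t\<close> acts on \<open>A\<close> by conjugation.\<close>

definition act :: "'a \<Rightarrow> int poly \<Rightarrow> 'a \<Rightarrow> 'a" where
  "act t p a = fold_coeffs (\<lambda>c r. a [^] c \<otimes> conj t r) p \<one>"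

lemma act_0 [simp]: "act t 0 a = \<one>"
  by (simp add: act_def)

lemma act_pCons:
  assumes "t \<in> carrier G"
  shows "act t (pCons c p) a = a [^] c \<otimes> conj t (act t p a)"
proof (cases "c = 0 \<and> p = 0")
  case True
  then show ?thesis using assms by (simp add: act_def)
next
  case False
  then show ?thesis
    by (cases "p = 0") (auto simp: act_def fold_coeffs_pCons_coeff_not_0_eq fold_coeffs_pCons_not_0_0_eq)
qed

lemma act_closed [simp]: "t \<in> carrier G \<Longrightarrow> a \<in> A \<Longrightarrow> act t p a \<in> A"
  by (induction p) (auto simp: act_pCons)

lemma act_add:
  assumes t: "t \<in> carrier G" and a: "a \<in> A"
  shows "act t (p + q) a = act t p a \<otimes> act t q a"
proof (induction p q rule: poly_induct2)
  case (pCons c p d q)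
  have "act t (pCons c p + pCons d q) a = a [^] c \<otimes> a [^] d \<otimes> (conj t (act t p a) \<otimes> conj t (act t q a))"
    using pCons t a by (simp add: act_pCons conj_mult int_pow_mult del: conj_A)
  also have "\<dots> = (a [^] c \<otimes> conj t (act t p a)) \<otimes> (a [^] d \<otimes> conj t (act t q a))"
    using a conj_A[OF t act_closed[OF t a]] by (simp add: m_assoc A_lcomm del: conj_A)
  finally show ?case by (simp only: act_pCons[OF t])
qed simp

lemma act_smult:
  assumes t: "t \<in> carrier G" and a: "a \<in> A"
  shows "act t (smult c p) a = act t p a [^] c"
proof (induction p)
  case (pCons d p)
  have "conj t (act t p a) \<in> A" using t a by simp
  then show ?case using pCons t a
    by (simp add: act_pCons A_int_pow_mult conj_int_pow int_pow_pow mult.commute del: conj_A)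
qed simp

lemma act_mult:
  assumes t: "t \<in> carrier G" and a: "a \<in> A"
  shows "act t (p * q) a = act t p (act t q a)"
proof (induction p)
  case (pCons c p)
  show ?case using t a pCons
    by (simp add: act_add act_smult act_pCons)
qed simp

lemma act_dvd:
  assumes "t \<in> carrier G" "a \<in> A" "p dvd q" "act t p a = \<one>"
  shows "act t q a = \<one>"
proof -
  obtain r where "q = r * p" using assms(3) by (metis dvdE mult.commute)
  then have "act t q a = act t r \<one>" using assms(1,2,4) by (simp add: act_mult)
  also have "\<dots> = \<one>" using assms(1) by (induction r) (auto simp: act_pCons)
  finally show ?thesis .
qed

lemma act_1 [simp]: "t \<in> carrier G \<Longrightarrow> a \<in> carrier G \<Longrightarrow> act t 1 a = a"
  by (simp add: one_pCons act_pCons)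

lemma act_arg_one [simp]: "t \<in> carrier G \<Longrightarrow> act t p \<one> = \<one>"
  by (induction p) (auto simp: act_pCons)

lemma act_arg_mult:
  assumes t: "t \<in> carrier G" and a: "a \<in> A" "b \<in> A"
  shows "act t p (a \<otimes> b) = act t p a \<otimes> act t p b"
proof (induction p)
  case (pCons c p)
  define u v where "u = conj t (act t p a)" and "v = conj t (act t p b)"
  have uv: "u \<in> A" "v \<in> A" unfolding u_def v_def using t a by auto
  have "conj t (act t p (a \<otimes> b)) = u \<otimes> v"
    using pCons t a by (simp only: u_def v_def conj_mult act_closed A_closed)
  then have "act t (pCons c p) (a \<otimes> b) = (a [^] c \<otimes> b [^] c) \<otimes> (u \<otimes> v)"
    using a by (simp only: act_pCons[OF t] A_int_pow_mult)
  also have "\<dots> = (a [^] c \<otimes> u) \<otimes> (b [^] c \<otimes> v)"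
    using uv a by (simp add: m_assoc A_lcomm)
  finally show ?case by (simp only: act_pCons[OF t] u_def v_def)
qed simp

lemma act_arg_inv:
  assumes t: "t \<in> carrier G" and a: "a \<in> A"
  shows "act t p (inv a) = inv (act t p a)"
proof -
  have "act t p (inv a) \<otimes> act t p a = \<one>"
    using act_arg_mult[OF t A_inv[OF a] a, of p] a t by simp
  then show ?thesis using t a by (intro inv_equality[symmetric]) auto
qed

lemma act_monom:
  assumes t: "t \<in> carrier G" and a: "a \<in> A"
  shows "act t (monom c n) a = conj (t [^] n) a [^] c"
proof (induction n)
  case 0
  then show ?case using t a by (simp add: monom_0 act_pCons)
next
  case (Suc n)
  have "act t (monom c (Suc n)) a = conj t (conj (t [^] n) (a [^] c))"
    using t a Suc by (simp add: monom_Suc act_pCons conj_int_pow)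
  also have "\<dots> = conj (t [^] Suc n) (a [^] c)"
    using t a by (intro conj_pow_Suc) auto
  finally show ?case using t a by (simp add: conj_int_pow)
qed

text \<open>Turns relations for \<open>t [^] N\<close> into relations for \<open>t\<close> in the
  variable X^N.\<close>

lemma act_pow:
  assumes t: "t \<in> carrier G" and a: "a \<in> A"
  shows "act (t [^] N) p a = act t (pcompose p (monom 1 N)) a"
proof (induction p)
  case (pCons c p)
  have "act t (pcompose (pCons c p) (monom 1 N)) a = a [^] c \<otimes> act t (monom 1 N) (act t (pcompose p (monom 1 N)) a)"
    unfolding pcompose_pCons using t a by (simp add: act_add act_mult act_pCons)
  also have "act t (monom 1 N) (act t (pcompose p (monom 1 N)) a) = conj (t [^] N) (act (t [^] N) p a)"
    using t a pCons by (simp add: act_monom)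
  finally show ?case using t by (simp only: act_pCons nat_pow_closed)
qed simp

definition small_relation :: "'a \<Rightarrow> 'a \<Rightarrow> bool" where
  "small_relation t a \<longleftrightarrow> (\<exists>p. p \<noteq> 0 \<and> small_coeffs p \<and> act t p a = \<one>)"

text \<open>Conjugation by \<open>t\<close> is injective, so a factor X can be cancelled from a
  relation.\<close>

lemma small_relation_normalize:
  assumes t: "t \<in> carrier G" and a: "a \<in> A" and r: "small_relation t a"
  obtains p where "small_coeffs p" "coeff p 0 \<noteq> 0" "act t p a = \<one>"
proof -
  have "\<exists>p. small_coeffs p \<and> coeff p 0 \<noteq> 0 \<and> act t p a = \<one>"
    if "p \<noteq> 0" "small_coeffs p" "act t p a = \<one>" for p
    using that
  proof (induction p)
    case (pCons c p)
    show ?case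
    proof (cases "c = 0")
      case True
      then have "act t p a = \<one>" using pCons.prems t a conj_eq_one_iff[of t "act t p a"] by (simp add: act_pCons)
      moreover have "p \<noteq> 0" using True pCons.prems by auto
      moreover have "small_coeffs p"
        unfolding small_coeffs_def
      proof
        fix i
        show "coeff p i \<in> {-1, 0, 1}"
          using pCons.prems(2)[unfolded small_coeffs_def, rule_format, of "Suc i"] by simp
      qed
      ultimately show ?thesis by (rule pCons.IH[rotated -1])
    next
      case False
      then show ?thesis using pCons.prems by (intro exI[of _ "pCons c p"]) simp
    qed
  qed simp
  then show thesis using r that unfolding small_relation_def by blast
qed

lemma small_coeffs_unit:
  assumes "small_coeffs p" "coeff p i \<noteq> 0"
  shows "coeff p i = 1 \<or> coeff p i = -1"
  using assms unfolding small_coeffs_def by blast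

subsection \<open>Finite generation of the module\<close>

text \<open>Vanishing coefficients take the place of a degree bound, so that \<open>D = 0\<close>
  admits exactly the zero polynomial.\<close>

lemma act_in_generate_orbit:
  assumes t: "t \<in> carrier G" and b: "b \<in> A" and p: "\<And>i. i \<ge> D \<Longrightarrow> coeff p i = 0"
  shows "act t p b \<in> generate G {conj (t [^] j) b | j :: nat. j < D}"
  using p
proof (induction p arbitrary: D)
  case 0
  then show ?case by (simp add: generate.one)
next
  case (pCons c p)
  let ?O = "\<lambda>D. {conj (t [^] j) b | j :: nat. j < D}"
  have "D \<noteq> 0"
  proof
    assume "D = 0"
    then have "pCons c p = 0" by (intro poly_eqI) (simp add: pCons.prems)
    then show False using pCons.hyps by auto
  qed
  then obtain D' where D': "D = Suc D'" by (cases D) auto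
  have O: "?O D \<subseteq> carrier G" "?O D' \<subseteq> carrier G" using t b by auto
  have sub: "subgroup (generate G (?O D)) G" using O(1) by (rule generate_is_subgroup)
  have "act t p b \<in> generate G (?O D')"
    using pCons.prems D' by (intro pCons.IH) (metis Suc_le_mono coeff_pCons_Suc)
  then have "conj t (act t p b) \<in> generate G (?O D)"
  proof (rule conj_generate_subset[OF sub t O(2)])
    fix x assume "x \<in> ?O D'"
    then obtain j where j: "j < D'" "x = conj (t [^] j) b" by blast
    have "conj t x = conj (t [^] Suc j) b" unfolding j(2) using t b by (simp only: conj_pow_Suc A_closed)
    moreover have "Suc j < D" using j(1) D' by simp
    ultimately have "conj t x \<in> ?O D" by blast
    then show "conj t x \<in> generate G (?O D)" by (rule generate.incl)
  qed
  moreover have "b [^] c \<in> generate G (?O D)"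
  proof -
    have "b \<in> ?O D" using \<open>D \<noteq> 0\<close> b by (intro CollectI exI[of _ 0]) auto
    then have "b \<in> generate G (?O D)" by (rule generate.incl)
    then show ?thesis using subgroup_int_pow_closed[OF sub] by blast
  qed
  ultimately show ?case unfolding act_pCons[OF t] by (rule generate.eng[rotated])
qed

text \<open>Both extreme coefficients of a normalized relation are units. The leading one expresses
  the translate by \<open>t [^] D\<close> through the lower ones, the constant one the translate by
  \<open>inv t\<close>; so the span of \<open>D\<close> translates is closed under both.\<close>

lemma orbit_span:
  assumes t: "t \<in> carrier G" and b: "b \<in> A" and r: "small_relation t b"
  obtains D where "\<And>j. j < D \<Longrightarrow> conj (t [^] Suc j) b \<in> generate G {conj (t [^] j) b | j :: nat. j < D}"
    and "conj (inv t) b \<in> generate G {conj (t [^] j) b | j :: nat. j < D}"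
    and "b \<in> generate G {conj (t [^] j) b | j :: nat. j < D}"
proof -
  obtain p where p: "small_coeffs p" "coeff p 0 \<noteq> 0" "act t p b = \<one>"
    using small_relation_normalize[OF t b r] by blast
  define D where "D = degree p"
  let ?O = "{conj (t [^] j) b | j :: nat. j < D}"
  have O: "?O \<subseteq> carrier G" using t b by auto
  have sub: "subgroup (generate G ?O) G" using O by (rule generate_is_subgroup)
  have p0: "p \<noteq> 0" using p by auto
  have unit: "x \<in> generate G ?O" if "x [^] c \<in> generate G ?O" "c = 1 \<or> c = -1" "x \<in> carrier G" for x and c :: int
    using that subgroup.m_inv_closed[OF sub, of "inv x"] by (auto simp: int_pow_neg_int int_pow_neg)
  have D1: "conj (t [^] D) b \<in> generate G ?O"
  proof -
    define r where "r = p - monom (lead_coeff p) D"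
    have "p = monom (lead_coeff p) D + r" by (simp add: r_def)
    then have "\<one> = act t (monom (lead_coeff p) D) b \<otimes> act t r b" using p(3) t b act_add by metis
    then have "conj (t [^] D) b [^] lead_coeff p = inv (act t r b)"
      using t b by (metis A_closed act_closed act_monom inv_equality inv_inv inv_closed)
    moreover have "act t r b \<in> generate G ?O"
    proof (rule act_in_generate_orbit[OF t b])
      fix i assume "i \<ge> D"
      then show "coeff r i = 0" by (cases "i = D") (auto simp: r_def D_def coeff_eq_0)
    qed
    ultimately have in_O: "conj (t [^] D) b [^] lead_coeff p \<in> generate G ?O" using subgroup.m_inv_closed[OF sub] by simp
    show ?thesis
    proof (rule unit[OF in_O])
      show "lead_coeff p = 1 \<or> lead_coeff p = -1" using p0 by (intro small_coeffs_unit[OF p(1)]) simp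
    qed (use t b in simp)
  qed
  show thesis
  proof
    fix j assume "j < D"
    show "conj (t [^] Suc j) b \<in> generate G ?O"
    proof (cases "Suc j = D")
      case True
      then show ?thesis using D1 by simp
    next
      case False
      then have "Suc j < D" using \<open>j < D\<close> by simp
      then have "conj (t [^] Suc j) b \<in> ?O" by blast
      then show ?thesis by (rule generate.incl)
    qed
  next
    show "b \<in> generate G ?O"
    proof (cases "D = 0")
      case True
      then show ?thesis using D1 b by simp
    next
      case False
      then show ?thesis using b by (intro generate.incl CollectI exI[of _ 0]) auto
    qed
  next
    obtain c q where pq: "p = pCons c q" by (cases p)
    have "b [^] c \<otimes> conj t (act t q b) = \<one>" using p(3) t by (simp only: pq act_pCons)
    then have e: "b [^] c = inv (conj t (act t q b))"
      using t b conj_A[OF t act_closed[OF t b]] by (metis A_closed A_int_pow inv_equality)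
    have "conj (inv t) b [^] c = conj (inv t) (b [^] c)" using t b by (intro conj_int_pow[symmetric]) auto
    also have "\<dots> = conj (inv t) (conj t (inv (act t q b)))"
      unfolding e by (simp only: conj_inv[OF t A_closed[OF act_closed[OF t b]]])
    also have "\<dots> = inv (act t q b)" using t b by (intro conj_cancel(2)) auto
    finally have "conj (inv t) b [^] c = inv (act t q b)" .
    moreover have "act t q b \<in> generate G ?O"
    proof (rule act_in_generate_orbit[OF t b])
      fix i assume "i \<ge> D"
      then have "coeff p (Suc i) = 0" by (intro coeff_eq_0) (simp add: D_def)
      then show "coeff q i = 0" by (simp add: pq)
    qed
    ultimately have in_O: "conj (inv t) b [^] c \<in> generate G ?O" using subgroup.m_inv_closed[OF sub] by simp
    have "c = 1 \<or> c = -1" using small_coeffs_unit[OF p(1,2)] by (simp add: pq)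
    then show "conj (inv t) b \<in> generate G ?O" using t b by (intro unit[OF in_O]) auto
  qed
qed

definition stable :: "'a \<Rightarrow> 'a set \<Rightarrow> bool" where
  "stable u B \<longleftrightarrow> (\<forall>x\<in>generate G B. conj u x \<in> generate G B)"

text \<open>Each generator is replaced by its finite block of translates. Stability under a further
  \<open>u\<close> survives because conjugations commute on \<open>A\<close>; this lets the elements
  of a finite set be treated one by one.\<close>

lemma orbit_extension:
  assumes t: "t \<in> carrier G" and B: "finite B" "B \<subseteq> A" and r: "\<And>b. b \<in> B \<Longrightarrow> small_relation t b"
  obtains B' where "finite B'" "B' \<subseteq> A" "B \<subseteq> generate G B'" "stable t B'" "stable (inv t) B'"
    "\<And>u. u \<in> carrier G \<Longrightarrow> stable u B \<Longrightarrow> stable u B'"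
proof -
  let ?O = "\<lambda>b D. {conj (t [^] j) b | j :: nat. j < D}"
  define Q where "Q b D \<longleftrightarrow> (\<forall>j<D. conj (t [^] Suc j) b \<in> generate G (?O b D)) \<and>
    conj (inv t) b \<in> generate G (?O b D) \<and> b \<in> generate G (?O b D)" for b D
  have "\<forall>b\<in>B. \<exists>D. Q b D"
  proof
    fix b assume b: "b \<in> B"
    then have bA: "b \<in> A" using B by blast
    show "\<exists>D. Q b D" by (rule orbit_span[OF t bA r[OF b]]) (auto simp: Q_def)
  qed
  then obtain D where "\<forall>b\<in>B. Q b (D b)" by (rule bchoice[THEN exE])
  then have D: "\<And>b j. b \<in> B \<Longrightarrow> j < D b \<Longrightarrow> conj (t [^] Suc j) b \<in> generate G (?O b (D b))"
    "\<And>b. b \<in> B \<Longrightarrow> conj (inv t) b \<in> generate G (?O b (D b))" "\<And>b. b \<in> B \<Longrightarrow> b \<in> generate G (?O b (D b))"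
    unfolding Q_def by blast+
  define B' where "B' = (\<Union>b\<in>B. ?O b (D b))"
  have B'A: "B' \<subseteq> A" using B t by (auto simp: B'_def)
  have B'c: "B' \<subseteq> carrier G" using B'A by auto
  have sub: "subgroup (generate G B') G" using B'c by (rule generate_is_subgroup)
  have OB: "generate G (?O b (D b)) \<subseteq> generate G B'" if "b \<in> B" for b
    using that by (intro mono_generate) (auto simp: B'_def)
  have BB': "B \<subseteq> generate G B'" using D(3) OB by blast
  have st: "stable t B'"
    unfolding stable_def
  proof
    fix x assume "x \<in> generate G B'"
    then show "conj t x \<in> generate G B'"
    proof (rule conj_generate_subset[OF sub t B'c])
      fix y assume "y \<in> B'"
      then obtain b j where bj: "b \<in> B" "j < D b" "y = conj (t [^] j) b" by (auto simp: B'_def)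
      then have "conj t y = conj (t [^] Suc j) b"
        using t subsetD[OF B(2) bj(1)] by (simp only: conj_pow_Suc A_closed)
      then show "conj t y \<in> generate G B'" using D(1)[OF bj(1,2)] OB[OF bj(1)] by auto
    qed
  qed
  have sti: "stable (inv t) B'"
    unfolding stable_def
  proof
    fix x assume "x \<in> generate G B'"
    then show "conj (inv t) x \<in> generate G B'"
    proof (rule conj_generate_subset[OF sub inv_closed[OF t] B'c])
      fix y assume "y \<in> B'"
      then obtain b j where bj: "b \<in> B" "j < D b" "y = conj (t [^] j) b" by (auto simp: B'_def)
      have bA: "b \<in> A" using bj B by blast
      show "conj (inv t) y \<in> generate G B'"
      proof (cases j)
        case 0
        then have "conj (inv t) y = conj (inv t) b" using bj bA by simp
        then show ?thesis using D(2)[OF bj(1)] OB[OF bj(1)] by auto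
      next
        case (Suc i)
        then have "y = conj t (conj (t [^] i) b)" using bj t bA by (simp only: conj_pow_Suc A_closed)
        then have "conj (inv t) y = conj (t [^] i) b" using conj_cancel(2)[OF t, of "conj (t [^] i) b"] t bA by simp
        then have "conj (inv t) y \<in> B'" using bj Suc by (auto simp: B'_def intro!: bexI[of _ b] exI[of _ i])
        then show ?thesis by (rule generate.incl)
      qed
    qed
  qed
  have pow: "conj (t [^] j) x \<in> generate G B'" if "x \<in> generate G B'" for x and j :: nat
  proof (induction j)
    case 0
    then show ?case using that generate_in_carrier[OF B'c] by simp
  next
    case (Suc j)
    then have "conj t (conj (t [^] j) x) \<in> generate G B'" using st unfolding stable_def by blast
    moreover have "conj t (conj (t [^] j) x) = conj (t [^] Suc j) x"
      using t generate_in_carrier[OF B'c that] by (simp only: conj_pow_Suc)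
    ultimately show ?case by simp
  qed
  have "stable u B'" if u: "u \<in> carrier G" and us: "stable u B" for u
    unfolding stable_def
  proof
    fix x assume "x \<in> generate G B'"
    then show "conj u x \<in> generate G B'"
    proof (rule conj_generate_subset[OF sub u B'c])
      fix y assume "y \<in> B'"
      then obtain b j where bj: "b \<in> B" "j < D b" "y = conj (t [^] j) b" by (auto simp: B'_def)
      have bA: "b \<in> A" using bj B by blast
      have "conj u b \<in> generate G B" using us bj(1) unfolding stable_def by (meson generate.incl)
      also have "generate G B \<subseteq> generate G B'"
        by (rule generate_subgroup_incl[OF BB' sub])
      finally have "conj (t [^] j) (conj u b) \<in> generate G B'" by (rule pow)
      moreover have "conj (t [^] j) (conj u b) = conj u y"
        unfolding bj(3) using t u bA by (intro conj_commute) auto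
      ultimately show "conj u y \<in> generate G B'" by simp
    qed
  qed
  moreover have "finite B'" using B(1) by (simp add: B'_def)
  ultimately show thesis using that[of B'] B'A BB' st sti by blast
qed

lemma stable_extension:
  assumes "finite T" "T \<subseteq> carrier G" "finite B" "B \<subseteq> A"
    and r: "\<And>t a. t \<in> carrier G \<Longrightarrow> a \<in> A \<Longrightarrow> small_relation t a"
  shows "\<exists>B'. finite B' \<and> B' \<subseteq> A \<and> B \<subseteq> generate G B' \<and> (\<forall>t\<in>T. stable t B' \<and> stable (inv t) B')"
  using assms(1,2)
proof (induction T rule: finite_induct)
  case empty
  then show ?case using assms(3,4) by (intro exI[of _ B]) (auto intro: generate.incl)
next
  case (insert t T)
  then obtain B1 where B1: "finite B1" "B1 \<subseteq> A" "B \<subseteq> generate G B1" "\<forall>t\<in>T. stable t B1 \<and> stable (inv t) B1" by auto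
  have t: "t \<in> carrier G" using insert.prems by simp
  obtain B2 where B2: "finite B2" "B2 \<subseteq> A" "B1 \<subseteq> generate G B2" "stable t B2" "stable (inv t) B2"
    "\<And>u. u \<in> carrier G \<Longrightarrow> stable u B1 \<Longrightarrow> stable u B2"
    using orbit_extension[OF t B1(1,2)] r t B1(2) by blast
  have "B2 \<subseteq> carrier G" using B2(2) by auto
  then have "generate G B1 \<subseteq> generate G B2"
    by (intro generate_subgroup_incl[OF B2(3)] generate_is_subgroup)
  moreover have "stable s B2 \<and> stable (inv s) B2" if "s \<in> T" for s
    using B2(6) B1(4) that insert.prems by auto
  ultimately show ?case using B1(3) B2 by (intro exI[of _ B2]) auto
qed

section \<open>Commutator identities and generators of the derived subgroup\<close>

lemma commutator_mult_left:
  assumes "g \<in> carrier G" "g' \<in> carrier G" "s \<in> carrier G"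
  shows "(g \<otimes> g') \<otimes> s \<otimes> inv (g \<otimes> g') \<otimes> inv s = conj g (g' \<otimes> s \<otimes> inv g' \<otimes> inv s) \<otimes> (g \<otimes> s \<otimes> inv g \<otimes> inv s)"
  using assms by (simp add: m_assoc inv_mult_group inv_solve_left)

lemma commutator_mult_right:
  assumes "g \<in> carrier G" "g' \<in> carrier G" "s \<in> carrier G"
  shows "s \<otimes> (g \<otimes> g') \<otimes> inv s \<otimes> inv (g \<otimes> g') = (s \<otimes> g \<otimes> inv s \<otimes> inv g) \<otimes> conj g (s \<otimes> g' \<otimes> inv s \<otimes> inv g')"
  using assms by (simp add: m_assoc inv_mult_group inv_solve_left)

lemma commutator_inv:
  assumes "g \<in> carrier G" "s \<in> carrier G"
  shows "inv (g \<otimes> s \<otimes> inv g \<otimes> inv s) = s \<otimes> g \<otimes> inv s \<otimes> inv g"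
  using assms by (simp add: m_assoc inv_mult_group)

lemma commutator_inv_left:
  assumes "g \<in> carrier G" "s \<in> carrier G"
  shows "inv g \<otimes> s \<otimes> inv (inv g) \<otimes> inv s = conj (inv g) (inv (g \<otimes> s \<otimes> inv g \<otimes> inv s))"
  using assms by (simp add: m_assoc inv_mult_group)

text \<open>The identities reduce one argument at a time to generators; between the two passes the
  arguments are swapped by inverting the commutator.\<close>

lemma commutators_in_normal:
  assumes N: "subgroup N G" and norm: "\<And>g x. g \<in> carrier G \<Longrightarrow> x \<in> N \<Longrightarrow> conj g x \<in> N"
    and S: "S \<subseteq> carrier G" "generate G S = carrier G"
    and gens: "\<And>s s'. s \<in> S \<Longrightarrow> s' \<in> S \<Longrightarrow> s \<otimes> s' \<otimes> inv s \<otimes> inv s' \<in> N"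
    and gh: "g \<in> carrier G" "h \<in> carrier G"
  shows "g \<otimes> h \<otimes> inv g \<otimes> inv h \<in> N"
proof -
  have step: "g \<otimes> s \<otimes> inv g \<otimes> inv s \<in> N"
    if g: "g \<in> generate G S" and s: "s \<in> carrier G" and base: "\<And>t. t \<in> S \<Longrightarrow> t \<otimes> s \<otimes> inv t \<otimes> inv s \<in> N" for g s
    using g
  proof (induction rule: generate.induct)
    case one
    then show ?case using s subgroup.one_closed[OF N] by simp
  next
    case (incl h)
    then show ?case by (rule base)
  next
    case (inv h)
    have "h \<in> carrier G" using inv S by auto
    then show ?case unfolding commutator_inv_left[OF \<open>h \<in> carrier G\<close> s]
      using base[OF inv] by (intro norm subgroup.m_inv_closed[OF N]) auto
  next
    case (eng h1 h2)
    have c: "h1 \<in> carrier G" "h2 \<in> carrier G" using eng S by auto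
    show ?case unfolding commutator_mult_left[OF c s]
      by (rule subgroup.m_closed[OF N norm[OF c(1) eng.IH(2)] eng.IH(1)])
  qed
  have 1: "g \<otimes> s \<otimes> inv g \<otimes> inv s \<in> N" if "g \<in> carrier G" "s \<in> S" for g s
  proof (rule step)
    show "g \<in> generate G S" "s \<in> carrier G" using that S by auto
  qed (rule gens[OF _ that(2)])
  have 2: "s \<otimes> g \<otimes> inv s \<otimes> inv g \<in> N" if "g \<in> carrier G" "s \<in> S" for g s
  proof -
    have "s \<in> carrier G" using that S by auto
    then show ?thesis
      using subgroup.m_inv_closed[OF N 1[OF that]] commutator_inv[OF that(1)] by simp
  qed
  show ?thesis
  proof (rule step)
    show "g \<in> generate G S" using gh S by simp
  qed (use gh(2) 2 in auto)
qed

text \<open>The commutators of generators are enlarged to a finite set whose span is stable under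
  all generators, hence normal. The span then contains all commutators, and \<open>A_min\<close>,
  the minimality of the derived subgroup, concludes.\<close>

lemma finitely_generated_A:
  assumes S: "finite S" "S \<subseteq> carrier G" "generate G S = carrier G"
    and A_min: "\<And>N. subgroup N G \<Longrightarrow> (\<And>g h. g \<in> carrier G \<Longrightarrow> h \<in> carrier G \<Longrightarrow> g \<otimes> h \<otimes> inv g \<otimes> inv h \<in> N) \<Longrightarrow> A \<subseteq> N"
    and r: "\<And>t a. t \<in> carrier G \<Longrightarrow> a \<in> A \<Longrightarrow> small_relation t a"
  shows "\<exists>B. finite B \<and> B \<subseteq> A \<and> generate G B = A"
proof -
  define B0 where "B0 = (\<lambda>(s, s'). s \<otimes> s' \<otimes> inv s \<otimes> inv s') ` (S \<times> S)"
  have B0: "finite B0" "B0 \<subseteq> A" using S commutator_A by (auto simp: B0_def subset_iff)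
  obtain B where B: "finite B" "B \<subseteq> A" "B0 \<subseteq> generate G B" "\<forall>t\<in>S. stable t B \<and> stable (inv t) B"
    using stable_extension[OF S(1,2) B0 r] by blast
  have Bc: "B \<subseteq> carrier G" using B(2) by auto
  have sub: "subgroup (generate G B) G" using Bc by (rule generate_is_subgroup)
  have norm: "conj g x \<in> generate G B" if g: "g \<in> carrier G" and x: "x \<in> generate G B" for g x
  proof -
    have "g \<in> generate G S" using g S by simp
    then have "\<forall>x\<in>generate G B. conj g x \<in> generate G B"
    proof (induction rule: generate.induct)
      case one
      then show ?case using generate_in_carrier[OF Bc] by simp
    next
      case (incl h)
      then show ?case using B(4) unfolding stable_def by blast
    next
      case (inv h)
      then show ?case using B(4) unfolding stable_def by blast
    next
      case (eng h1 h2)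
      then have c: "h1 \<in> carrier G" "h2 \<in> carrier G" using S by auto
      show ?case
      proof
        fix x assume x: "x \<in> generate G B"
        have "conj (h1 \<otimes> h2) x = conj h1 (conj h2 x)"
          using c generate_in_carrier[OF Bc x] by (simp only: conj_conj)
        then show "conj (h1 \<otimes> h2) x \<in> generate G B" using eng.IH x by simp
      qed
    qed
    then show ?thesis using x by blast
  qed
  have "A \<subseteq> generate G B"
  proof (rule A_min[OF sub])
    fix g h assume gh: "g \<in> carrier G" "h \<in> carrier G"
    show "g \<otimes> h \<otimes> inv g \<otimes> inv h \<in> generate G B"
    proof (rule commutators_in_normal[OF sub _ S(2,3) _ gh])
      show "conj g x \<in> generate G B" if "g \<in> carrier G" "x \<in> generate G B" for g x
        using that by (rule norm)
    next
      fix s s' assume "s \<in> S" "s' \<in> S"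
      then have "s \<otimes> s' \<otimes> inv s \<otimes> inv s' \<in> B0" by (auto simp: B0_def)
      then show "s \<otimes> s' \<otimes> inv s \<otimes> inv s' \<in> generate G B" using B(3) by blast
    qed
  qed
  moreover have "generate G B \<subseteq> A" by (rule generate_subgroup_incl[OF B(2) subgroup_A])
  ultimately show ?thesis using B by blast
qed

subsection \<open>Unipotence\<close>

text \<open>The polynomials that annihilate one element of \<open>A\<close> form an ideal as in
  \<open>ideal_contains_cyclotomic_power\<close>; the small relations of all powers of
  \<open>t\<close> supply its hypothesis. Merging exponents then covers the finitely many
  generators.\<close>

lemma unipotent_power:
  assumes B: "finite B" "B \<subseteq> A" "generate G B = A"
    and r: "\<And>t a. t \<in> carrier G \<Longrightarrow> a \<in> A \<Longrightarrow> small_relation t a" and t: "t \<in> carrier G"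
  shows "\<exists>M\<ge>1. \<exists>k. \<forall>a\<in>A. act t ((monom 1 M - 1) ^ k) a = \<one>"
proof -
  have single: "\<exists>M\<ge>1. \<exists>k. act t ((monom 1 M - 1) ^ k) a = \<one>" if a: "a \<in> A" for a
  proof -
    let ?I = "{p. act t p a = \<one>}"
    have "\<exists>M\<ge>1. \<exists>k. (monom 1 M - 1) ^ k \<in> ?I"
    proof (rule ideal_contains_cyclotomic_power)
      fix N :: nat assume "N \<ge> 1"
      obtain p where "small_coeffs p" "coeff p 0 \<noteq> 0" "act (t [^] N) p a = \<one>"
        using small_relation_normalize[OF nat_pow_closed[OF t] a r] t a by blast
      then show "\<exists>P. small_coeffs P \<and> coeff P 0 \<noteq> 0 \<and> pcompose P (monom 1 N) \<in> ?I"
        using act_pow[OF t a] by auto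
    qed (use t a in \<open>auto simp: act_add act_mult\<close>)
    then show ?thesis by simp
  qed
  have "\<exists>M\<ge>1. \<exists>k. \<forall>a\<in>B. act t ((monom 1 M - 1) ^ k) a = \<one>"
    using B(1,2)
  proof (induction B rule: finite_induct)
    case (insert b B)
    obtain M k where Mk: "M \<ge> 1" "\<forall>a\<in>B. act t ((monom 1 M - 1) ^ k) a = \<one>" using insert by auto
    obtain M' k' where Mk': "M' \<ge> 1" "act t ((monom 1 M' - 1) ^ k') b = \<one>" using single[of b] insert.prems by auto
    let ?q = "(monom 1 (M * M') - 1) ^ (k + k') :: int poly"
    have "(monom 1 M - 1) ^ k dvd ?q" by (rule monom_minus_one_power_dvd)
    moreover have "(monom 1 M' - 1) ^ k' dvd ?q"
      using monom_minus_one_power_dvd[of M' k' M k] by (simp only: mult.commute add.commute)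
    ultimately have "\<forall>a\<in>insert b B. act t ?q a = \<one>"
      using Mk(2) Mk'(2) act_dvd[OF t] insert.prems by blast
    moreover have "M * M' \<ge> 1" using Mk(1) Mk'(1) by (simp add: Suc_leI)
    ultimately show ?case by blast
  qed auto
  then obtain M k where Mk: "M \<ge> 1" "\<And>b. b \<in> B \<Longrightarrow> act t ((monom 1 M - 1) ^ k) b = \<one>" by blast
  have "act t ((monom 1 M - 1) ^ k) a = \<one>" if "a \<in> A" for a
  proof -
    have "a \<in> generate G B" using that B by simp
    then show ?thesis
    proof (induction rule: generate.induct)
      case (inv h)
      then show ?case using Mk(2) B(2) t act_arg_inv[OF t, of h] by auto
    next
      case (eng h1 h2)
      have "h1 \<in> A" "h2 \<in> A" using eng B(3) by auto
      then show ?case using eng by (simp add: act_arg_mult[OF t])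
    qed (use t Mk in auto)
  qed
  then show ?thesis using Mk(1) by blast
qed

end

section \<open>Unipotent actions\<close>

lemma generate_in_subgroup_monoid:
  assumes "group G" "subgroup H G" "subgroup D G" "D \<subseteq> H" "K \<subseteq> D"
  shows "generate (G\<lparr>carrier := H\<rparr>) K \<subseteq> D"
proof
  interpret group G by fact
  fix x assume "x \<in> generate (G\<lparr>carrier := H\<rparr>) K"
  then show "x \<in> D"
  proof (induction rule: generate.induct)
    case one
    then show ?case using subgroup.one_closed[OF assms(3)] by simp
  next
    case (incl h)
    then show ?case using assms by blast
  next
    case (inv h)
    have "m_inv (G\<lparr>carrier := H\<rparr>) h = m_inv G h"
      using inv assms by (intro m_inv_consistent) auto
    moreover have "h \<in> D" using inv assms by blast
    ultimately show ?case using subgroup.m_inv_closed[OF assms(3)] by simp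
  next
    case (eng h1 h2)
    then show ?case using subgroup.m_closed[OF assms(3)] by simp
  qed
qed

context metabelian_pair begin

text \<open>In additive notation, \<open>bra g\<close> is the action of \<open>g - 1\<close> on \<open>A\<close>.\<close>

definition bra :: "'a \<Rightarrow> 'a \<Rightarrow> 'a" where
  "bra g a = conj g a \<otimes> inv a"

abbreviation comm :: "'a \<Rightarrow> 'a \<Rightarrow> 'a" where
  "comm g h \<equiv> g \<otimes> h \<otimes> inv g \<otimes> inv h"

lemma bra_A [simp]: "g \<in> carrier G \<Longrightarrow> a \<in> A \<Longrightarrow> bra g a \<in> A"
  by (simp add: bra_def)

lemma conj_bra: "g \<in> carrier G \<Longrightarrow> a \<in> carrier G \<Longrightarrow> conj g a = bra g a \<otimes> a"
  by (simp add: bra_def m_assoc)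

lemma bra_mult:
  assumes g: "g \<in> carrier G" and a: "a \<in> A" "b \<in> A"
  shows "bra g (a \<otimes> b) = bra g a \<otimes> bra g b"
proof -
  define x y where "x = conj g a" and "y = conj g b"
  have xy: "x \<in> A" "y \<in> A" using g a by (simp_all only: x_def y_def conj_A)
  have "conj g (a \<otimes> b) = x \<otimes> y" using g a by (simp only: x_def y_def conj_mult A_closed)
  then have "bra g (a \<otimes> b) = x \<otimes> y \<otimes> (inv a \<otimes> inv b)"
    using a by (simp only: bra_def A_inv_mult)
  also have "\<dots> = (x \<otimes> inv a) \<otimes> (y \<otimes> inv b)"
    using a xy by (simp add: m_assoc A_lcomm)
  finally show ?thesis by (simp only: bra_def x_def y_def)
qed

lemma bra_one [simp]: "g \<in> carrier G \<Longrightarrow> bra g \<one> = \<one>"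
  by (simp add: bra_def)

lemma bra_inv:
  assumes g: "g \<in> carrier G" and a: "a \<in> A"
  shows "bra g (inv a) = inv (bra g a)"
proof -
  have "bra g (inv a) \<otimes> bra g a = \<one>"
    using bra_mult[OF g A_inv[OF a] a] a g by simp
  then show ?thesis using g a by (intro inv_equality[symmetric]) auto
qed

lemma bra_nat_pow: "g \<in> carrier G \<Longrightarrow> a \<in> A \<Longrightarrow> bra g (a [^] (n :: nat)) = bra g a [^] n"
  by (induction n) (auto simp: bra_mult)

lemma bra_conj:
  assumes g: "g \<in> carrier G" "h \<in> carrier G" and a: "a \<in> A"
  shows "bra g (conj h a) = conj h (bra g a)"
  unfolding bra_def using conj_commute[OF g a] g a
  by (simp only: conj_mult conj_inv A_closed conj_A A_inv)

lemma bra_commute: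
  assumes g: "g \<in> carrier G" "h \<in> carrier G" and a: "a \<in> A"
  shows "bra g (bra h a) = bra h (bra g a)"
proof -
  have "bra g (bra h a) = bra g (conj h a) \<otimes> inv (bra g a)"
    unfolding bra_def[of h a] using g a by (simp only: bra_mult conj_A A_inv bra_inv)
  also have "\<dots> = conj h (bra g a) \<otimes> inv (bra g a)" using g a by (simp only: bra_conj)
  finally show ?thesis by (simp only: bra_def[of h "bra g a"])
qed

text \<open>The operator identity g h - 1 = (g - 1) h + (h - 1).\<close>

lemma bra_mult_left:
  assumes g: "g \<in> carrier G" "h \<in> carrier G" and a: "a \<in> A"
  shows "bra (g \<otimes> h) a = bra g (conj h a) \<otimes> bra h a"
proof -
  define x where "x = conj h a"
  have x: "x \<in> A" using g a by (simp only: x_def conj_A)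
  have "conj (g \<otimes> h) a = conj g x" using g a by (simp only: x_def conj_conj A_closed)
  moreover have "conj g x \<in> A" using g(1) x by (rule conj_A)
  ultimately show ?thesis using x a by (simp only: bra_def x_def[symmetric]) (simp add: m_assoc)
qed

lemma bra_by_one [simp]: "a \<in> carrier G \<Longrightarrow> bra \<one> a = \<one>"
  by (simp add: bra_def)

lemma bra_by_A: "a \<in> A \<Longrightarrow> b \<in> A \<Longrightarrow> bra a b = \<one>"
  by (simp add: bra_def conj_by_A)

lemma funpow_bra_A [simp]: "u \<in> carrier G \<Longrightarrow> a \<in> A \<Longrightarrow> (bra u ^^ k) a \<in> A"
  by (induction k) auto

lemma act_bra:
  assumes t: "t \<in> carrier G" and a: "a \<in> A"
  shows "act t ([:-1, 1:] ^ k) a = (bra t ^^ k) a"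
proof (induction k)
  case (Suc k)
  have "act t ([:-1, 1:] ^ Suc k) a = act t [:-1, 1:] ((bra t ^^ k) a)"
    using Suc t a by (simp only: power_Suc act_mult)
  also have "\<dots> = bra t ((bra t ^^ k) a)"
  proof -
    define x where "x = (bra t ^^ k) a"
    have x: "x \<in> A" using t a by (simp add: x_def)
    have "x [^] (- 1 :: int) = inv x" using int_pow_neg[of x 1] x by simp
    moreover have "conj t x \<in> A" using x t by (rule conj_A[rotated])
    ultimately show ?thesis using x t comm_A[of "inv x" "conj t x"]
      by (simp add: act_pCons bra_def x_def[symmetric])
  qed
  finally show ?case by simp
qed (use t a in simp)

text \<open>Substituting X^M into (X - 1)^k gives the annihilating polynomial, so the M-th power
  acts unipotently.\<close>

lemma bra_pow_nilpotent:
  assumes t: "t \<in> carrier G" and a: "a \<in> A" and nil: "act t ((monom 1 M - 1) ^ k) a = \<one>"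
  shows "(bra (t [^] M) ^^ k) a = \<one>"
proof -
  have "(bra (t [^] M) ^^ k) a = act (t [^] M) ([:-1, 1:] ^ k) a"
    using t a by (simp only: act_bra nat_pow_closed)
  also have "\<dots> = act t (pcompose ([:-1, 1:] ^ k) (monom 1 M)) a" by (rule act_pow[OF t a])
  also have "pcompose ([:-1, 1:] ^ k) (monom 1 M) = (monom 1 M - 1 :: int poly) ^ k"
  proof -
    have "pcompose [:-1, 1:] (monom 1 M) = (monom 1 M - 1 :: int poly)"
      by (simp add: pcompose_pCons one_pCons)
    moreover have "pcompose (q ^ k) r = pcompose q r ^ k" for q r :: "int poly"
      by (induction k) (simp_all add: pcompose_mult pcompose_1)
    ultimately show ?thesis by (simp only:)
  qed
  finally show ?thesis using nil by simp
qed

end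

text \<open>In the application \<open>U\<close> consists of the chosen independent powers of
  generators and their inverses; passing to powers is what makes the action unipotent.\<close>

locale unipotent_pair = metabelian_pair G A for G (structure) and A +
  fixes U B :: "'a set" and K :: nat
  assumes finite_U: "finite U" and U_carrier: "U \<subseteq> carrier G" and U_inv: "u \<in> U \<Longrightarrow> inv u \<in> U"
    and finite_B: "finite B" and generate_B: "generate G B = A"
    and nilpotent: "u \<in> U \<Longrightarrow> a \<in> A \<Longrightarrow> (bra u ^^ K) a = \<one>"
begin

lemma U_closed [simp]: "u \<in> U \<Longrightarrow> u \<in> carrier G"
  using U_carrier by blast

lemma B_A: "b \<in> B \<Longrightarrow> b \<in> A"
  using generate.incl[of b B G] generate_B by simp

abbreviation bras :: "'a list \<Rightarrow> 'a \<Rightarrow> 'a" where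
  "bras l a \<equiv> foldr bra l a"

lemma bras_A [simp]: "set l \<subseteq> U \<Longrightarrow> a \<in> A \<Longrightarrow> bras l a \<in> A"
  by (induction l) auto

lemma bras_one [simp]: "set l \<subseteq> U \<Longrightarrow> bras l \<one> = \<one>"
  by (induction l) auto

lemma bras_bra: "set l \<subseteq> U \<Longrightarrow> u \<in> U \<Longrightarrow> a \<in> A \<Longrightarrow> bra u (bras l a) = bras l (bra u a)"
  by (induction l) (auto simp: bra_commute[of u])

text \<open>The operators commute, so all occurrences of \<open>u\<close> can be moved
  innermost.\<close>

lemma bras_filter:
  assumes "set l \<subseteq> U" "u \<in> U" "a \<in> A"
  shows "bras l a = bras (filter (\<lambda>v. v \<noteq> u) l) ((bra u ^^ count_list l u) a)"
  using assms(1)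
proof (induction l)
  case (Cons v l)
  then show ?case using assms(2,3) bras_bra[of "filter (\<lambda>v. v \<noteq> u) l" u]
    by (auto simp: subset_iff)
qed simp

text \<open>By the pigeonhole principle, a list of this length contains some element of
  \<open>U\<close> at least \<open>K\<close> times.\<close>

definition depth :: nat where
  "depth = card U * K + 1"

lemma bras_nilpotent:
  assumes l: "set l \<subseteq> U" "depth \<le> length l" and a: "a \<in> A"
  shows "bras l a = \<one>"
proof -
  have "\<exists>u\<in>U. K \<le> count_list l u"
  proof (rule ccontr)
    assume "\<not> ?thesis"
    then have *: "count_list l u \<le> K" if "u \<in> U" for u using that by (meson le_cases)
    have "length l = (\<Sum>u\<in>U. count_list l u)"
      by (rule sum_count_set[OF l(1) finite_U, symmetric])
    also have "\<dots> \<le> (\<Sum>u\<in>U. K)" by (intro sum_mono *)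
    finally show False using l(2) by (simp add: depth_def)
  qed
  then obtain u where u: "u \<in> U" "K \<le> count_list l u" by blast
  then obtain k where k: "count_list l u = k + K" by (metis le_Suc_ex add.commute)
  have "(bra u ^^ k) \<one> = \<one>" using u(1) by (induction k) auto
  then have "(bra u ^^ count_list l u) a = \<one>" unfolding k funpow_add using nilpotent[OF u(1) a] by simp
  moreover have "set (filter (\<lambda>v. v \<noteq> u) l) \<subseteq> U" using l(1) by auto
  ultimately show ?thesis using bras_filter[OF l(1) u(1) a] by simp
qed

subsection \<open>Nilpotency\<close>

definition H :: "'a set" where
  "H = generate G (U \<union> A)"

lemma subgroup_H: "subgroup H G"
  unfolding H_def using U_carrier by (intro generate_is_subgroup) auto

lemma A_subset_H: "A \<subseteq> H"
  unfolding H_def by (auto intro: generate.incl)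

text \<open>The subgroup I^j A, for the augmentation ideal I of the group generated by
  \<open>U\<close>. Commutation with \<open>H\<close> moves one step down, and the series ends at
  \<open>depth\<close>.\<close>

definition central_term :: "nat \<Rightarrow> 'a set" where
  "central_term j = generate G {bras l y | l y. j \<le> length l \<and> set l \<subseteq> U \<and> y \<in> A}"

lemma central_term_subset_A: "central_term j \<subseteq> A"
  unfolding central_term_def by (rule generate_subgroup_incl[OF _ subgroup_A]) auto

lemma subgroup_central_term: "subgroup (central_term j) G"
  unfolding central_term_def by (rule generate_is_subgroup) auto

lemma central_term_Suc: "central_term (Suc j) \<subseteq> central_term j"
  unfolding central_term_def by (rule mono_generate) (blast dest: Suc_leD)

lemma bra_central_term_U:
  assumes u: "u \<in> U" and x: "x \<in> central_term j"
  shows "bra u x \<in> central_term (Suc j)"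
  using x[unfolded central_term_def]
proof (induction rule: generate.induct)
  case one
  then show ?case using u subgroup.one_closed[OF subgroup_central_term] by simp
next
  case (incl h)
  then obtain l y where "h = bras l y" "j \<le> length l" "set l \<subseteq> U" "y \<in> A" by blast
  then have "bra u h = bras (u # l) y" "Suc j \<le> length (u # l)" "set (u # l) \<subseteq> U" using u by auto
  then show ?case unfolding central_term_def using \<open>y \<in> A\<close> by (intro generate.incl) blast
next
  case (inv h)
  then obtain l y where h: "h = bras l y" "j \<le> length l" "set l \<subseteq> U" "y \<in> A" by blast
  then have "bra u h = bras (u # l) y" "Suc j \<le> length (u # l)" "set (u # l) \<subseteq> U" using u by auto
  then have "bra u h \<in> central_term (Suc j)" unfolding central_term_def using \<open>y \<in> A\<close> by (intro generate.incl) blast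
  then show ?case using h u bra_inv[of u h] subgroup.m_inv_closed[OF subgroup_central_term] by simp
next
  case (eng h1 h2)
  have "h1 \<in> A" "h2 \<in> A" using eng(1,2) central_term_subset_A[of j] unfolding central_term_def by auto
  then show ?case using eng u bra_mult[of u h1 h2] subgroup.m_closed[OF subgroup_central_term] by simp
qed

text \<open>Words reduce to letters by the identity for g h - 1, and letters in \<open>A\<close> act
  trivially.\<close>

lemma bra_central_term:
  assumes h: "h \<in> H" and x: "x \<in> central_term j"
  shows "bra h x \<in> central_term (Suc j)"
  using h[unfolded H_def] x
proof (induction arbitrary: x rule: generate.induct)
  case one
  have "x \<in> A" using one central_term_subset_A by blast
  then show ?case using subgroup.one_closed[OF subgroup_central_term] by simp
next
  case (incl h)
  then have "x \<in> A" using central_term_subset_A by blast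
  then show ?case
    using incl bra_central_term_U bra_by_A[of h x] subgroup.one_closed[OF subgroup_central_term] by auto
next
  case (inv h)
  then have "x \<in> A" using central_term_subset_A by blast
  then show ?case
    using inv bra_central_term_U U_inv bra_by_A[of "inv h" x] subgroup.one_closed[OF subgroup_central_term] by auto
next
  case (eng h1 h2)
  have c: "h1 \<in> carrier G" "h2 \<in> carrier G"
    using eng.hyps subgroup.mem_carrier[OF subgroup_H] unfolding H_def by auto
  have xA: "x \<in> A" using eng.prems central_term_subset_A by auto
  have b2: "bra h2 x \<in> central_term (Suc j)" by (rule eng.IH(2)[OF eng.prems])
  then have "bra h2 x \<in> central_term j" using central_term_Suc by blast
  then have "conj h2 x \<in> central_term j"
    unfolding conj_bra[OF c(2) A_closed[OF xA]]
    by (rule subgroup.m_closed[OF subgroup_central_term _ eng.prems])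
  then have "bra h1 (conj h2 x) \<in> central_term (Suc j)" by (rule eng.IH(1))
  then show ?case using bra_mult_left[OF c xA] b2 subgroup.m_closed[OF subgroup_central_term] by simp
qed

lemma central_term_depth: "central_term depth = {\<one>}"
proof -
  have "{bras l y | l y. depth \<le> length l \<and> set l \<subseteq> U \<and> y \<in> A} \<subseteq> {\<one>}"
    using bras_nilpotent by auto
  then have "central_term depth \<subseteq> generate G {\<one>}" unfolding central_term_def by (rule mono_generate)
  also have "\<dots> = {\<one>}" by (rule generate_one)
  finally show ?thesis using subgroup.one_closed[OF subgroup_central_term] by blast
qed

text \<open>The first commutator only lands in \<open>A\<close>, hence the shift of the index; from
  then on commutators are values of operators y - 1.\<close>

lemma lower_central_subset: "lower_central (G\<lparr>carrier := H\<rparr>) (Suc j) \<subseteq> central_term j"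
proof (induction j)
  case 0
  have inv: "m_inv (G\<lparr>carrier := H\<rparr>) x = inv x" if "x \<in> H" for x
    using that by (intro m_inv_consistent subgroup_H)
  have A: "A \<subseteq> central_term 0"
  proof
    fix a assume "a \<in> A"
    then have "a = bras [] a \<and> 0 \<le> length ([] :: 'a list) \<and> set [] \<subseteq> U \<and> a \<in> A" by simp
    then show "a \<in> central_term 0" unfolding central_term_def by (intro generate.incl) blast
  qed
  have "H \<subseteq> carrier G" using subgroup.subset[OF subgroup_H] .
  then show ?case
    unfolding lower_central.simps
    using A commutator_A central_term_subset_A A_subset_H inv
    by (intro generate_in_subgroup_monoid subgroup_H subgroup_central_term is_group) (auto simp: subset_iff)
next
  case (Suc j)
  let ?H = "G\<lparr>carrier := H\<rparr>"
  have inv: "m_inv ?H x = inv x" if "x \<in> H" for x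
    using that by (intro m_inv_consistent subgroup_H)
  have Hc: "H \<subseteq> carrier G" using subgroup.subset[OF subgroup_H] .
  have "x \<otimes> y \<otimes> m_inv ?H x \<otimes> m_inv ?H y \<in> central_term (Suc j)"
    if x: "x \<in> lower_central ?H (Suc j)" and y: "y \<in> H" for x y
  proof -
    have xc: "x \<in> central_term j" using x Suc by blast
    have xA: "x \<in> A" using xc central_term_subset_A by blast
    have yc: "y \<in> carrier G" using y Hc by blast
    have "conj y (inv x) \<in> A" using yc xA by (simp only: conj_A A_inv)
    then have "x \<otimes> conj y (inv x) = conj y (inv x) \<otimes> x" using xA by (intro comm_A)
    also have "\<dots> = bra y (inv x)" using xA by (simp add: bra_def)
    finally have "x \<otimes> y \<otimes> inv x \<otimes> inv y = bra y (inv x)" using xA yc by (simp add: m_assoc)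
    moreover have "bra y (inv x) \<in> central_term (Suc j)"
      using xc subgroup.m_inv_closed[OF subgroup_central_term] by (intro bra_central_term[OF y]) auto
    ultimately show ?thesis using inv xA A_subset_H y by auto
  qed
  moreover have "central_term (Suc j) \<subseteq> H" using central_term_subset_A A_subset_H by blast
  ultimately show ?case
    unfolding lower_central.simps(2)[of ?H "Suc j"]
    by (intro generate_in_subgroup_monoid subgroup_H subgroup_central_term is_group) auto
qed

lemma nilpotent_H: "nilpotent_group (G\<lparr>carrier := H\<rparr>)"
proof -
  have "lower_central (G\<lparr>carrier := H\<rparr>) (Suc depth) \<subseteq> {\<one>}"
    using lower_central_subset[of depth] central_term_depth by simp
  moreover have "\<one> \<in> lower_central (G\<lparr>carrier := H\<rparr>) (Suc depth)"
    using generate.one[of "G\<lparr>carrier := H\<rparr>"] by simp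
  ultimately have "lower_central (G\<lparr>carrier := H\<rparr>) (Suc depth) = {\<one>\<^bsub>G\<lparr>carrier := H\<rparr>\<^esub>}" by auto
  then show ?thesis
    unfolding nilpotent_group_def using subgroup_imp_group[OF subgroup_H] by blast
qed

end

section \<open>Weighted boxes in finitely generated abelian groups\<close>

context metabelian_pair begin

text \<open>The factor \<open>C\<close> is real because it may shrink with \<open>n\<close>: for
  \<open>C = 1 / n ^ w\<close> an item of weight \<open>w\<close> may still occur once. Hence prices
  can serve as box parameters.\<close>

primrec box :: "('a \<times> nat) list \<Rightarrow> real \<Rightarrow> nat \<Rightarrow> 'a set" where
  "box [] C n = {\<one>}"
| "box (x # L) C n = (\<lambda>(b, p). fst x [^] (b :: int) \<otimes> p) `
     ({b. \<bar>real_of_int b\<bar> \<le> C * real n ^ snd x} \<times> box L C n)"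

lemma box_ConsE:
  assumes "g \<in> box (x # L) C n"
  obtains b p where "\<bar>real_of_int b\<bar> \<le> C * real n ^ snd x" "p \<in> box L C n" "g = fst x [^] (b :: int) \<otimes> p"
  using assms by auto

lemma box_ConsI:
  "\<bar>real_of_int b\<bar> \<le> C * real n ^ snd x \<Longrightarrow> p \<in> box L C n \<Longrightarrow> fst x [^] (b :: int) \<otimes> p \<in> box (x # L) C n"
  by auto

lemma box_A: "fst ` set L \<subseteq> A \<Longrightarrow> g \<in> box L C n \<Longrightarrow> g \<in> A"
  by (induction L arbitrary: g) auto

lemma finite_int_interval: "finite {b :: int. \<bar>real_of_int b\<bar> \<le> c}"
  by (rule finite_subset[of _ "{- \<lceil>c\<rceil>..\<lceil>c\<rceil>}"]) (auto, linarith+)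

lemma finite_box: "finite (box L C n)"
  by (induction L) (auto intro: finite_int_interval)

lemma box_one: "0 \<le> C \<Longrightarrow> \<one> \<in> box L C n"
proof (induction L)
  case (Cons x L)
  then show ?case using box_ConsI[of 0 C n x \<one> L] by simp
qed simp

lemma box_mult:
  assumes L: "fst ` set L \<subseteq> A" and g: "g \<in> box L C n" and h: "h \<in> box L C' n"
  shows "g \<otimes> h \<in> box L (C + C') n"
  using assms
proof (induction L arbitrary: g h)
  case (Cons x L)
  obtain b p where bp: "\<bar>real_of_int b\<bar> \<le> C * real n ^ snd x" "p \<in> box L C n" "g = fst x [^] (b :: int) \<otimes> p"
    using Cons.prems(2) by (rule box_ConsE)
  obtain b' p' where bp': "\<bar>real_of_int b'\<bar> \<le> C' * real n ^ snd x" "p' \<in> box L C' n" "h = fst x [^] (b' :: int) \<otimes> p'"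
    using Cons.prems(3) by (rule box_ConsE)
  have xA: "fst x \<in> A" and LA: "fst ` set L \<subseteq> A" using Cons.prems(1) by auto
  have pA: "p \<in> A" "p' \<in> A" using bp(2) bp'(2) box_A[OF LA] by auto
  have "g \<otimes> h = fst x [^] (b + b') \<otimes> (p \<otimes> p')"
    unfolding bp(3) bp'(3) using xA pA by (simp add: int_pow_mult m_assoc A_lcomm)
  also have "\<dots> \<in> box (x # L) (C + C') n"
  proof (rule box_ConsI)
    show "\<bar>real_of_int (b + b')\<bar> \<le> (C + C') * real n ^ snd x"
      using bp(1) bp'(1) by (simp add: distrib_right)
  qed (rule Cons.IH[OF LA bp(2) bp'(2)])
  finally show ?case .
qed simp

lemma box_item:
  assumes L: "fst ` set L \<subseteq> A" and x: "x \<in> set L" and C: "0 \<le> C" and b: "\<bar>real_of_int b\<bar> \<le> C * real n ^ snd x"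
  shows "fst x [^] (b :: int) \<in> box L C n"
  using L x
proof (induction L)
  case (Cons y L)
  show ?case
  proof (cases "x = y")
    case True
    then show ?thesis using box_ConsI[of b C n x \<one> L] b box_one[OF C] Cons.prems by auto
  next
    case False
    then have "fst x [^] b \<in> box L C n" using Cons by auto
    moreover have "fst x \<in> A" "fst y \<in> A" using Cons.prems by auto
    then have "fst y [^] (0 :: int) \<otimes> fst x [^] b = fst x [^] b" by simp
    ultimately show ?thesis using box_ConsI[of 0 C n y "fst x [^] b" L] C by (simp del: box.simps)
  qed
qed simp

lemma generate_in_box:
  assumes L: "fst ` set L \<subseteq> A" and g: "g \<in> generate G (fst ` set L)"
  shows "\<exists>C\<ge>0. g \<in> box L C 1"
  using g
proof (induction rule: generate.induct)
  case one
  then show ?case using box_one by blast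
next
  case (incl h)
  then obtain x where x: "x \<in> set L" "h = fst x" by blast
  have "fst x \<in> A" using x L by blast
  then show ?case using box_item[OF L x(1), of 1 1 1] x(2) by (intro exI[of _ 1]) (simp add: int_pow_1)
next
  case (inv h)
  then obtain x where x: "x \<in> set L" "h = fst x" by blast
  have "fst x \<in> A" using x L by blast
  then have "fst x [^] (-1 :: int) = inv (fst x)" using int_pow_neg[of "fst x" 1] by simp
  then show ?case using box_item[OF L x(1), of 1 "-1" 1] x(2) by (intro exI[of _ 1]) simp
next
  case (eng h1 h2)
  then obtain C C' where "0 \<le> C" "0 \<le> C'" "h1 \<in> box L C 1" "h2 \<in> box L C' 1" by blast
  then show ?case using box_mult[OF L, of h1 C 1 h2 C'] by (intro exI[of _ "C + C'"]) auto
qed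

text \<open>Heavier items tolerate larger exponents, so a fixed element of their span can be raised
  to any exponent that is admissible for weight \<open>w\<close>. This absorbs a dependent item into
  heavier ones.\<close>

lemma box_scale:
  assumes L: "fst ` set L \<subseteq> A" and w: "\<And>x. x \<in> set L \<Longrightarrow> w \<le> snd x" and n: "n \<ge> 1" and E: "E \<ge> 0"
    and b: "\<bar>real_of_int b\<bar> \<le> C * real n ^ w" and g: "g \<in> box L E 1"
  shows "g [^] (b :: int) \<in> box L (E * C) n"
  using L w g
proof (induction L arbitrary: g)
  case (Cons x L)
  obtain c p where cp: "\<bar>real_of_int c\<bar> \<le> E * real 1 ^ snd x" "p \<in> box L E 1" "g = fst x [^] (c :: int) \<otimes> p"
    using Cons.prems(3) by (rule box_ConsE)
  have xA: "fst x \<in> A" and LA: "fst ` set L \<subseteq> A" using Cons.prems(1) by auto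
  have pA: "p \<in> A" using cp(2) box_A[OF LA] by auto
  have "g [^] b = fst x [^] (c * b) \<otimes> p [^] b"
    unfolding cp(3) using xA pA by (simp add: A_int_pow_mult int_pow_pow)
  also have "\<dots> \<in> box (x # L) (E * C) n"
  proof (rule box_ConsI)
    have "C \<ge> 0" using b n by (smt (verit) zero_less_power of_nat_0_less_iff mult_neg_pos less_le_trans zero_less_one)
    have "real n ^ w \<le> real n ^ snd x" using Cons.prems(2)[of x] n by (intro power_increasing) auto
    then have "\<bar>real_of_int b\<bar> \<le> C * real n ^ snd x"
      using b \<open>C \<ge> 0\<close> by (meson mult_left_mono order_trans)
    then have "\<bar>real_of_int c\<bar> * \<bar>real_of_int b\<bar> \<le> E * (C * real n ^ snd x)"
      using cp(1) E by (intro mult_mono) auto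
    then show "\<bar>real_of_int (c * b)\<bar> \<le> E * C * real n ^ snd x" by (simp add: abs_mult mult.assoc)
  qed (use Cons.IH[OF LA _ cp(2)] Cons.prems(2) in auto)
  finally show ?case .
qed simp

lemma card_int_interval_le:
  assumes "c \<ge> 0" shows "real (card {b :: int. \<bar>real_of_int b\<bar> \<le> c}) \<le> 2 * c + 1"
proof -
  have "{b :: int. \<bar>real_of_int b\<bar> \<le> c} = {- \<lfloor>c\<rfloor>..\<lfloor>c\<rfloor>}"
    by (auto simp: abs_le_iff le_floor_iff) linarith+
  then have "card {b :: int. \<bar>real_of_int b\<bar> \<le> c} = nat (2 * \<lfloor>c\<rfloor> + 1)" by simp
  moreover have "2 * \<lfloor>c\<rfloor> + 1 \<ge> 0" using assms by simp
  ultimately show ?thesis by simp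
qed

lemma card_int_interval_ge:
  "real N \<le> real (card {b :: int. \<bar>real_of_int b\<bar> \<le> real N})"
proof -
  have "{b :: int. \<bar>real_of_int b\<bar> \<le> real N} = {- int N..int N}" by auto
  then show ?thesis by simp
qed

text \<open>Going through the list from the heaviest item to the lightest, an item that is independent of
  the heavier ones adds its weight to the exponent, and one that is dependent changes only constants.\<close>

lemma box_growth:
  assumes L: "fst ` set L \<subseteq> A" and sorted: "sorted_wrt (\<lambda>x y. snd x \<le> snd y) L"
  shows "\<exists>d. (\<exists>c>0. \<forall>n\<ge>1. c * real n ^ d \<le> real (card (box L 1 n))) \<and>
    (\<forall>C\<ge>0. \<exists>c>0. \<forall>n\<ge>1. real (card (box L C n)) \<le> c * real n ^ d)"
  using assms
proof (induction L)
  case Nil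
  show ?case by (intro exI[of _ 0] conjI allI impI exI[of _ 1]) auto
next
  case (Cons x L)
  obtain y w where x: "x = (y, w)" by (cases x)
  have LA: "fst ` set L \<subseteq> A" and yA: "y \<in> A" using Cons.prems x by auto
  have wL: "w \<le> snd z" if "z \<in> set L" for z using Cons.prems(2) that x by auto
  from Cons obtain d c where c: "c > 0" "\<And>n. n \<ge> 1 \<Longrightarrow> c * real n ^ d \<le> real (card (box L 1 n))"
    and up: "\<And>C. C \<ge> 0 \<Longrightarrow> \<exists>c>0. \<forall>n\<ge>1. real (card (box L C n)) \<le> c * real n ^ d" by auto
  let ?V = "generate G (fst ` set L)"
  have V: "subgroup ?V G" using LA by (intro generate_is_subgroup) auto
  have boxV: "box L C n \<subseteq> ?V" for C n
  proof -
    have "box M C n \<subseteq> ?V" if "set M \<subseteq> set L" for M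
      using that
    proof (induction M)
      case (Cons z M)
      have "fst z \<in> ?V" using Cons.prems by (intro generate.incl) auto
      then show ?case using Cons subgroup.m_closed[OF V] subgroup_int_pow_closed[OF V] by auto
    qed (simp add: generate.one)
    then show ?thesis by blast
  qed
  show ?case
  proof (cases "\<exists>q::nat. q \<ge> 1 \<and> y [^] q \<in> ?V")
    case False
    have card: "card (box (x # L) C n) = card {b :: int. \<bar>real_of_int b\<bar> \<le> C * real n ^ w} * card (box L C n)" for C n
    proof -
      have "inj_on (\<lambda>(b, p). fst x [^] (b :: int) \<otimes> p) ({b. \<bar>real_of_int b\<bar> \<le> C * real n ^ snd x} \<times> box L C n)"
      proof (rule inj_onI, clarify)
        fix b b' :: int and p p' assume p: "p \<in> box L C n" "p' \<in> box L C n"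
          and eq: "fst x [^] b \<otimes> p = fst x [^] b' \<otimes> p'"
        have pA: "p \<in> A" "p' \<in> A" using p box_A[OF LA] by auto
        \<comment> \<open>Equal products with different exponents would put a positive power of
          \<open>y\<close> into the span of the heavier items.\<close>
        have main: False if "b < b'" "p \<in> ?V" "p' \<in> ?V" "p \<in> A" "p' \<in> A" "y [^] b \<otimes> p = y [^] b' \<otimes> p'" for b b' :: int and p p'
        proof -
          define k where "k = nat (b' - b)"
          have k: "b' = b + int k" "k \<ge> 1" using that(1) by (auto simp: k_def)
          have "y [^] b' = y [^] b \<otimes> y [^] k"
            unfolding k(1) using yA by (simp only: int_pow_mult int_pow_int A_closed)
          then have "y [^] b \<otimes> p = y [^] b \<otimes> (y [^] k \<otimes> p')"
            using that yA by (simp add: m_assoc)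
          then have "p = y [^] k \<otimes> p'" using that yA by simp
          then have "y [^] k = p \<otimes> inv p'" using that yA by (simp add: m_assoc)
          also have "\<dots> \<in> ?V" using that by (intro subgroup.m_closed[OF V] subgroup.m_inv_closed[OF V])
          finally show False using False k(2) by blast
        qed
        have pV: "p \<in> ?V" "p' \<in> ?V" using p boxV by auto
        have "b = b'"
          using main[of b b' p p'] main[of b' b p' p] pV pA eq x by (cases b b' rule: linorder_cases) auto
        then show "b = b' \<and> p = p'" using eq pA yA x by simp
      qed
      then show ?thesis by (simp add: card_image card_cartesian_product x)
    qed
    have "\<exists>c>0. \<forall>n\<ge>1. c * real n ^ (w + d) \<le> real (card (box (x # L) 1 n))"
    proof (intro exI conjI allI impI)
      fix n :: nat assume n: "n \<ge> 1"
      have "real n ^ w * (c * real n ^ d) \<le> real (card {b :: int. \<bar>real_of_int b\<bar> \<le> 1 * real n ^ w}) * real (card (box L 1 n))"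
        using card_int_interval_ge[of "n ^ w"] c(1) c(2)[OF n] by (intro mult_mono) auto
      then show "c * real n ^ (w + d) \<le> real (card (box (x # L) 1 n))"
        by (simp only: card of_nat_mult power_add mult_ac)
    qed (rule c(1))
    moreover have "\<exists>c>0. \<forall>n\<ge>1. real (card (box (x # L) C n)) \<le> c * real n ^ (w + d)" if C: "C \<ge> 0" for C
    proof -
      obtain c where c: "c > 0" "\<And>n. n \<ge> 1 \<Longrightarrow> real (card (box L C n)) \<le> c * real n ^ d" using up[OF C] by blast
      have "real (card (box (x # L) C n)) \<le> ((2 * C + 1) * c) * real n ^ (w + d)" if n: "n \<ge> 1" for n
      proof -
        have "real (card {b :: int. \<bar>real_of_int b\<bar> \<le> C * real n ^ w}) \<le> 2 * (C * real n ^ w) + 1"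
          using C by (intro card_int_interval_le) auto
        also have "\<dots> \<le> (2 * C + 1) * real n ^ w" using n by (simp add: algebra_simps one_le_power)
        finally have "real (card {b :: int. \<bar>real_of_int b\<bar> \<le> C * real n ^ w}) * real (card (box L C n)) \<le> (2 * C + 1) * real n ^ w * (c * real n ^ d)"
          using c(2)[OF n] C by (intro mult_mono) auto
        then show ?thesis by (simp only: card of_nat_mult power_add mult_ac)
      qed
      then show ?thesis using c(1) C by (intro exI[of _ "(2 * C + 1) * c"]) auto
    qed
    ultimately show ?thesis by blast
  next
    case True
    then obtain q :: nat where q: "q \<ge> 1" "y [^] q \<in> ?V" by blast
    obtain E where E: "E \<ge> 0" "y [^] q \<in> box L E 1" using generate_in_box[OF LA q(2)] by blast
    have "\<exists>c>0. \<forall>n\<ge>1. c * real n ^ d \<le> real (card (box (x # L) 1 n))"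
    proof (intro exI conjI allI impI)
      fix n :: nat assume n: "n \<ge> 1"
      have "box L 1 n \<subseteq> box (x # L) 1 n"
      proof
        fix p assume p: "p \<in> box L 1 n"
        then show "p \<in> box (x # L) 1 n" using box_ConsI[of 0 1 n x p L] box_A[OF LA p] by simp
      qed
      then have "card (box L 1 n) \<le> card (box (x # L) 1 n)" by (intro card_mono finite_box)
      then show "c * real n ^ d \<le> real (card (box (x # L) 1 n))" using c(2)[OF n] by linarith
    qed (rule c(1))
    moreover have "\<exists>c>0. \<forall>n\<ge>1. real (card (box (x # L) C n)) \<le> c * real n ^ d" if C: "C \<ge> 0" for C
    proof -
      obtain c where c: "c > 0" "\<And>n. n \<ge> 1 \<Longrightarrow> real (card (box L (E * C + C) n)) \<le> c * real n ^ d"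
        using up[of "E * C + C"] C E(1) by auto
      have "real (card (box (x # L) C n)) \<le> (real q * c) * real n ^ d" if n: "n \<ge> 1" for n
      proof -
        \<comment> \<open>Division with remainder by \<open>q\<close>: the quotient power of
          \<open>y [^] q\<close> is absorbed by the heavier items, and only \<open>q\<close>
          remainders are left. Torsion is covered, as the span may be trivial.\<close>
        have "box (x # L) C n \<subseteq> (\<Union>r\<in>{..<q}. (\<lambda>p. y [^] r \<otimes> p) ` box L (E * C + C) n)"
        proof
          fix g assume "g \<in> box (x # L) C n"
          then obtain b p where bp: "\<bar>real_of_int b\<bar> \<le> C * real n ^ w" "p \<in> box L C n" "g = y [^] (b :: int) \<otimes> p"
            using x by (auto elim: box_ConsE)
          have pA: "p \<in> A" using bp(2) box_A[OF LA] by auto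
          define r where "r = nat (b mod int q)"
          have r: "r < q" "int r = b mod int q" using q(1) by (auto simp: r_def nat_less_iff)
          have bq: "b = int r + int q * (b div int q)" using r(2) by simp
          have "y [^] b = y [^] r \<otimes> (y [^] q) [^] (b div int q)"
          proof -
            have "y [^] (int r + int q * (b div int q)) = y [^] int r \<otimes> (y [^] int q) [^] (b div int q)"
              using yA by (simp only: int_pow_mult int_pow_pow A_closed)
            then show ?thesis by (simp only: bq[symmetric] int_pow_int)
          qed
          then have g: "g = y [^] r \<otimes> ((y [^] q) [^] (b div int q) \<otimes> p)"
            using bp(3) yA pA by (simp add: m_assoc)
          \<comment> \<open>Division rounds down, so for negative \<open>b\<close> the quotient is
            negative, but not below \<open>b\<close>.\<close>
          have "\<bar>b div int q\<bar> \<le> \<bar>b\<bar>"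
          proof (cases "b \<ge> 0")
            case True
            then have d: "b div int q \<ge> 0" using q(1) by (simp add: pos_imp_zdiv_nonneg_iff)
            then have "1 * (b div int q) \<le> int q * (b div int q)" using q(1) by (intro mult_right_mono) auto
            then show ?thesis using bq d by linarith
          next
            case False
            then have "b div int q < 0" using q(1) by (intro div_neg_pos_less0) auto
            moreover have "int q * (b div int q) + int q > b"
              using bq r(1) by linarith
            moreover have "b div int q \<ge> b"
            proof (rule ccontr)
              assume "\<not> b \<le> b div int q"
              then have "b div int q \<le> b - 1" by simp
              then have "int q * (b div int q) \<le> int q * (b - 1)" using q(1) by (intro mult_left_mono) auto
              moreover have "int q * (b - 1) + int q = int q * b" by (simp add: algebra_simps)
              moreover have "int q * b \<le> 1 * b" using q(1) False by (intro mult_right_mono_neg) auto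
              ultimately show False using \<open>int q * (b div int q) + int q > b\<close> by linarith
            qed
            ultimately show ?thesis using False by linarith
          qed
          then have bd: "\<bar>real_of_int (b div int q)\<bar> \<le> C * real n ^ w" using bp(1) by linarith
          have "(y [^] q) [^] (b div int q) \<in> box L (E * C) n"
            by (rule box_scale[OF LA _ n E(1) bd E(2)]) (rule wL)
          then have "(y [^] q) [^] (b div int q) \<otimes> p \<in> box L (E * C + C) n"
            by (rule box_mult[OF LA _ bp(2)])
          then show "g \<in> (\<Union>r\<in>{..<q}. (\<lambda>p. y [^] r \<otimes> p) ` box L (E * C + C) n)"
            using g r(1) by blast
        qed
        then have "card (box (x # L) C n) \<le> card (\<Union>r\<in>{..<q}. (\<lambda>p. y [^] r \<otimes> p) ` box L (E * C + C) n)"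
          by (intro card_mono) (auto intro: finite_box)
        also have "\<dots> \<le> (\<Sum>r\<in>{..<q}. card ((\<lambda>p. y [^] r \<otimes> p) ` box L (E * C + C) n))"
          by (rule card_UN_le) simp
        also have "\<dots> \<le> (\<Sum>r\<in>{..<q}. card (box L (E * C + C) n))"
          by (intro sum_mono card_image_le finite_box)
        finally have "card (box (x # L) C n) \<le> q * card (box L (E * C + C) n)" by simp
        then have "real (card (box (x # L) C n)) \<le> real q * real (card (box L (E * C + C) n))"
          by (simp only: of_nat_mult[symmetric] of_nat_le_iff)
        also have "\<dots> \<le> real q * (c * real n ^ d)" using c(2)[OF n] by (intro mult_left_mono) auto
        finally show ?thesis by (simp add: mult.assoc)
      qed
      then show ?thesis using c(1) q(1) by (intro exI[of _ "real q * c"]) auto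
    qed
    ultimately show ?thesis by blast
  qed
qed

end

section \<open>The weight filtration\<close>

context unipotent_pair begin

text \<open>An item \<open>(y, w)\<close> records that \<open>y\<close> has weight \<open>w\<close>: the word length of \<open>y [^] (n ^ w)\<close> will be at most
  a multiple of \<open>n\<close>.\<close>

definition seeds :: "('a \<times> nat) set" where
  "seeds = (\<lambda>b. (b, 1)) ` B \<union> (\<lambda>(u, v). (comm u v, 2)) ` (U \<times> U)"

text \<open>Lists longer than \<open>depth\<close> give the trivial element by
  \<open>bras_nilpotent\<close>; the cutoff makes the set finite and keeps it closed under
  \<open>bra u\<close>, up to the trivial element.\<close>

definition items :: "('a \<times> nat) set" where
  "items = (\<lambda>(l, y, w). (bras l y, length l + w)) ` ({l. set l \<subseteq> U \<and> length l \<le> depth} \<times> seeds)"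

lemma finite_items: "finite items"
  unfolding items_def seeds_def using finite_B finite_U
  by (intro finite_imageI finite_cartesian_product finite_UnI finite_lists_length_le)

lemma seeds_A: "(y, w) \<in> seeds \<Longrightarrow> y \<in> A \<and> w \<ge> 1"
  using B_A commutator_A by (auto simp: seeds_def)

lemma items_A: "(y, w) \<in> items \<Longrightarrow> y \<in> A \<and> w \<ge> 1"
  using seeds_A by (force simp: items_def)

lemma items_bra:
  assumes "(y, w) \<in> items" "u \<in> U"
  shows "bra u y = \<one> \<or> (bra u y, Suc w) \<in> items"
proof -
  obtain l z v where l: "set l \<subseteq> U" "length l \<le> depth" "(z, v) \<in> seeds" "y = bras l z" "w = length l + v"
    using assms(1) by (auto simp: items_def)
  have ul: "set (u # l) \<subseteq> U" "bra u y = bras (u # l) z" "Suc w = length (u # l) + v" using l assms(2) by auto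
  show ?thesis
  proof (cases "length (u # l) \<le> depth")
    case True
    then have "(u # l, z, v) \<in> {l. set l \<subseteq> U \<and> length l \<le> depth} \<times> seeds" using ul(1) l(3) by simp
    then have "(bras (u # l) z, length (u # l) + v) \<in> items" unfolding items_def by (rule rev_image_eqI) simp
    then show ?thesis using ul by simp
  next
    case False
    then show ?thesis using bras_nilpotent[OF ul(1)] seeds_A[OF l(3)] ul(2) by auto
  qed
qed

lemma items_induct [consumes 1, case_names base comm step]:
  assumes "(y, w) \<in> items"
    and "\<And>b. b \<in> B \<Longrightarrow> P b 1" and "\<And>u v. u \<in> U \<Longrightarrow> v \<in> U \<Longrightarrow> P (comm u v) 2"
    and "\<And>y w u. (y, w) \<in> items \<Longrightarrow> u \<in> U \<Longrightarrow> P y w \<Longrightarrow> P (bra u y) (Suc w)"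
  shows "P y w"
proof -
  have seeds: "P z v" if "(z, v) \<in> seeds" for z v using that assms(2,3) by (auto simp: seeds_def)
  have "P (bras l z) (length l + v)" if "(z, v) \<in> seeds" "set l \<subseteq> U" "length l \<le> depth" for l z v
    using that(2,3)
  proof (induction l)
    case Nil
    then show ?case using seeds[OF that(1)] by simp
  next
    case (Cons u l)
    have "(l, z, v) \<in> {l. set l \<subseteq> U \<and> length l \<le> depth} \<times> seeds" using Cons.prems that(1) by simp
    then have "(bras l z, length l + v) \<in> items" unfolding items_def by (rule rev_image_eqI) simp
    then show ?case using assms(4)[of "bras l z" "length l + v" u] Cons by simp
  qed
  then show ?thesis using assms(1) by (auto simp: items_def)
qed

text \<open>\<open>cost w n a C\<close>: \<open>a\<close> is a product of items of weight at least \<open>w\<close> and their inverses, of total price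
  at most \<open>C\<close>, when an item of weight \<open>v\<close> has the price \<open>n powr (- v)\<close>. Conjugation by an element of \<open>U\<close>
  multiplies the price by at most \<open>1 + 1 / n\<close>, hence a word of length \<open>n\<close> multiplies it by at most \<open>exp 1\<close>.\<close>

inductive cost :: "nat \<Rightarrow> nat \<Rightarrow> 'a \<Rightarrow> real \<Rightarrow> bool" for w n where
  cost_one: "0 \<le> C \<Longrightarrow> cost w n \<one> C"
| cost_item: "(y, v) \<in> items \<Longrightarrow> w \<le> v \<Longrightarrow> cost w n y (1 / real n ^ v)"
| cost_item_inv: "(y, v) \<in> items \<Longrightarrow> w \<le> v \<Longrightarrow> cost w n (inv y) (1 / real n ^ v)"
| cost_mult: "cost w n a C \<Longrightarrow> cost w n b D \<Longrightarrow> cost w n (a \<otimes> b) (C + D)"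

lemma cost_A: "cost w n a C \<Longrightarrow> a \<in> A"
  by (induction rule: cost.induct) (auto dest: items_A)

lemma cost_nonneg: "cost w n a C \<Longrightarrow> 0 \<le> C"
  by (induction rule: cost.induct) auto

lemma cost_mono:
  assumes "cost w n a C" "C \<le> D" shows "cost w n a D"
  using cost_mult[OF assms(1) cost_one[of "D - C"]] assms cost_A[OF assms(1)] by simp

lemma cost_weaken: "cost w n a C \<Longrightarrow> v \<le> w \<Longrightarrow> cost v n a C"
  by (induction rule: cost.induct) (auto intro: cost.intros)

lemma cost_inv: "cost w n a C \<Longrightarrow> cost w n (inv a) C"
proof (induction rule: cost.induct)
  case (cost_item_inv y v)
  then show ?case using cost_item[OF cost_item_inv] items_A by auto
next
  case (cost_mult a C b D)
  then show ?case using cost.cost_mult[OF cost_mult.IH] cost_A by (simp add: A_inv_mult)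
qed (auto intro: cost.intros)

lemma cost_nat_pow: "cost w n a C \<Longrightarrow> cost w n (a [^] (k :: nat)) (real k * C)"
proof (induction k)
  case (Suc k)
  then show ?case using cost_mult[of w n "a [^] k" "real k * C" a C] by (simp add: algebra_simps)
qed (auto intro: cost.intros)

text \<open>The operator u - 1 raises weights by one, and each unit of weight divides a price by
  \<open>n\<close>.\<close>

lemma cost_bra:
  assumes "cost w n a C" "u \<in> U" "n \<ge> 1"
  shows "cost (Suc w) n (bra u a) (C / real n)"
  using assms(1)
proof (induction rule: cost.induct)
  case (cost_one C)
  then show ?case using assms by (auto intro: cost.intros)
next
  case (cost_item y v)
  have e: "1 / real n ^ Suc v = 1 / real n ^ v / real n" by simp
  show ?case
    using items_bra[OF cost_item(1) assms(2)]
  proof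
    assume "(bra u y, Suc v) \<in> items"
    then have "cost (Suc w) n (bra u y) (1 / real n ^ Suc v)" using cost_item(2) by (intro cost.cost_item) auto
    then show ?thesis by (simp only: e)
  qed (auto intro: cost.intros)
next
  case (cost_item_inv y v)
  have e: "1 / real n ^ Suc v = 1 / real n ^ v / real n" by simp
  have b: "bra u (inv y) = inv (bra u y)" using items_A[OF cost_item_inv(1)] assms(2) by (simp add: bra_inv)
  show ?case
    using items_bra[OF cost_item_inv(1) assms(2)]
  proof
    assume "(bra u y, Suc v) \<in> items"
    then have "cost (Suc w) n (inv (bra u y)) (1 / real n ^ Suc v)" using cost_item_inv(2) by (intro cost.cost_item_inv) auto
    then show ?thesis by (simp only: e b)
  qed (auto simp: b intro: cost.intros)
next
  case (cost_mult a C b D)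
  then show ?case using cost.cost_mult[OF cost_mult.IH] cost_A assms(2) by (simp add: bra_mult add_divide_distrib)
qed

lemma cost_conj:
  assumes "cost w n a C" "u \<in> U" "n \<ge> 1"
  shows "cost w n (conj u a) ((1 + 1 / real n) * C)"
proof -
  have "cost w n (bra u a \<otimes> a) (C / real n + C)"
    using cost_bra[OF assms] by (intro cost_mult assms(1)) (rule cost_weaken, auto)
  then show ?thesis using conj_bra[of u a] cost_A[OF assms(1)] assms(2) by (simp add: algebra_simps)
qed

lemma U_letters: "U \<union> m_inv G ` U = U"
  using U_inv by auto

lemma cost_conj_word:
  assumes "cost w n a C" "g \<in> word_ball G U p" "n \<ge> 1"
  shows "cost w n (conj g a) ((1 + 1 / real n) ^ p * C)"
  using assms(2)
proof (induction p arbitrary: g)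
  case 0
  then show ?case using assms(1) cost_A[OF assms(1)] by simp
next
  case (Suc p)
  have C: "C \<ge> 0" using cost_nonneg[OF assms(1)] .
  from Suc.prems show ?case
  proof (cases rule: word_ball_SucE)
    case 1
    have "(1 + 1 / real n) ^ p * C \<le> (1 + 1 / real n) ^ Suc p * C"
      using C by (intro mult_right_mono power_increasing) auto
    then show ?thesis using Suc.IH[OF 1] cost_mono by blast
  next
    case (2 h u)
    have u: "u \<in> U" using 2(2) U_letters by simp
    have h: "h \<in> carrier G" using word_ball_closed[OF U_carrier 2(1)] .
    \<comment> \<open>The new letter is moved to the outside, where the bound for one conjugation
      applies to the known price of \<open>conj h a\<close>.\<close>
    have "conj g a = conj u (conj h a)"
    proof -
      have "conj g a = conj h (conj u a)" unfolding 2(3) using h u cost_A[OF assms(1)] by (simp only: conj_conj U_closed A_closed)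
      also have "\<dots> = conj u (conj h a)" using h u cost_A[OF assms(1)] by (intro conj_commute) auto
      finally show ?thesis .
    qed
    moreover have "cost w n (conj u (conj h a)) ((1 + 1 / real n) * ((1 + 1 / real n) ^ p * C))"
      by (rule cost_conj[OF Suc.IH[OF 2(1)] u assms(3)])
    ultimately show ?thesis by (simp add: mult.assoc)
  qed
qed

lemma one_plus_power_le: "(1 + 1 / real n) ^ p \<le> exp (real p / real n)"
proof -
  have "(1 + 1 / real n) ^ p \<le> exp (1 / real n) ^ p" by (intro power_mono) (auto simp: add.commute)
  then show ?thesis by (simp add: exp_of_nat_mult[symmetric])
qed

lemma cost_comm:
  assumes "u \<in> U" "v \<in> U"
  shows "cost 2 n (comm u v) (1 / real n ^ 2)"
proof (rule cost_item)
  have "([], comm u v, 2) \<in> {l. set l \<subseteq> U \<and> length l \<le> depth} \<times> seeds" using assms by (auto simp: seeds_def)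
  then show "(comm u v, 2) \<in> items" unfolding items_def by (rule rev_image_eqI) simp
qed simp

lemma cost_base:
  assumes "b \<in> B"
  shows "cost 1 n b (1 / real n)"
proof -
  have "([], b, 1) \<in> {l. set l \<subseteq> U \<and> length l \<le> depth} \<times> seeds" using assms by (auto simp: seeds_def)
  then have "(b, 1) \<in> items" unfolding items_def by (rule rev_image_eqI) simp
  from cost_item[OF this, of 1 n] show ?thesis by simp
qed

text \<open>The commutator with a word of length \<open>p\<close> expands into \<open>p\<close>
  conjugates of commutators of letters, each of price \<open>1 / n ^ 2\<close> before
  conjugation.\<close>

lemma cost_comm_word:
  assumes g: "g \<in> word_ball G U p" and v: "v \<in> U" and n: "n \<ge> 1"
  shows "cost 2 n (comm g v) (real p * (1 + 1 / real n) ^ p / real n ^ 2)"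
  using g
proof (induction p arbitrary: g)
  case 0
  then show ?case using v by (auto intro: cost.intros)
next
  case (Suc p)
  let ?e = "1 + 1 / real n"
  have ee: "?e ^ p \<le> ?e ^ Suc p" by (intro power_increasing) auto
  from Suc.prems show ?case
  proof (cases rule: word_ball_SucE)
    case 1
    have "real p * ?e ^ p / real n ^ 2 \<le> real (Suc p) * ?e ^ Suc p / real n ^ 2"
      using ee by (intro divide_right_mono mult_mono) auto
    then show ?thesis using Suc.IH[OF 1] cost_mono by blast
  next
    case (2 h u)
    have u: "u \<in> U" using 2(2) U_letters by simp
    have h: "h \<in> carrier G" using word_ball_closed[OF U_carrier 2(1)] .
    have "comm g v = conj h (comm u v) \<otimes> comm h v"
      unfolding 2(3) using h u v by (intro commutator_mult_left) auto
    moreover have "cost 2 n (conj h (comm u v) \<otimes> comm h v) (?e ^ p * (1 / real n ^ 2) + real p * ?e ^ p / real n ^ 2)"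
      by (intro cost_mult Suc.IH[OF 2(1)] cost_conj_word[OF cost_comm[OF u v] 2(1) n])
    moreover have "?e ^ p * (1 / real n ^ 2) + real p * ?e ^ p / real n ^ 2 = real (Suc p) * ?e ^ p / real n ^ 2"
      by (simp add: add_divide_distrib algebra_simps)
    ultimately have "cost 2 n (comm g v) (real (Suc p) * ?e ^ p / real n ^ 2)" by (simp only:)
    moreover have "real (Suc p) * ?e ^ p / real n ^ 2 \<le> real (Suc p) * ?e ^ Suc p / real n ^ 2"
      using ee by (intro divide_right_mono mult_left_mono) auto
    ultimately show ?thesis by (rule cost_mono)
  qed
qed

end

section \<open>Distortion of the module\<close>

context unipotent_pair begin

lemma U_pow_word: "u \<in> U \<Longrightarrow> u [^] (k :: nat) \<in> word_ball G U k"
  using word_ball_pow[OF U_carrier word_ball_letter[OF U_carrier], of u k] by simp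

lemma one_plus_power_le_exp: "p \<le> n \<Longrightarrow> n \<ge> 1 \<Longrightarrow> (1 + 1 / real n) ^ p \<le> exp 1"
  by (rule order_trans[OF one_plus_power_le]) auto

lemma bra_pow_Suc:
  assumes "u \<in> carrier G" "a \<in> A"
  shows "bra (u [^] Suc v) a = bra u (conj (u [^] v) a) \<otimes> bra (u [^] v) a"
  unfolding nat_pow_Suc2[OF assms(1)] using assms by (intro bra_mult_left) auto

text \<open>Telescoping: u^v - 1 is the sum of the (u - 1) u^i for i < v. Each summand costs at most
  \<open>exp 1 * C / n\<close>, because conjugation by at most \<open>n\<close> letters inflates
  prices by at most \<open>exp 1\<close>.\<close>

lemma cost_bra_pow:
  assumes a: "cost w n a C" and u: "u \<in> U" and v: "v \<le> n" and n: "n \<ge> 1"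
  shows "cost (Suc w) n (bra (u [^] v) a) (exp 1 * C * real v / real n)"
  using v
proof (induction v)
  case 0
  then show ?case using cost_A[OF a] by (auto intro: cost.intros)
next
  case (Suc v)
  have C: "C \<ge> 0" using cost_nonneg[OF a] .
  have "cost w n (conj (u [^] v) a) ((1 + 1 / real n) ^ v * C)"
    by (rule cost_conj_word[OF a U_pow_word[OF u] n])
  moreover have "(1 + 1 / real n) ^ v * C \<le> exp 1 * C"
    using one_plus_power_le_exp[of v n] Suc.prems n C by (intro mult_right_mono) auto
  ultimately have "cost w n (conj (u [^] v) a) (exp 1 * C)" by (rule cost_mono)
  then have "cost (Suc w) n (bra u (conj (u [^] v) a)) (exp 1 * C / real n)" by (rule cost_bra[OF _ u n])
  from cost_mult[OF this Suc.IH] Suc.prems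
  have "cost (Suc w) n (bra (u [^] Suc v) a) (exp 1 * C / real n + exp 1 * C * real v / real n)"
    unfolding bra_pow_Suc[OF U_closed[OF u] cost_A[OF a]] by simp
  then show ?case by (rule cost_mono) (simp add: algebra_simps add_divide_distrib)
qed

text \<open>u^v - 1 equals v (u - 1) up to multiples of (u - 1)^2, so the error gains two units of
  weight, and its price stays bounded up to \<open>v = n\<close>.\<close>

lemma bra_pow_linear:
  assumes a: "cost w n a C" and u: "u \<in> U" and v: "v \<le> n" and n: "n \<ge> 1"
  shows "\<exists>e. bra (u [^] v) a = bra u a [^] v \<otimes> e \<and> cost (Suc (Suc w)) n e (real v * (exp 1 * C / real n))"
  using v
proof (induction v)
  case 0
  then show ?case using cost_A[OF a] by (intro exI[of _ \<one>]) (auto intro: cost.intros)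
next
  case (Suc v)
  then obtain e where e: "bra (u [^] v) a = bra u a [^] v \<otimes> e" "cost (Suc (Suc w)) n e (real v * (exp 1 * C / real n))"
    by auto
  have C: "C \<ge> 0" using cost_nonneg[OF a] .
  have aA: "a \<in> A" using cost_A[OF a] .
  have uc: "u \<in> carrier G" "u [^] v \<in> carrier G" using u by auto
  define x where "x = bra (u [^] v) a"
  have xA: "x \<in> A" using uc aA by (simp add: x_def)
  have eA: "e \<in> A" using cost_A[OF e(2)] .
  have "bra u (conj (u [^] v) a) = bra u x \<otimes> bra u a"
    unfolding conj_bra[OF uc(2) A_closed[OF aA]] x_def[symmetric] using uc xA aA by (intro bra_mult) auto
  then have "bra (u [^] Suc v) a = bra u x \<otimes> bra u a \<otimes> x"
    unfolding bra_pow_Suc[OF uc(1) aA] x_def by simp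
  also have "\<dots> = bra u a [^] Suc v \<otimes> (e \<otimes> bra u x)"
    using e(1) uc aA eA xA unfolding x_def[symmetric] by (simp add: m_assoc A_ac)
  finally have eq: "bra (u [^] Suc v) a = bra u a [^] Suc v \<otimes> (e \<otimes> bra u x)" .
  have "cost (Suc w) n x (exp 1 * C * real v / real n)"
    unfolding x_def using Suc.prems by (intro cost_bra_pow[OF a u _ n]) auto
  moreover have "exp 1 * C * real v / real n \<le> exp 1 * C"
    using Suc.prems n C by (simp add: divide_le_eq mult_left_mono)
  ultimately have "cost (Suc w) n x (exp 1 * C)" by (rule cost_mono)
  then have "cost (Suc (Suc w)) n (bra u x) (exp 1 * C / real n)" by (rule cost_bra[OF _ u n])
  from cost_mult[OF e(2) this]
  have "cost (Suc (Suc w)) n (e \<otimes> bra u x) (real (Suc v) * (exp 1 * C / real n))"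
    by (simp add: algebra_simps add_divide_distrib)
  with eq show ?case by blast
qed

abbreviation S0 :: "'a set" where "S0 \<equiv> U \<union> B"

lemma S0_carrier: "S0 \<subseteq> carrier G"
  using U_carrier B_A by auto

lemma U_word_S0: "g \<in> word_ball G U n \<Longrightarrow> g \<in> word_ball G S0 n"
  using word_ball_subst[OF S0_carrier _ , of U 1 g n] word_ball_letter[OF S0_carrier] by auto

lemma word_ball_conj_comm:
  assumes "g \<in> word_ball G S0 p" "a \<in> word_ball G S0 q"
  shows "comm g a \<in> word_ball G S0 (2 * p + 2 * q)"
proof -
  have "comm g a \<in> word_ball G S0 (p + q + p + q)"
    using assms by (intro word_ball_mult[OF S0_carrier] word_ball_inv[OF S0_carrier])
  moreover have "p + q + p + q = 2 * p + 2 * q" by simp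
  ultimately show ?thesis by (simp only:)
qed

text \<open>Up to heavier items, \<open>y [^] (n ^ w)\<close> is an iterated commutator of \<open>n\<close>-th powers.\<close>

definition approximable :: "'a \<Rightarrow> nat \<Rightarrow> bool" where
  "approximable y w \<longleftrightarrow> (\<exists>(C :: nat) D. \<forall>n\<ge>1. \<exists>z e. z \<in> word_ball G S0 (C * n) \<and> z \<in> A \<and> cost (Suc w) n e D \<and>
     y [^] (n ^ w) = z \<otimes> e)"

text \<open>Bilinearity of the commutator modulo weight 3, first in \<open>u\<close>, then in
  \<open>v\<close>. The first pass leaves an error of price \<open>exp 1 / n\<close>, which is then
  raised to the power \<open>n\<close>; the second leaves \<open>exp 1 ^ 2\<close>. The total does
  not depend on \<open>n\<close>.\<close>

lemma comm_pow_linear: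
  assumes uv: "u \<in> U" "v \<in> U" and n: "n \<ge> 1"
  shows "\<exists>e. comm (u [^] n) (v [^] n) = comm u v [^] (n ^ 2) \<otimes> e \<and> cost 3 n e (exp 1 + exp 1 ^ 2)"
proof -
  define c where "c = comm u v"
  have uc: "u \<in> carrier G" "v \<in> carrier G" using uv by auto
  have cA: "c \<in> A" unfolding c_def using uc by (rule commutator_A)
  have c: "cost 2 n c (1 / real n ^ 2)" unfolding c_def by (rule cost_comm[OF uv])
  have "\<exists>e. comm (u [^] p) v = c [^] p \<otimes> e \<and> cost 3 n e (real p * (exp 1 / real n ^ 2))" if "p \<le> n" for p
    using that
  proof (induction p)
    case 0
    then show ?case using uc by (intro exI[of _ \<one>]) (auto intro: cost.intros)
  next
    case (Suc p)
    then obtain e where e: "comm (u [^] p) v = c [^] p \<otimes> e" "cost 3 n e (real p * (exp 1 / real n ^ 2))" by auto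
    have eA: "e \<in> A" using cost_A[OF e(2)] .
    define x where "x = bra (u [^] p) c"
    have xA: "x \<in> A" using uc cA by (simp add: x_def)
    have "comm (u [^] Suc p) v = conj (u [^] p) c \<otimes> comm (u [^] p) v"
      unfolding c_def nat_pow_Suc using uc by (intro commutator_mult_left) auto
    also have "\<dots> = x \<otimes> c \<otimes> (c [^] p \<otimes> e)"
      unfolding e(1) x_def using uc cA conj_bra[of "u [^] p" c] by simp
    also have "\<dots> = c [^] Suc p \<otimes> (e \<otimes> x)"
      using xA cA eA by (simp add: m_assoc A_ac)
    finally have eq: "comm (u [^] Suc p) v = c [^] Suc p \<otimes> (e \<otimes> x)" .
    have "cost (Suc 2) n x (exp 1 * (1 / real n ^ 2) * real p / real n)"
      unfolding x_def using Suc.prems by (intro cost_bra_pow[OF c uv(1) _ n]) auto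
    moreover have "exp 1 * (1 / real n ^ 2) * real p / real n \<le> exp 1 / real n ^ 2"
    proof -
      have "(exp 1 / real n ^ 2) * (real p / real n) \<le> (exp 1 / real n ^ 2) * 1"
        using Suc.prems n by (intro mult_left_mono) auto
      then show ?thesis by simp
    qed
    ultimately have "cost (Suc 2) n x (exp 1 / real n ^ 2)" by (rule cost_mono)
    then have "cost 3 n x (exp 1 / real n ^ 2)" by (simp add: numeral_3_eq_3 numeral_2_eq_2)
    from cost_mult[OF e(2) this]
    have "cost 3 n (e \<otimes> x) (real (Suc p) * (exp 1 / real n ^ 2))" by (simp add: algebra_simps add_divide_distrib)
    with eq show ?case by blast
  qed
  from this[of n] obtain e1 where e1: "comm (u [^] n) v = c [^] n \<otimes> e1" "cost 3 n e1 (real n * (exp 1 / real n ^ 2))" by auto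
  have e1A: "e1 \<in> A" using cost_A[OF e1(2)] .
  have "real n * (exp 1 / real n ^ 2) = exp 1 / real n" using n by (simp add: power2_eq_square)
  then have e1': "cost 3 n e1 (exp 1 / real n)" using e1(2) by simp
  define r where "r = comm (u [^] n) v"
  have rA: "r \<in> A" unfolding r_def using uc by (intro commutator_A) auto
  have r: "cost 2 n r (exp 1 / real n)"
  proof -
    have "cost 2 n r (real n * (1 + 1 / real n) ^ n / real n ^ 2)"
      unfolding r_def by (rule cost_comm_word[OF U_pow_word[OF uv(1)] uv(2) n])
    moreover have "real n * (1 + 1 / real n) ^ n / real n ^ 2 \<le> real n * exp 1 / real n ^ 2"
      using one_plus_power_le_exp[of n n] n by (intro divide_right_mono mult_left_mono) auto
    moreover have "real n * exp 1 / real n ^ 2 = exp 1 / real n" using n by (simp add: power2_eq_square)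
    ultimately show ?thesis using cost_mono by simp
  qed
  have "\<exists>e. comm (u [^] n) (v [^] q) = r [^] q \<otimes> e \<and> cost 3 n e (real q * (exp 1 ^ 2 / real n))" if "q \<le> n" for q
    using that
  proof (induction q)
    case 0
    then show ?case using uc by (intro exI[of _ \<one>]) (auto intro: cost.intros)
  next
    case (Suc q)
    then obtain e where e: "comm (u [^] n) (v [^] q) = r [^] q \<otimes> e" "cost 3 n e (real q * (exp 1 ^ 2 / real n))" by auto
    have eA: "e \<in> A" using cost_A[OF e(2)] .
    define x where "x = bra (v [^] q) r"
    have xA: "x \<in> A" using uc rA by (simp add: x_def)
    have "comm (u [^] n) (v [^] Suc q) = comm (u [^] n) (v [^] q) \<otimes> conj (v [^] q) r"
      unfolding r_def nat_pow_Suc using uc by (intro commutator_mult_right) auto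
    also have "\<dots> = r [^] q \<otimes> e \<otimes> (x \<otimes> r)"
      unfolding e(1) x_def using uc rA conj_bra[of "v [^] q" r] by simp
    also have "\<dots> = r [^] Suc q \<otimes> (e \<otimes> x)"
      using xA rA eA by (simp add: m_assoc A_ac)
    finally have eq: "comm (u [^] n) (v [^] Suc q) = r [^] Suc q \<otimes> (e \<otimes> x)" .
    have "cost (Suc 2) n x (exp 1 * (exp 1 / real n) * real q / real n)"
      unfolding x_def using Suc.prems by (intro cost_bra_pow[OF r uv(2) _ n]) auto
    moreover have "exp 1 * (exp 1 / real n) * real q / real n \<le> exp 1 ^ 2 / real n"
    proof -
      have "(exp 1 ^ 2 / real n) * (real q / real n) \<le> (exp 1 ^ 2 / real n) * 1"
        using Suc.prems n by (intro mult_left_mono) auto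
      then show ?thesis by (simp add: power2_eq_square)
    qed
    ultimately have "cost (Suc 2) n x (exp 1 ^ 2 / real n)" by (rule cost_mono)
    then have "cost 3 n x (exp 1 ^ 2 / real n)" by (simp add: numeral_3_eq_3 numeral_2_eq_2)
    from cost_mult[OF e(2) this]
    have "cost 3 n (e \<otimes> x) (real (Suc q) * (exp 1 ^ 2 / real n))" by (simp add: algebra_simps add_divide_distrib)
    with eq show ?case by blast
  qed
  from this[of n] obtain e2 where e2: "comm (u [^] n) (v [^] n) = r [^] n \<otimes> e2" "cost 3 n e2 (real n * (exp 1 ^ 2 / real n))" by auto
  have e2A: "e2 \<in> A" using cost_A[OF e2(2)] .
  have "r [^] n = (c [^] n \<otimes> e1) [^] n" unfolding r_def e1(1) ..
  also have "\<dots> = (c [^] n) [^] n \<otimes> e1 [^] n"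
    using cA e1A by (intro pow_mult_distrib comm_A) auto
  also have "(c [^] n) [^] n = c [^] (n ^ 2)" using cA by (simp add: nat_pow_pow power2_eq_square)
  finally have "comm (u [^] n) (v [^] n) = c [^] (n ^ 2) \<otimes> (e1 [^] n \<otimes> e2)"
    unfolding e2(1) using cA e1A e2A by (simp add: m_assoc)
  moreover have "cost 3 n (e1 [^] n \<otimes> e2) (real n * (exp 1 / real n) + real n * (exp 1 ^ 2 / real n))"
    by (intro cost_mult cost_nat_pow e1' e2(2))
  moreover have "real n * (exp 1 / real n) + real n * (exp 1 ^ 2 / real n) = exp 1 + exp 1 ^ 2" using n by simp
  ultimately show ?thesis unfolding c_def by (intro exI[of _ "e1 [^] n \<otimes> e2"]) simp
qed

text \<open>A generator is approximated by its own power, a commutator by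
  \<open>comm (u [^] n) (v [^] n)\<close>, and \<open>bra u y\<close> by
  \<open>bra (u [^] n) z\<close> with the approximation \<open>z\<close> for \<open>y\<close>;
  linearization supplies the new factor \<open>n\<close>. The lengths \<open>4 * n\<close> and
  \<open>(2 + 2 * C) * n\<close> are those of commutators.\<close>

lemma approximable_items:
  assumes "(y, w) \<in> items"
  shows "approximable y w"
  using assms
proof (induction rule: items_induct)
  case (base b)
  have "\<exists>z e. z \<in> word_ball G S0 (1 * n) \<and> z \<in> A \<and> cost (Suc 1) n e 0 \<and> b [^] (n ^ 1) = z \<otimes> e" if "n \<ge> 1" for n
    using word_ball_pow[OF S0_carrier word_ball_letter[OF S0_carrier], of b n] base B_A[OF base]
    by (intro exI[of _ "b [^] n"] exI[of _ \<one>]) (auto intro: cost.intros)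
  then show ?case unfolding approximable_def by blast
next
  case (comm u v)
  have "\<exists>z e. z \<in> word_ball G S0 (4 * n) \<and> z \<in> A \<and> cost (Suc 2) n e (exp 1 + exp 1 ^ 2) \<and> comm u v [^] (n ^ 2) = z \<otimes> e"
    if n: "n \<ge> 1" for n
  proof -
    obtain e where e: "comm (u [^] n) (v [^] n) = comm u v [^] (n ^ 2) \<otimes> e" "cost 3 n e (exp 1 + exp 1 ^ 2)"
      using comm_pow_linear[OF comm n] by blast
    have eA: "e \<in> A" using cost_A[OF e(2)] .
    have cA: "comm u v \<in> A" using comm by (intro commutator_A) auto
    have "comm (u [^] n) (v [^] n) \<in> word_ball G S0 (2 * n + 2 * n)"
      using comm by (intro word_ball_conj_comm U_word_S0 U_pow_word)
    moreover have "comm (u [^] n) (v [^] n) \<in> A" using comm by (intro commutator_A) auto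
    moreover have "comm u v [^] (n ^ 2) = comm (u [^] n) (v [^] n) \<otimes> inv e"
      unfolding e(1) using A_nat_pow[OF cA, of "n ^ 2"] eA by (simp add: m_assoc del: A_nat_pow)
    moreover have "cost (Suc 2) n (inv e) (exp 1 + exp 1 ^ 2)"
      using cost_inv[OF e(2)] by (simp add: numeral_3_eq_3 numeral_2_eq_2)
    ultimately show ?thesis by (intro exI[of _ "comm (u [^] n) (v [^] n)"] exI[of _ "inv e"]) (simp add: mult.commute)
  qed
  then show ?case unfolding approximable_def by blast
next
  case (step y w u)
  obtain C :: nat and D where CD: "\<And>n. n \<ge> 1 \<Longrightarrow> \<exists>z e. z \<in> word_ball G S0 (C * n) \<and> z \<in> A \<and> cost (Suc w) n e D \<and>
     y [^] (n ^ w) = z \<otimes> e" using step.IH unfolding approximable_def by blast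
  have yA: "y \<in> A" using items_A[OF step(1)] by simp
  have uc: "u \<in> carrier G" using step(2) by simp
  have "\<exists>z e. z \<in> word_ball G S0 ((2 + 2 * C) * n) \<and> z \<in> A \<and> cost (Suc (Suc w)) n e (exp 1 * D + exp 1) \<and>
     bra u y [^] (n ^ Suc w) = z \<otimes> e" if n: "n \<ge> 1" for n
  proof -
    obtain z e where ze: "z \<in> word_ball G S0 (C * n)" "z \<in> A" "cost (Suc w) n e D" "y [^] (n ^ w) = z \<otimes> e"
      using CD[OF n] by blast
    have eA: "e \<in> A" using cost_A[OF ze(3)] .
    have unc: "u [^] n \<in> carrier G" using uc by simp
    have c1: "cost w n (y [^] (n ^ w)) (real (n ^ w) * (1 / real n ^ w))"
      using step(1) by (intro cost_nat_pow cost_item) auto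
    have "real (n ^ w) * (1 / real n ^ w) = 1" using n by simp
    then have "cost w n (y [^] (n ^ w)) 1" using c1 by simp
    from bra_pow_linear[OF this step(2) le_refl n] obtain e' where
      e': "bra (u [^] n) (y [^] (n ^ w)) = bra u (y [^] (n ^ w)) [^] n \<otimes> e'"
        "cost (Suc (Suc w)) n e' (real n * (exp 1 * 1 / real n))" by blast
    have e'A: "e' \<in> A" using cost_A[OF e'(2)] .
    have e'c: "cost (Suc (Suc w)) n e' (exp 1)" using e'(2) n by simp
    have "bra u (y [^] (n ^ w)) [^] n = (bra u y [^] (n ^ w)) [^] n"
      using uc yA by (simp only: bra_nat_pow)
    also have "\<dots> = bra u y [^] (n ^ Suc w)"
      using uc yA by (simp add: nat_pow_pow mult.commute)
    finally have p: "bra u (y [^] (n ^ w)) [^] n = bra u y [^] (n ^ Suc w)" .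
    have "bra (u [^] n) (y [^] (n ^ w)) = bra (u [^] n) z \<otimes> bra (u [^] n) e"
      unfolding ze(4) by (rule bra_mult[OF unc ze(2) eA])
    then have "bra u y [^] (n ^ Suc w) \<otimes> e' = bra (u [^] n) z \<otimes> bra (u [^] n) e"
      using e'(1) p by simp
    then have "bra u y [^] (n ^ Suc w) = bra (u [^] n) z \<otimes> bra (u [^] n) e \<otimes> inv e'"
    proof -
      define P where "P = bra u y [^] (n ^ Suc w)"
      have P: "P \<in> A" unfolding P_def using uc yA by (intro A_nat_pow bra_A)
      have "P = P \<otimes> e' \<otimes> inv e'" using P e'A by (simp add: m_assoc)
      then show ?thesis using \<open>bra u y [^] (n ^ Suc w) \<otimes> e' = bra (u [^] n) z \<otimes> bra (u [^] n) e\<close>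
        unfolding P_def[symmetric] by simp
    qed
    then have "bra u y [^] (n ^ Suc w) = bra (u [^] n) z \<otimes> (bra (u [^] n) e \<otimes> inv e')"
      using e'A eA ze(2) unc by (simp add: m_assoc)
    moreover have "cost (Suc (Suc w)) n (bra (u [^] n) e \<otimes> inv e') (exp 1 * D * real n / real n + exp 1)"
      by (intro cost_mult cost_inv e'c cost_bra_pow[OF ze(3) step(2) le_refl n])
    moreover have "exp 1 * D * real n / real n + exp 1 = exp 1 * D + exp 1" using n by simp
    moreover have "bra (u [^] n) z \<in> word_ball G S0 (2 * n + 2 * (C * n))"
      unfolding bra_def using step(2) by (intro word_ball_conj_comm U_word_S0 U_pow_word ze(1))
    moreover have "2 * n + 2 * (C * n) = (2 + 2 * C) * n" by (simp add: algebra_simps)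
    ultimately show ?thesis using unc ze(2) by (intro exI[of _ "bra (u [^] n) z"] exI[of _ "bra (u [^] n) e \<otimes> inv e'"]) simp
  qed
  then show ?case unfolding approximable_def by blast
qed

definition distorted :: "'a \<Rightarrow> nat \<Rightarrow> bool" where
  "distorted y w \<longleftrightarrow> (\<exists>C :: nat. \<forall>n\<ge>1. \<forall>b :: int. \<bar>b\<bar> \<le> int n ^ w \<longrightarrow> y [^] b \<in> word_ball G S0 (C * n))"

lemma distorted_if_powers:
  assumes y: "y \<in> carrier G" and C: "\<And>n. n \<ge> 1 \<Longrightarrow> y [^] (n ^ w) \<in> word_ball G S0 (C * n)"
  shows "distorted y w"
proof -
  \<comment> \<open>expand the exponent in base \<open>2 ^ w\<close>: the digits at place \<open>r\<close> cost a multiple of \<open>2 ^ r\<close>\<close>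
  have digits: "y [^] b \<in> word_ball G S0 (2 ^ w * C * 2 ^ r)" if "b < 2 ^ (w * r)" for b r :: nat
    using that
  proof (induction r arbitrary: b)
    case 0
    then show ?case using word_ball_one by simp
  next
    case (Suc r)
    define q where "q = b div 2 ^ (w * r)"
    define s where "s = b mod 2 ^ (w * r)"
    have b: "b = 2 ^ (w * r) * q + s" by (simp add: q_def s_def)
    have s: "s < 2 ^ (w * r)" by (simp add: s_def)
    have "b < 2 ^ (w * r) * 2 ^ w" using Suc.prems by (simp add: power_add mult.commute)
    then have q: "q < 2 ^ w" unfolding q_def by (simp add: div_less_iff_less_mult mult.commute)
    have "y [^] ((2 ^ r) ^ w :: nat) \<in> word_ball G S0 (C * 2 ^ r)" by (rule C) simp
    then have "(y [^] ((2 ^ r) ^ w :: nat)) [^] q \<in> word_ball G S0 (q * (C * 2 ^ r))" by (rule word_ball_pow[OF S0_carrier])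
    moreover have "(y [^] ((2 ^ r) ^ w :: nat)) [^] q = y [^] (2 ^ (w * r) * q)"
      using y by (simp add: nat_pow_pow power_mult[symmetric] mult.commute)
    ultimately have "y [^] (2 ^ (w * r) * q) \<in> word_ball G S0 (q * (C * 2 ^ r))" by simp
    from word_ball_mult[OF S0_carrier this Suc.IH[OF s]]
    have "y [^] b \<in> word_ball G S0 (q * (C * 2 ^ r) + 2 ^ w * C * 2 ^ r)"
      using y by (subst b) (simp add: nat_pow_mult)
    moreover have "q * (C * 2 ^ r) + 2 ^ w * C * 2 ^ r \<le> 2 ^ w * C * 2 ^ Suc r"
      using q by simp
    ultimately show ?case using word_ball_mono by blast
  qed
  have "y [^] b \<in> word_ball G S0 ((2 ^ w * C * 2) * n)" if n: "n \<ge> 1" and b: "\<bar>b\<bar> \<le> int n ^ w" and w: "w \<ge> 1" for n and b :: int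
  proof -
    have "\<exists>r. n < 2 ^ r \<and> 2 ^ r \<le> 2 * n"
      using n
    proof (induction n rule: nat_induct_at_least)
      case base
      then show ?case by (intro exI[of _ 1]) auto
    next
      case (Suc n)
      then obtain r where r: "n < 2 ^ r" "2 ^ r \<le> 2 * n" by blast
      show ?case
      proof (cases "Suc n < 2 ^ r")
        case True
        then show ?thesis using r by (intro exI[of _ r]) auto
      next
        case False
        then show ?thesis using r Suc.hyps by (intro exI[of _ "Suc r"]) auto
      qed
    qed
    then obtain r where r: "n < 2 ^ r" "2 ^ r \<le> 2 * n" by blast
    have "nat \<bar>b\<bar> \<le> n ^ w" using b by (metis nat_le_iff of_nat_power)
    also have "\<dots> < (2 ^ r) ^ w" using r(1) w by (intro power_strict_mono) auto
    finally have "y [^] nat \<bar>b\<bar> \<in> word_ball G S0 (2 ^ w * C * 2 ^ r)"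
      by (intro digits) (simp add: power_mult[symmetric] mult.commute)
    moreover have "2 ^ w * C * 2 ^ r \<le> (2 ^ w * C * 2) * n" using r(2) by simp
    ultimately have in_ball: "y [^] nat \<bar>b\<bar> \<in> word_ball G S0 ((2 ^ w * C * 2) * n)"
      using word_ball_mono by blast
    show ?thesis
    proof (cases b rule: int_cases2)
      case (nonneg m)
      then show ?thesis using in_ball by (simp add: int_pow_int)
    next
      case (nonpos m)
      then show ?thesis using word_ball_inv[OF S0_carrier in_ball] y by (simp add: int_pow_neg int_pow_int)
    qed
  qed
  \<comment> \<open>For \<open>w = 0\<close> the strict bound \<open>n ^ w < (2 ^ r) ^ w\<close>
    fails; only the exponents -1, 0 and 1 remain.\<close>
  moreover have "y [^] b \<in> word_ball G S0 (C * n)" if n: "n \<ge> 1" and b: "\<bar>b\<bar> \<le> int n ^ w" and w: "w = 0" for n and b :: int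
  proof -
    have y1: "y \<in> word_ball G S0 (C * n)"
      using C[of 1] w y word_ball_mono[of "C * 1" "C * n"] n by auto
    have "b = 0 \<or> b = 1 \<or> b = -1" using b w by auto
    then show ?thesis using y1 y word_ball_one word_ball_inv[OF S0_carrier y1] by (auto simp: int_pow_neg int_pow_1)
  qed
  ultimately show ?thesis unfolding distorted_def by (metis gr0I less_one not_le)
qed

text \<open>An item of weight \<open>v\<close> occurs with exponent 1, which is
  \<open>1 / n ^ v\<close> times the bound \<open>n ^ v\<close>; so prices add up to box
  parameters.\<close>

lemma cost_in_box:
  assumes L: "set L = {x \<in> items. w \<le> snd x}" and n: "n \<ge> 1" and a: "cost w n a C"
  shows "a \<in> box L C n"
proof -
  have LA: "fst ` set L \<subseteq> A" using items_A L by force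
  show ?thesis
    using a
  proof (induction rule: cost.induct)
    case (cost_one C)
    then show ?case by (rule box_one)
  next
    case (cost_item y v)
    then have "fst (y, v) [^] (1 :: int) \<in> box L (1 / real n ^ v) n"
      using n L by (intro box_item[OF LA]) auto
    then show ?case using items_A[OF cost_item(1)] by (simp add: int_pow_1)
  next
    case (cost_item_inv y v)
    then have "fst (y, v) [^] (- 1 :: int) \<in> box L (1 / real n ^ v) n"
      using n L by (intro box_item[OF LA]) auto
    then show ?case using items_A[OF cost_item_inv(1)] int_pow_neg[of y 1] by simp
  next
    case (cost_mult a C b D)
    then show ?case by (intro box_mult[OF LA])
  qed
qed

lemma box_subset_word_ball:
  assumes L: "\<And>x. x \<in> set L \<Longrightarrow> fst x \<in> A \<and> snd x \<ge> 1 \<and> distorted (fst x) (snd x)"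
  shows "\<exists>D :: nat. \<forall>n\<ge>1. box L C n \<subseteq> word_ball G S0 (D * n)"
  using L
proof (induction L)
  case Nil
  then show ?case using word_ball_one by auto
next
  case (Cons x L)
  then obtain D :: nat where D: "\<And>n. n \<ge> 1 \<Longrightarrow> box L C n \<subseteq> word_ball G S0 (D * n)" by auto
  obtain E :: nat where E: "\<And>n (b :: int). n \<ge> 1 \<Longrightarrow> \<bar>b\<bar> \<le> int n ^ snd x \<Longrightarrow> fst x [^] b \<in> word_ball G S0 (E * n)"
    using Cons.prems[of x] unfolding distorted_def by auto
  have w: "snd x \<ge> 1" using Cons.prems by auto
  \<comment> \<open>For weights at least 1, \<open>C * n ^ w \<le> (N * n) ^ w\<close>; the factor
    is thus moved into the radius.\<close>
  define N where "N = nat \<lceil>C\<rceil> + 1"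
  have N: "C \<le> real N" "N \<ge> 1" unfolding N_def by linarith+
  have "box (x # L) C n \<subseteq> word_ball G S0 ((E * N + D) * n)" if n: "n \<ge> 1" for n
  proof
    fix g assume "g \<in> box (x # L) C n"
    then obtain b p where bp: "\<bar>real_of_int b\<bar> \<le> C * real n ^ snd x" "p \<in> box L C n" "g = fst x [^] (b :: int) \<otimes> p"
      by (rule box_ConsE)
    have "real N * 1 \<le> real N * real N ^ (snd x - 1)" using N(2) by (intro mult_left_mono one_le_power) auto
    then have "C \<le> real N ^ snd x" using N(1) w by (simp add: power_eq_if)
    then have "C * real n ^ snd x \<le> real N ^ snd x * real n ^ snd x" by (intro mult_right_mono) auto
    then have "\<bar>real_of_int b\<bar> \<le> real_of_int (int (N * n) ^ snd x)" using bp(1) by (simp add: power_mult_distrib)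
    then have "\<bar>b\<bar> \<le> int (N * n) ^ snd x" by linarith
    moreover have "N * n \<ge> 1" using N(2) n by (simp add: Suc_leI)
    ultimately have "fst x [^] b \<in> word_ball G S0 (E * (N * n))" by (intro E)
    from word_ball_mult[OF S0_carrier this, of p "D * n"] D[OF n] bp(2)
    show "g \<in> word_ball G S0 ((E * N + D) * n)" unfolding bp(3) by (auto simp: algebra_simps)
  qed
  then show ?case by blast
qed

text \<open>Downward induction on the weight: the error in approximating
  \<open>y [^] (n ^ w)\<close> consists of heavier items of bounded price, whose box already lies in
  a ball of radius linear in \<open>n\<close>.\<close>

lemma distorted_items:
  assumes "(y, w) \<in> items"
  shows "distorted y w"
proof -
  obtain W where W: "\<And>y w. (y, w) \<in> items \<Longrightarrow> w < W"
  proof -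
    have "finite (snd ` items)" using finite_items by simp
    then obtain W where "\<forall>w\<in>snd ` items. w < W" using finite_nat_set_iff_bounded by blast
    then show thesis by (intro that[of W]) force
  qed
  show ?thesis
    using assms
  proof (induction "W - w" arbitrary: y w rule: less_induct)
    case less
    have yA: "y \<in> A" "w \<ge> 1" using items_A[OF less.prems] by auto
    obtain C :: nat and D where CD: "\<And>n. n \<ge> 1 \<Longrightarrow> \<exists>z e. z \<in> word_ball G S0 (C * n) \<and> z \<in> A \<and> cost (Suc w) n e D \<and>
      y [^] (n ^ w) = z \<otimes> e" using approximable_items[OF less.prems] unfolding approximable_def by blast
    obtain L where L: "set L = {x \<in> items. Suc w \<le> snd x}"
      using finite_list[of "{x \<in> items. Suc w \<le> snd x}"] finite_items by auto
    have "fst x \<in> A \<and> snd x \<ge> 1 \<and> distorted (fst x) (snd x)" if "x \<in> set L" for x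
    proof -
      obtain y' w' where x: "x = (y', w')" by (cases x)
      then have i: "(y', w') \<in> items" "w < w'" using that L by auto
      then have "W - w' < W - w" using W[OF i(1)] by linarith
      then show ?thesis using less.hyps[OF _ i(1)] items_A[OF i(1)] x by simp
    qed
    then obtain E :: nat where E: "\<And>n. n \<ge> 1 \<Longrightarrow> box L D n \<subseteq> word_ball G S0 (E * n)"
      using box_subset_word_ball by blast
    show ?case
    proof (rule distorted_if_powers)
      fix n :: nat assume n: "n \<ge> 1"
      obtain z e where ze: "z \<in> word_ball G S0 (C * n)" "cost (Suc w) n e D" "y [^] (n ^ w) = z \<otimes> e"
        using CD[OF n] by blast
      have "e \<in> word_ball G S0 (E * n)" using cost_in_box[OF L n ze(2)] E[OF n] by blast
      from word_ball_mult[OF S0_carrier ze(1) this]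
      show "y [^] (n ^ w) \<in> word_ball G S0 ((C + E) * n)" unfolding ze(3) by (simp add: algebra_simps)
    qed (use yA in simp)
  qed
qed

end

section \<open>Growth of nilpotent-by-finite metabelian groups\<close>

context group begin

primrec power_prod :: "'a list \<Rightarrow> int list \<Rightarrow> 'a" where
  "power_prod [] es = \<one>"
| "power_prod (s # ss) es = s [^] hd es \<otimes> power_prod ss (tl es)"

lemma power_prod_closed [simp]: "set ss \<subseteq> carrier G \<Longrightarrow> power_prod ss es \<in> carrier G"
  by (induction ss arbitrary: es) auto

text \<open>Rounding \<open>m\<close> down to a multiple of \<open>q\<close> loses less than a
  factor 2 in the radius once \<open>m \<ge> q\<close>.\<close>

lemma lower_growth_from_multiples:
  fixes W :: "nat \<Rightarrow> 'a set"
  assumes c: "c > 0" "\<And>n. n \<ge> 1 \<Longrightarrow> c * real n ^ d \<le> real (card (W (q * n)))" and q: "q \<ge> 1"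
    and W: "\<And>n. finite (W n)" "\<And>m n. m \<le> n \<Longrightarrow> W m \<subseteq> W n" "\<And>n. W n \<noteq> {}"
  shows "\<exists>a>0. \<forall>m\<ge>1. a * real m ^ d \<le> real (card (W m))"
proof -
  define P where "P = (2 * real q) ^ d"
  \<comment> \<open>The minimum with 1 takes care of \<open>m < q\<close>, where only the trivial
    bound 1 is available.\<close>
  define a where "a = min 1 c / P"
  have pos: "P > 0" using q by (simp add: P_def)
  have a: "a > 0" using c(1) pos by (simp add: a_def)
  have "a * real m ^ d \<le> real (card (W m))" if m: "m \<ge> 1" for m
  proof (cases "m < q")
    case True
    have "real m ^ d \<le> P" unfolding P_def using True by (intro power_mono) auto
    then have "a * real m ^ d \<le> a * P" using a by (intro mult_left_mono) auto
    also have "\<dots> \<le> 1" using pos by (simp add: a_def)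
    also have "1 \<le> real (card (W m))" using W(1,3)[of m] by (simp add: Suc_leI card_gt_0_iff)
    finally show ?thesis .
  next
    case False
    define n where "n = m div q"
    have n: "n \<ge> 1" using False q by (simp add: n_def Suc_leI div_greater_zero_iff)
    have mq: "q * n \<le> m" by (simp add: n_def)
    have "m < q * n + q" unfolding n_def using q by (metis dividend_less_times_div less_le_trans zero_less_one add.commute)
    also have "\<dots> \<le> 2 * q * n" using n by (cases n) auto
    finally have "real m \<le> real (2 * q * n)" by (simp only: of_nat_le_iff less_imp_le)
    then have "real m ^ d \<le> P * real n ^ d"
      by (simp only: P_def of_nat_mult of_nat_numeral power_mult_distrib[symmetric]) (intro power_mono, auto)
    then have "a * real m ^ d \<le> a * (P * real n ^ d)" using a by (intro mult_left_mono) auto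
    also have "\<dots> = min 1 c * real n ^ d" using pos by (simp add: a_def)
    also have "\<dots> \<le> c * real n ^ d" by (intro mult_right_mono) auto
    also have "\<dots> \<le> real (card (W (q * n)))" by (rule c(2)[OF n])
    also have "\<dots> \<le> real (card (W m))" using W mq by (simp add: card_mono)
    finally show ?thesis .
  qed
  then show ?thesis using a by blast
qed

lemma growth_bounds_upper:
  assumes "growth_bounds S d a b" "n \<ge> 1"
  shows "real (card (word_ball G S n)) \<le> b * real n ^ d"
  using assms by (auto simp: growth_bounds_def)

text \<open>A letter read after a representative \<open>t\<close> is rewritten as
  \<open>t \<otimes> s = h' \<otimes> t'\<close>. Only finitely many \<open>h'\<close> occur, so a
  word of length \<open>n\<close> becomes a word of length \<open>L * n\<close> over
  \<open>S\<close> followed by one representative.\<close>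

lemma growth_bounds_finite_index:
  assumes S: "S \<subseteq> carrier G" "finite S" and T: "T \<subseteq> carrier G" "finite T"
    and cover: "\<And>g. g \<in> carrier G \<Longrightarrow> \<exists>h\<in>generate G S. \<exists>t\<in>T. g = h \<otimes> t"
    and growth: "growth_bounds S d a b"
  shows "\<exists>a' b'. growth_bounds (S \<union> T) d a' b'" and "generate G (S \<union> T) = carrier G"
proof -
  let ?S = "S \<union> T"
  have Sc: "?S \<subseteq> carrier G" "finite ?S" using S T by auto
  show "generate G ?S = carrier G"
  proof
    show "generate G ?S \<subseteq> carrier G" by (rule generate_incl[OF Sc(1)])
    show "carrier G \<subseteq> generate G ?S"
    proof
      fix g assume "g \<in> carrier G"
      then obtain h t where ht: "h \<in> generate G S" "t \<in> T" "g = h \<otimes> t" using cover by blast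
      have "h \<in> generate G ?S" using mono_generate[of S ?S] ht(1) by blast
      moreover have "t \<in> generate G ?S" using ht(2) by (intro generate.incl) auto
      ultimately show "g \<in> generate G ?S" unfolding ht(3) by (rule generate.eng)
    qed
  qed
  \<comment> \<open>The identity is added so that the empty word has this form too.\<close>
  define T1 where "T1 = insert \<one> T"
  have T': "T1 \<subseteq> carrier G" "finite T1" "\<one> \<in> T1" "T \<subseteq> T1" using T by (auto simp: T1_def)
  have "\<forall>x\<in>T1 \<times> (?S \<union> m_inv G ` ?S). \<exists>y\<in>generate G S \<times> T. fst x \<otimes> snd x = fst y \<otimes> snd y"
  proof
    fix x assume "x \<in> T1 \<times> (?S \<union> m_inv G ` ?S)"
    then have x: "fst x \<in> T1" "snd x \<in> ?S \<union> m_inv G ` ?S" by (simp_all only: mem_Times_iff)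
    have "fst x \<in> carrier G" using x(1) T'(1) by blast
    moreover have "snd x \<in> carrier G" using x(2) Sc(1) by auto
    ultimately have "fst x \<otimes> snd x \<in> carrier G" by (rule m_closed)
    from cover[OF this] show "\<exists>y\<in>generate G S \<times> T. fst x \<otimes> snd x = fst y \<otimes> snd y" by force
  qed
  then have "\<forall>x\<in>T1 \<times> (?S \<union> m_inv G ` ?S). \<exists>y. y \<in> generate G S \<times> T \<and> fst x \<otimes> snd x = fst y \<otimes> snd y"
    unfolding Bex_def .
  then obtain f where f: "\<forall>x\<in>T1 \<times> (?S \<union> m_inv G ` ?S). f x \<in> generate G S \<times> T \<and> fst x \<otimes> snd x = fst (f x) \<otimes> snd (f x)"
    by (rule bchoice[THEN exE])
  have "finite ((fst \<circ> f) ` (T1 \<times> (?S \<union> m_inv G ` ?S)))" using T' Sc by simp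
  moreover have "(fst \<circ> f) ` (T1 \<times> (?S \<union> m_inv G ` ?S)) \<subseteq> generate G S"
  proof (rule image_subsetI)
    fix x assume "x \<in> T1 \<times> (?S \<union> m_inv G ` ?S)"
    then have "f x \<in> generate G S \<times> T" using f by blast
    then show "(fst \<circ> f) x \<in> generate G S" by (simp add: mem_Times_iff)
  qed
  ultimately obtain L where L: "(fst \<circ> f) ` (T1 \<times> (?S \<union> m_inv G ` ?S)) \<subseteq> word_ball G S L"
    using finite_subset_word_ball[OF S(1)] by blast
  have sub: "word_ball G ?S n \<subseteq> (\<lambda>(h, t). h \<otimes> t) ` (word_ball G S (L * n) \<times> T1)" for n
  proof (induction n)
    case 0
    then show ?case using T'(3) by (auto intro!: image_eqI[of _ _ "(\<one>, \<one>)"])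
  next
    case (Suc n)
    show ?case
    proof
      fix g assume "g \<in> word_ball G ?S (Suc n)"
      then show "g \<in> (\<lambda>(h, t). h \<otimes> t) ` (word_ball G S (L * Suc n) \<times> T1)"
      proof (cases rule: word_ball_SucE)
        case 1
        from subsetD[OF Suc 1] obtain h t where ht: "h \<in> word_ball G S (L * n)" "t \<in> T1" "g = h \<otimes> t"
          by (elim imageE) auto
        have "h \<in> word_ball G S (L * Suc n)"
          using subsetD[OF word_ball_mono[of "L * n" "L * Suc n" S] ht(1)] by simp
        then show ?thesis using ht(2,3) by (intro image_eqI[of _ _ "(h, t)"]) auto
      next
        case (2 g' s)
        from subsetD[OF Suc 2(1)] obtain h t where ht: "h \<in> word_ball G S (L * n)" "t \<in> T1" "g' = h \<otimes> t"
          by (elim imageE) auto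
        have ts: "(t, s) \<in> T1 \<times> (?S \<union> m_inv G ` ?S)" using ht(2) 2(2) by blast
        define h' t' where "h' = fst (f (t, s))" and "t' = snd (f (t, s))"
        have e: "t \<otimes> s = h' \<otimes> t'" "t' \<in> T" using f[rule_format, OF ts] by (auto simp: h'_def t'_def)
        have h': "h' \<in> word_ball G S L" using subsetD[OF L imageI[OF ts]] by (simp add: h'_def)
        have c: "h \<in> carrier G" "t \<in> carrier G" "s \<in> carrier G" "h' \<in> carrier G" "t' \<in> carrier G"
          using ht(1) h' word_ball_closed[OF S(1)] subsetD[OF T'(1) ht(2)] subsetD[OF T(1) e(2)] 2(2) Sc(1) by auto
        have "g = h \<otimes> (t \<otimes> s)" unfolding 2(3) ht(3) using c by (simp add: m_assoc)
        also have "\<dots> = (h \<otimes> h') \<otimes> t'" unfolding e(1) using c by (simp add: m_assoc)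
        finally have "g = (h \<otimes> h') \<otimes> t'" .
        moreover have "h \<otimes> h' \<in> word_ball G S (L * Suc n)"
          using word_ball_mult[OF S(1) ht(1) h'] by (simp add: add.commute)
        moreover have "t' \<in> T1" using e(2) T'(4) by blast
        ultimately show ?thesis by (intro image_eqI[of _ _ "(h \<otimes> h', t')"]) auto
      qed
    qed
  qed
  have ab: "a > 0" "b > 0" using growth by (auto simp: growth_bounds_def)
  define b' where "b' = real (card T1) * (b * real (Suc L) ^ d)"
  have up: "real (card (word_ball G ?S n)) \<le> b' * real n ^ d" if n: "n \<ge> 1" for n
  proof -
    have "card (word_ball G ?S n) \<le> card ((\<lambda>(h, t). h \<otimes> t) ` (word_ball G S (L * n) \<times> T1))"
      using sub T' finite_word_ball[OF S(2)] by (intro card_mono) auto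
    also have "\<dots> \<le> card (word_ball G S (L * n) \<times> T1)"
      using T' finite_word_ball[OF S(2)] by (intro card_image_le) auto
    also have "\<dots> = card T1 * card (word_ball G S (L * n))" by (simp add: card_cartesian_product mult.commute)
    also have "\<dots> \<le> card T1 * card (word_ball G S (Suc L * n))"
      using word_ball_mono[of "L * n" "Suc L * n"] by (intro mult_le_mono2 card_mono finite_word_ball S) auto
    finally have "real (card (word_ball G ?S n)) \<le> real (card T1) * real (card (word_ball G S (Suc L * n)))"
      by (simp only: of_nat_mult[symmetric] of_nat_le_iff)
    also have "\<dots> \<le> real (card T1) * (b * real (Suc L * n) ^ d)"
      using n by (intro mult_left_mono growth_bounds_upper[OF growth]) auto
    finally show ?thesis by (simp only: b'_def of_nat_mult power_mult_distrib mult.assoc)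
  qed
  have "a * real n ^ d \<le> real (card (word_ball G ?S n))" if n: "n \<ge> 1" for n
  proof -
    have "word_ball G S n \<subseteq> word_ball G ?S n"
      using word_ball_subst[OF Sc(1), of S 1] word_ball_letter[OF Sc(1)] by auto
    then have "card (word_ball G S n) \<le> card (word_ball G ?S n)" by (intro card_mono finite_word_ball Sc)
    moreover have "a * real n ^ d \<le> real (card (word_ball G S n))" using growth n by (auto simp: growth_bounds_def)
    ultimately show ?thesis by linarith
  qed
  moreover have "b' > 0"
  proof -
    have "card T1 > 0" using T' by (auto simp: card_gt_0_iff)
    then show ?thesis unfolding b'_def using ab by (intro mult_pos_pos zero_less_power) auto
  qed
  ultimately have "growth_bounds ?S d a b'" using up ab unfolding growth_bounds_def by blast
  then show "\<exists>a' b'. growth_bounds ?S d a' b'" by blast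
qed

lemma growth_bounds_change_generators:
  assumes S: "finite_generating_set G S" and T: "finite_generating_set G T" and growth: "growth_bounds S d a b"
  shows "\<exists>a' b'. growth_bounds T d a' b'"
proof -
  have Sc: "S \<subseteq> carrier G" "finite S" "generate G S = carrier G" using S by (auto simp: finite_generating_set_def)
  have Tc: "T \<subseteq> carrier G" "finite T" "generate G T = carrier G" using T by (auto simp: finite_generating_set_def)
  obtain L where "T \<subseteq> word_ball G S L" using finite_subset_word_ball[OF Sc(1) Tc(2)] Tc Sc by auto
  then have L: "T \<subseteq> word_ball G S (Suc L)" by auto
  obtain M where "S \<subseteq> word_ball G T M" using finite_subset_word_ball[OF Tc(1) Sc(2)] Tc Sc by auto
  then have M: "S \<subseteq> word_ball G T (Suc M)" by auto
  have ab: "a > 0" "b > 0" using growth by (auto simp: growth_bounds_def)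
  have up: "real (card (word_ball G T n)) \<le> (b * real (Suc L) ^ d) * real n ^ d" if n: "n \<ge> 1" for n
  proof -
    have "word_ball G T n \<subseteq> word_ball G S (Suc L * n)" using word_ball_subst[OF Sc(1) L] by blast
    then have "card (word_ball G T n) \<le> card (word_ball G S (Suc L * n))" by (intro card_mono finite_word_ball Sc)
    also have "real (card (word_ball G S (Suc L * n))) \<le> b * real (Suc L * n) ^ d"
      using n by (intro growth_bounds_upper[OF growth]) auto
    finally show ?thesis by (simp only: of_nat_mult power_mult_distrib mult.assoc of_nat_le_iff)
  qed
  have "\<exists>a'>0. \<forall>m\<ge>1. a' * real m ^ d \<le> real (card (word_ball G T m))"
  proof (rule lower_growth_from_multiples[OF ab(1), of d _ "Suc M"])
    fix n :: nat assume n: "n \<ge> 1"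
    have "word_ball G S n \<subseteq> word_ball G T (Suc M * n)" using word_ball_subst[OF Tc(1) M] by blast
    then have "card (word_ball G S n) \<le> card (word_ball G T (Suc M * n))" by (intro card_mono finite_word_ball Tc)
    moreover have "a * real n ^ d \<le> real (card (word_ball G S n))" using growth n by (auto simp: growth_bounds_def)
    ultimately show "a * real n ^ d \<le> real (card (word_ball G T (Suc M * n)))" by linarith
  next
    show "word_ball G T n \<noteq> {}" for n using word_ball_one by blast
  qed (use finite_word_ball[OF Tc(2)] word_ball_mono in auto)
  then obtain a' where "a' > 0" "\<forall>m\<ge>1. a' * real m ^ d \<le> real (card (word_ball G T m))" by blast
  then have "growth_bounds T d a' (b * real (Suc L) ^ d)" using up ab unfolding growth_bounds_def by auto
  then show ?thesis by blast
qed

end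

section \<open>Independent elements modulo the abelian subgroup\<close>

context metabelian_pair begin

lemma subgroup_containing_A_normal:
  assumes "subgroup N G" "A \<subseteq> N" "g \<in> carrier G" "x \<in> N"
  shows "conj g x \<in> N"
proof -
  have x: "x \<in> carrier G" using subgroup.mem_carrier[OF assms(1,4)] .
  have "comm g x \<in> N" using assms commutator_A x by blast
  then have "comm g x \<otimes> x \<in> N" by (rule subgroup.m_closed[OF assms(1) _ assms(4)])
  then show ?thesis by (subst conj_eq_commutator[OF assms(3) x])
qed

lemma subgroup_generate_A: "X \<subseteq> carrier G \<Longrightarrow> subgroup (generate G (X \<union> A)) G"
  by (intro generate_is_subgroup) auto

lemma A_subset_generate: "A \<subseteq> generate G (X \<union> A)"
  by (auto intro: generate.incl)

text \<open>\<open>generate G (X \<union> A)\<close> contains \<open>A\<close> and is therefore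
  normalized by \<open>g\<close>, so all powers of \<open>g\<close> can be collected on the
  left.\<close>

lemma generate_insert_A:
  assumes g: "g \<in> carrier G" and X: "X \<subseteq> carrier G" and x: "x \<in> generate G (insert g X \<union> A)"
  shows "\<exists>(n :: int). \<exists>y\<in>generate G (X \<union> A). x = g [^] n \<otimes> y"
proof -
  let ?N = "generate G (X \<union> A)"
  note N = subgroup_generate_A[OF X]
  note norm = subgroup_containing_A_normal[OF N A_subset_generate]
  have in_N: "\<exists>(n :: int). \<exists>y\<in>?N. z = g [^] n \<otimes> y" if "z \<in> ?N" for z
    using subgroup.mem_carrier[OF N that] by (intro exI[of _ 0] bexI[OF _ that]) simp
  show ?thesis
    using x
  proof (induction rule: generate.induct)
    case one
    show ?case by (intro in_N generate.one)
  next
    case (incl h)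
    show ?case
    proof (cases "h = g")
      case True
      then show ?thesis using g by (intro exI[of _ 1] bexI[of _ \<one>]) (auto simp: int_pow_1 intro: generate.one)
    next
      case False
      then show ?thesis using incl by (intro in_N generate.incl) auto
    qed
  next
    case (inv h)
    show ?case
    proof (cases "h = g")
      case True
      then show ?thesis using g by (intro exI[of _ "-1"] bexI[of _ \<one>]) (auto simp: int_pow_neg int_pow_1 intro: generate.one)
    next
      case False
      then show ?thesis using inv by (intro in_N generate.inv) auto
    qed
  next
    case (eng h1 h2)
    then obtain n m :: int and y z where yz: "y \<in> ?N" "z \<in> ?N" "h1 = g [^] n \<otimes> y" "h2 = g [^] m \<otimes> z" by blast
    have c: "y \<in> carrier G" "z \<in> carrier G" using yz subgroup.mem_carrier[OF N] by auto
    have gm: "g [^] m \<in> carrier G" "g [^] n \<in> carrier G" using g by auto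
    have "h1 \<otimes> h2 = g [^] (n + m) \<otimes> (conj (inv (g [^] m)) y \<otimes> z)"
      unfolding yz(3,4) using c gm g by (simp add: int_pow_mult m_assoc)
    moreover have "conj (inv (g [^] m)) y \<otimes> z \<in> ?N"
      using gm by (intro subgroup.m_closed[OF N norm[OF _ yz(1)] yz(2)]) auto
    ultimately show ?case by blast
  qed
qed

text \<open>As G / A is abelian, this says that the images of the list form a basis of a free
  abelian subgroup of G / A.\<close>

primrec independent :: "'a list \<Rightarrow> bool" where
  "independent [] \<longleftrightarrow> True"
| "independent (s # ss) \<longleftrightarrow> (\<forall>q :: nat. q \<ge> 1 \<longrightarrow> s [^] q \<notin> generate G (set ss \<union> A)) \<and> independent ss"

text \<open>An element with a positive power in the span built so far adds only finitely many
  cosets. Otherwise its \<open>M\<close>-th power joins the list, and the lower powers become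
  representatives. In the application \<open>M\<close> makes the powers unipotent.\<close>

lemma independent_powers:
  assumes "set gs \<subseteq> carrier G" and M: "M \<ge> 1"
  shows "\<exists>ss T. set ss \<subseteq> (\<lambda>g. g [^] (M :: nat)) ` set gs \<and> independent ss \<and> finite T \<and> T \<subseteq> carrier G \<and>
    (\<forall>x\<in>generate G (set gs \<union> A). \<exists>h\<in>generate G (set ss \<union> A). \<exists>t\<in>T. x = h \<otimes> t)"
  using assms(1)
proof (induction gs)
  case Nil
  have "\<exists>h\<in>generate G ({} \<union> A). \<exists>t\<in>{\<one>}. x = h \<otimes> t" if "x \<in> generate G ({} \<union> A)" for x
  proof -
    have "{} \<union> A \<subseteq> carrier G" by auto
    from generate_in_carrier[OF this that] have "x = x \<otimes> \<one>" by simp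
    with that show ?thesis by blast
  qed
  then show ?case by (intro exI[of _ "[]"] exI[of _ "{\<one>}"]) auto
next
  case (Cons g gs)
  then have g: "g \<in> carrier G" and gs: "set gs \<subseteq> carrier G" by auto
  from Cons.IH[OF gs] obtain ss T where *: "set ss \<subseteq> (\<lambda>g. g [^] M) ` set gs \<and> independent ss \<and> finite T \<and> T \<subseteq> carrier G \<and>
    (\<forall>x\<in>generate G (set gs \<union> A). \<exists>h\<in>generate G (set ss \<union> A). \<exists>t\<in>T. x = h \<otimes> t)"
    by (elim exE)
  note ss = *[THEN conjunct1] *[THEN conjunct2, THEN conjunct1]
  note T = *[THEN conjunct2, THEN conjunct2, THEN conjunct1] *[THEN conjunct2, THEN conjunct2, THEN conjunct2, THEN conjunct1]
  from * have cover': "\<forall>x\<in>generate G (set gs \<union> A). \<exists>h\<in>generate G (set ss \<union> A). \<exists>t\<in>T. x = h \<otimes> t"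
    by (elim conjE)
  note cover = cover'[rule_format]
  have ssc: "set ss \<subseteq> carrier G" using ss(1) gs by auto
  \<comment> \<open>Covers both cases: \<open>k\<close> is an exponent at which a power of
    \<open>g\<close> lies in the span, and the remainders modulo \<open>k\<close> give the
    representatives.\<close>
  have main: "\<exists>h\<in>generate G (set ss' \<union> A). \<exists>t\<in>(\<lambda>(e, t). g [^] (e :: nat) \<otimes> t) ` ({..<k} \<times> T). x = h \<otimes> t"
    if x: "x \<in> generate G (set (g # gs) \<union> A)" and sub: "set ss \<subseteq> set ss'" and ss': "set ss' \<subseteq> carrier G"
      and k: "k \<ge> 1" "g [^] k \<in> generate G (set ss' \<union> A)" for x ss' and k :: nat
  proof -
    let ?N = "generate G (set ss' \<union> A)"
    note N = subgroup_generate_A[OF ss']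
    note norm = subgroup_containing_A_normal[OF N A_subset_generate]
    have "x \<in> generate G (insert g (set gs) \<union> A)" using x by simp
    from generate_insert_A[OF g gs this] obtain n :: int and y
      where ny: "y \<in> generate G (set gs \<union> A)" "x = g [^] n \<otimes> y"
      by (elim exE bexE)
    from cover[OF ny(1)] obtain h t where ht: "h \<in> generate G (set ss \<union> A)" "t \<in> T" "y = h \<otimes> t"
      by (elim bexE)
    have hN: "h \<in> ?N" using ht(1) mono_generate[of "set ss \<union> A" "set ss' \<union> A"] sub by blast
    define e where "e = nat (n mod int k)"
    have e: "e < k" "int e = n mod int k" using k(1) by (auto simp: e_def nat_less_iff)
    have n: "int e + int k * (n div int k) = n" using e(2) by simp
    define u where "u = (g [^] k) [^] (n div int k) \<otimes> h"
    have uN: "u \<in> ?N" unfolding u_def by (intro subgroup.m_closed[OF N] subgroup_int_pow_closed[OF N] k(2) hN)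
    have c: "u \<in> carrier G" "t \<in> carrier G" "g [^] e \<in> carrier G" "h \<in> carrier G"
      using uN hN subgroup.mem_carrier[OF N] ht(2) T(2) g by auto
    have "g [^] n = g [^] e \<otimes> (g [^] k) [^] (n div int k)"
    proof -
      have "g [^] (int e + int k * (n div int k)) = g [^] int e \<otimes> (g [^] int k) [^] (n div int k)"
        using g by (simp only: int_pow_mult int_pow_pow)
      then show ?thesis by (simp only: n int_pow_int)
    qed
    then have "x = g [^] e \<otimes> u \<otimes> t"
      unfolding ny(2) ht(3) u_def using c g by (simp add: m_assoc)
    then have "x = conj (g [^] e) u \<otimes> (g [^] e \<otimes> t)" using c by (simp add: m_assoc)
    moreover have "conj (g [^] e) u \<in> ?N" by (rule norm[OF c(3) uN])
    moreover have "g [^] e \<otimes> t \<in> (\<lambda>(e, t). g [^] (e :: nat) \<otimes> t) ` ({..<k} \<times> T)" using e(1) ht(2) by force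
    ultimately show ?thesis by blast
  qed
  have T': "finite ((\<lambda>(e, t). g [^] (e :: nat) \<otimes> t) ` ({..<k} \<times> T))" "(\<lambda>(e, t). g [^] (e :: nat) \<otimes> t) ` ({..<k} \<times> T) \<subseteq> carrier G" for k
    using T g by auto
  show ?case
  proof (cases "\<exists>q::nat. q \<ge> 1 \<and> g [^] q \<in> generate G (set ss \<union> A)")
    case True
    then obtain q :: nat where q: "q \<ge> 1" "g [^] q \<in> generate G (set ss \<union> A)" by blast
    show ?thesis
      by (intro exI[of _ ss] exI[of _ "(\<lambda>(e, t). g [^] (e :: nat) \<otimes> t) ` ({..<q} \<times> T)"] conjI ballI T' ss(2) main[OF _ _ ssc q])
        (use ss(1) in auto)
  next
    case False
    have ind: "independent (g [^] M # ss)"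
    proof -
      have "(g [^] M) [^] q \<notin> generate G (set ss \<union> A)" if "q \<ge> 1" for q :: nat
      proof -
        have "M * q \<ge> 1" using M that by (simp add: Suc_leI)
        then show ?thesis using False g by (simp add: nat_pow_pow)
      qed
      then show ?thesis using ss(2) by simp
    qed
    have c': "set (g [^] M # ss) \<subseteq> carrier G" using ssc g by auto
    have gM: "g [^] M \<in> generate G (set (g [^] M # ss) \<union> A)" by (intro generate.incl) auto
    show ?thesis
      by (intro exI[of _ "g [^] M # ss"] exI[of _ "(\<lambda>(e, t). g [^] (e :: nat) \<otimes> t) ` ({..<M} \<times> T)"] conjI ballI T' ind main[OF _ _ c' M gM])
        (use ss(1) in auto)
  qed
qed

lemma power_prod_in_generate:
  "set ss \<subseteq> X \<Longrightarrow> X \<subseteq> carrier G \<Longrightarrow> power_prod ss es \<in> generate G X"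
proof (induction ss arbitrary: es)
  case (Cons s ss)
  have sub: "subgroup (generate G X) G" using Cons.prems by (intro generate_is_subgroup)
  have "s \<in> generate G X" using Cons.prems by (intro generate.incl) auto
  then have "s [^] hd es \<in> generate G X" by (rule subgroup_int_pow_closed[OF sub])
  then show ?case using Cons by (auto intro: generate.eng)
qed (simp add: generate.one)

text \<open>Exponents are read off modulo \<open>A\<close> from the first one on; a difference would
  put a positive power into the span of the rest.\<close>

lemma power_prod_inj:
  assumes "independent ss" "set ss \<subseteq> carrier G" "length es = length ss" "length es' = length ss" "a \<in> A" "a' \<in> A"
    and "power_prod ss es \<otimes> a = power_prod ss es' \<otimes> a'"
  shows "es = es' \<and> a = a'"
  using assms
proof (induction ss arbitrary: es es')
  case (Cons s ss)
  obtain e fs e' fs' where es: "es = e # fs" "es' = e' # fs'" using Cons.prems(3,4) by (metis length_Suc_conv)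
  have s: "s \<in> carrier G" and ssc: "set ss \<subseteq> carrier G" using Cons.prems(2) by auto
  let ?N = "generate G (set ss \<union> A)"
  note N = subgroup_generate_A[OF ssc]
  define x where "x = power_prod ss fs \<otimes> a"
  define x' where "x' = power_prod ss fs' \<otimes> a'"
  have "power_prod ss fs \<in> ?N" "power_prod ss fs' \<in> ?N" using ssc by (auto intro!: power_prod_in_generate)
  moreover have "a \<in> ?N" "a' \<in> ?N" using A_subset_generate Cons.prems(5,6) by auto
  ultimately have xN: "x \<in> ?N" "x' \<in> ?N" unfolding x_def x'_def by (auto intro: generate.eng)
  have xc: "x \<in> carrier G" "x' \<in> carrier G" using xN subgroup.mem_carrier[OF N] by auto
  have "power_prod ss fs \<in> carrier G" "power_prod ss fs' \<in> carrier G" using ssc by auto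
  then have eq: "s [^] e \<otimes> x = s [^] e' \<otimes> x'"
    using Cons.prems(5-7) s unfolding x_def x'_def es by (simp add: m_assoc)
  have main: False if "e < e'" "x \<in> ?N" "x' \<in> ?N" "x \<in> carrier G" "x' \<in> carrier G" "s [^] e \<otimes> x = s [^] e' \<otimes> x'" for e e' :: int and x x'
  proof -
    define k where "k = nat (e' - e)"
    have k: "e' = e + int k" "k \<ge> 1" using that(1) by (auto simp: k_def)
    have "s [^] e' = s [^] e \<otimes> s [^] k" unfolding k(1) using s by (simp only: int_pow_mult int_pow_int)
    then have "s [^] e \<otimes> x = s [^] e \<otimes> (s [^] k \<otimes> x')" using that s by (simp add: m_assoc)
    then have "x = s [^] k \<otimes> x'" using that s by simp
    then have "s [^] k = x \<otimes> inv x'" using that s by (simp add: m_assoc)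
    also have "\<dots> \<in> ?N" using that by (intro subgroup.m_closed[OF N] subgroup.m_inv_closed[OF N])
    finally show False using Cons.prems(1) k(2) by simp
  qed
  have "e = e'" using main[of e e' x x'] main[of e' e x' x] xN xc eq by (cases e e' rule: linorder_cases) auto
  then have "x = x'" using eq xc s by simp
  then have "fs = fs' \<and> a = a'"
    using Cons.prems es unfolding x_def x'_def by (intro Cons.IH) auto
  then show ?case using \<open>e = e'\<close> es by simp
qed auto

end

section \<open>Normal forms and the growth of the nilpotent subgroup\<close>

context unipotent_pair begin

lemma power_prod_word_ball:
  assumes "set ss \<subseteq> U" "length es = length ss" "\<And>e. e \<in> set es \<Longrightarrow> \<bar>e\<bar> \<le> int p"
  shows "power_prod ss es \<in> word_ball G U (length ss * p)"
  using assms
proof (induction ss arbitrary: es)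
  case (Cons s ss)
  obtain e fs where es: "es = e # fs" using Cons.prems(2) by (metis length_Suc_conv)
  have "s \<in> word_ball G U 1" using Cons.prems(1) by (intro word_ball_letter[OF U_carrier]) auto
  then have "s [^] e \<in> word_ball G U (nat \<bar>e\<bar> * 1)" by (rule word_ball_int_pow[OF U_carrier])
  moreover have "nat \<bar>e\<bar> * 1 \<le> p" using Cons.prems(3)[of e] es by auto
  ultimately have "s [^] e \<in> word_ball G U p" using word_ball_mono by blast
  moreover have "power_prod ss fs \<in> word_ball G U (length ss * p)" using Cons es by auto
  ultimately show ?case using word_ball_mult[OF U_carrier] es by auto
qed simp

text \<open>The letter is moved left past a whole tail \<open>\<tau>\<close> at once, at the cost of
  one commutator in \<open>A\<close>. The tail is a word of length at most
  \<open>length ss * n\<close>, so this commutator has price of order \<open>1 / n\<close> by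
  \<open>cost_comm_word\<close>.\<close>

lemma power_prod_step:
  assumes "set ss \<subseteq> U" "u \<in> set ss \<union> m_inv G ` set ss" "length es = length ss" "\<And>e. e \<in> set es \<Longrightarrow> \<bar>e\<bar> \<le> int p"
    and n: "p \<le> n" "n \<ge> 1"
  shows "\<exists>es' c. length es' = length ss \<and> (\<forall>e\<in>set es'. \<bar>e\<bar> \<le> int (Suc p)) \<and>
    power_prod ss es \<otimes> u = power_prod ss es' \<otimes> c \<and> cost 2 n c (real (length ss) * exp (real (length ss)) / real n)"
  using assms(1-4)
proof (induction ss arbitrary: es)
  case (Cons s ss)
  obtain e fs where es: "es = e # fs" using Cons.prems(3) by (metis length_Suc_conv)
  have ssU: "set ss \<subseteq> U" and sU: "s \<in> U" using Cons.prems(1) by auto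
  have uU: "u \<in> U" using Cons.prems(1,2) U_inv by auto
  have fs: "length fs = length ss" "\<And>e. e \<in> set fs \<Longrightarrow> \<bar>e\<bar> \<le> int p" using Cons.prems es by auto
  let ?k = "real (length (s # ss))"
  define \<tau> where "\<tau> = power_prod ss fs"
  have \<tau>: "\<tau> \<in> word_ball G U (length ss * p)" unfolding \<tau>_def by (rule power_prod_word_ball[OF ssU fs])
  have \<tau>c: "\<tau> \<in> carrier G" using word_ball_closed[OF U_carrier \<tau>] .
  have sc: "s \<in> carrier G" "u \<in> carrier G" using sU uU by auto
  show ?case
  proof (cases "u \<in> set ss \<union> m_inv G ` set ss")
    case True
    obtain fs' c where fc: "length fs' = length ss" "\<forall>e\<in>set fs'. \<bar>e\<bar> \<le> int (Suc p)"
      "\<tau> \<otimes> u = power_prod ss fs' \<otimes> c" "cost 2 n c (real (length ss) * exp (real (length ss)) / real n)"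
      using Cons.IH[OF ssU True fs] unfolding \<tau>_def by blast
    have cc: "c \<in> carrier G" "power_prod ss fs' \<in> carrier G"
      using cost_A[OF fc(4)] ssU U_carrier by (auto intro!: power_prod_closed)
    have "power_prod (s # ss) es \<otimes> u = power_prod (s # ss) (e # fs') \<otimes> c"
      using \<tau>c sc cc fc(3) es unfolding \<tau>_def[symmetric] by (simp add: m_assoc \<tau>_def[symmetric])
    moreover have "cost 2 n c (?k * exp ?k / real n)"
      by (rule cost_mono[OF fc(4)]) (intro divide_right_mono mult_mono, auto)
    moreover have "\<forall>e\<in>set (e # fs'). \<bar>e\<bar> \<le> int (Suc p)" using fc(2) Cons.prems(4)[of e] es by auto
    moreover have "length (e # fs') = length (s # ss)" using fc(1) by simp
    ultimately show ?thesis by blast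
  next
    case False
    then have "u = s \<or> u = inv s" using Cons.prems(2) by auto
    then obtain d :: int where d: "u = s [^] d" "\<bar>d\<bar> = 1"
      using sc by (elim disjE) (auto simp: int_pow_neg int_pow_1 intro: that[of 1] that[of "-1"])
    \<comment> \<open>Chosen so that
      \<open>\<tau> \<otimes> u = u \<otimes> \<tau> \<otimes> c\<close>, with the correction on the
      right, where the factor from \<open>A\<close> is kept.\<close>
    define c where "c = comm (inv \<tau>) (inv u)"
    have "\<tau> \<otimes> u = u \<otimes> \<tau> \<otimes> c" using \<tau>c sc by (simp add: c_def m_assoc)
    moreover have cA: "c \<in> A" unfolding c_def using \<tau>c sc by (intro commutator_A) auto
    ultimately have "power_prod (s # ss) es \<otimes> u = s [^] e \<otimes> (u \<otimes> \<tau> \<otimes> c)"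
      using \<tau>c sc es by (simp add: m_assoc \<tau>_def[symmetric])
    also have "\<dots> = s [^] e \<otimes> s [^] d \<otimes> \<tau> \<otimes> c" using \<tau>c sc cA d(1) by (simp add: m_assoc)
    also have "s [^] e \<otimes> s [^] d = s [^] (e + d)" using sc by (simp add: int_pow_mult)
    finally have "power_prod (s # ss) es \<otimes> u = power_prod (s # ss) ((e + d) # fs) \<otimes> c"
      by (simp add: \<tau>_def)
    moreover have "cost 2 n c (?k * exp ?k / real n)"
    proof (rule cost_mono)
      show "cost 2 n c (real (length ss * p) * (1 + 1 / real n) ^ (length ss * p) / real n ^ 2)"
        unfolding c_def by (intro cost_comm_word word_ball_inv[OF U_carrier \<tau>] U_inv uU n)
      have "(1 + 1 / real n) ^ (length ss * p) \<le> exp (real (length ss * p) / real n)" by (rule one_plus_power_le)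
      also have "real (length ss * p) / real n \<le> real (length ss)"
        using n mult_left_mono[of "real p" "real n" "real (length ss)"] by (simp add: divide_le_eq)
      then have "exp (real (length ss * p) / real n) \<le> exp ?k" by simp
      finally have "real (length ss * p) * (1 + 1 / real n) ^ (length ss * p) \<le> (?k * real n) * exp ?k"
        using n by (intro mult_mono) (auto intro!: mult_mono)
      then have "real (length ss * p) * (1 + 1 / real n) ^ (length ss * p) / real n ^ 2 \<le> (?k * real n) * exp ?k / real n ^ 2"
        by (intro divide_right_mono) auto
      also have "\<dots> = ?k * exp ?k / real n" using n by (simp add: power2_eq_square)
      finally show "real (length ss * p) * (1 + 1 / real n) ^ (length ss * p) / real n ^ 2 \<le> ?k * exp ?k / real n" .
    qed
    moreover have "\<forall>x\<in>set ((e + d) # fs). \<bar>x\<bar> \<le> int (Suc p)"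
      using Cons.prems(4)[of e] fs(2) d(2) es by fastforce
    moreover have "length ((e + d) # fs) = length (s # ss)" using fs(1) by simp
    ultimately show ?thesis by blast
  qed
qed auto

text \<open>Each letter multiplies the price of the part in \<open>A\<close> by at most
  \<open>1 + 1 / n\<close> and adds at most \<open>Q / n\<close>. In \<open>Q\<close> the
  exponential term pays for collecting a letter of \<open>U\<close>, the summand 1 for a letter of
  \<open>B\<close>. After \<open>n\<close> letters the price is at most
  \<open>exp 1 * Q\<close>.\<close>

lemma power_prod_normal_form:
  assumes ss: "U = set ss \<union> m_inv G ` set ss" and n: "n \<ge> 1"
    and g: "g \<in> word_ball G S0 p" "p \<le> n"
  defines "Q \<equiv> real (length ss) * exp (real (length ss)) + 1"
  shows "\<exists>es a. length es = length ss \<and> (\<forall>e\<in>set es. \<bar>e\<bar> \<le> int p) \<and> g = power_prod ss es \<otimes> a \<and>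
    cost 1 n a ((1 + 1 / real n) ^ p * (real p * Q / real n))"
  using g
proof (induction p arbitrary: g)
  case 0
  have "power_prod ss (replicate (length ss) 0) = \<one>" by (induction ss) auto
  then show ?case using 0
    by (intro exI[of _ "replicate (length ss) 0"] exI[of _ \<one>]) (auto intro: cost.intros)
next
  case (Suc p)
  let ?e = "1 + 1 / real n"
  have ssc: "set ss \<subseteq> carrier G" "set ss \<subseteq> U" using ss U_carrier by auto
  have Q: "Q \<ge> 1" by (simp add: Q_def)
  have bound: "?e ^ p * (real p * Q / real n) * ?e + Q / real n \<le> ?e ^ Suc p * (real (Suc p) * Q / real n)"
  proof -
    have "1 * (Q / real n) \<le> ?e ^ Suc p * (Q / real n)" using Q n by (intro mult_right_mono one_le_power) auto
    then show ?thesis by (simp add: algebra_simps add_divide_distrib)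
  qed
  have mono: "?e ^ p * (real p * Q / real n) \<le> ?e ^ p * (real p * Q / real n) * ?e"
    using Q mult_left_mono[of 1 ?e "?e ^ p * (real p * Q / real n)"] by simp
  from Suc.prems(1) show ?case
  proof (cases rule: word_ball_SucE)
    case 1
    then obtain es a where es: "length es = length ss" "\<forall>e\<in>set es. \<bar>e\<bar> \<le> int p" "g = power_prod ss es \<otimes> a"
      "cost 1 n a (?e ^ p * (real p * Q / real n))" using Suc by (meson Suc_leD)
    have "0 \<le> Q / real n" using Q by simp
    then have "cost 1 n a (?e ^ Suc p * (real (Suc p) * Q / real n))"
      using bound mono by (intro cost_mono[OF es(4)]) linarith
    moreover have "\<forall>e\<in>set es. \<bar>e\<bar> \<le> int (Suc p)" using es(2) by force
    ultimately show ?thesis using es(1,3) by blast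
  next
    case (2 h u)
    then obtain es a where es: "length es = length ss" "\<forall>e\<in>set es. \<bar>e\<bar> \<le> int p" "h = power_prod ss es \<otimes> a"
      "cost 1 n a (?e ^ p * (real p * Q / real n))" using Suc by (meson Suc_leD)
    have aA: "a \<in> A" using cost_A[OF es(4)] .
    have pc: "power_prod ss es \<in> carrier G" using ssc by simp
    show ?thesis
    proof (cases "u \<in> U")
      case True
      then have uc: "u \<in> carrier G" by simp
      obtain es' c where ec: "length es' = length ss" "\<forall>e\<in>set es'. \<bar>e\<bar> \<le> int (Suc p)"
        "power_prod ss es \<otimes> u = power_prod ss es' \<otimes> c" "cost 2 n c (real (length ss) * exp (real (length ss)) / real n)"
        using power_prod_step[OF ssc(2) _ es(1) _ _ n, of u p] True ss es(2) Suc.prems(2) by auto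
      have cA: "c \<in> A" using cost_A[OF ec(4)] .
      define a' where "a' = conj (inv u) a"
      have a'A: "a' \<in> A" unfolding a'_def using uc aA by (intro conj_A) auto
      have "g = power_prod ss es \<otimes> u \<otimes> a'"
        unfolding 2(3) es(3) a'_def using pc uc aA by (simp add: m_assoc)
      also have "\<dots> = power_prod ss es' \<otimes> (a' \<otimes> c)"
        unfolding ec(3) using ssc cA a'A by (simp add: m_assoc comm_A)
      finally have "g = power_prod ss es' \<otimes> (a' \<otimes> c)" .
      moreover have "cost 1 n (a' \<otimes> c) (?e ^ Suc p * (real (Suc p) * Q / real n))"
      proof (rule cost_mono)
        have "cost 1 n a' (?e * (?e ^ p * (real p * Q / real n)))"
          unfolding a'_def by (rule cost_conj[OF es(4) U_inv[OF True] n])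
        moreover have "cost 1 n c (real (length ss) * exp (real (length ss)) / real n)"
          by (rule cost_weaken[OF ec(4)]) simp
        ultimately show "cost 1 n (a' \<otimes> c) (?e * (?e ^ p * (real p * Q / real n)) + real (length ss) * exp (real (length ss)) / real n)"
          by (rule cost_mult)
        have "real (length ss) * exp (real (length ss)) / real n \<le> Q / real n"
          unfolding Q_def by (intro divide_right_mono) auto
        then show "?e * (?e ^ p * (real p * Q / real n)) + real (length ss) * exp (real (length ss)) / real n
           \<le> ?e ^ Suc p * (real (Suc p) * Q / real n)"
          using bound by (simp add: mult_ac)
      qed
      ultimately show ?thesis using ec(1,2) by blast
    next
      case False
      then have "u \<in> B \<union> m_inv G ` B" using 2(2) U_letters by auto
      then have ub: "cost 1 n u (1 / real n)" using cost_base cost_inv by auto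
      have "u \<in> A" using cost_A[OF ub] .
      then have "g = power_prod ss es \<otimes> (a \<otimes> u)" unfolding 2(3) es(3) using pc aA by (simp add: m_assoc)
      moreover have "cost 1 n (a \<otimes> u) (?e ^ Suc p * (real (Suc p) * Q / real n))"
      proof (rule cost_mono[OF cost_mult[OF es(4) ub]])
        have "1 / real n \<le> Q / real n" using Q by (intro divide_right_mono) auto
        then show "?e ^ p * (real p * Q / real n) + 1 / real n \<le> ?e ^ Suc p * (real (Suc p) * Q / real n)"
          using bound mono by linarith
      qed
      moreover have "\<forall>e\<in>set es. \<bar>e\<bar> \<le> int (Suc p)" using es(2) by force
      ultimately show ?thesis using es(1) by blast
    qed
  qed
qed

text \<open>Normal forms bound the ball from above by boxes, and distortion fits boxes into the ball
  from below, with the same exponent: the number of independent elements plus the exponent of the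
  box.\<close>

lemma growth_S0:
  assumes ss: "U = set ss \<union> m_inv G ` set ss" and ind: "independent ss"
  shows "\<exists>d a b. growth_bounds S0 d a b"
proof -
  \<comment> \<open>Sorted by weight, as \<open>box_growth\<close> adds items from the end of the
    list, heaviest first.\<close>
  define L where "L = sort_key snd (SOME xs. set xs = items)"
  have "\<exists>xs. set xs = items" using finite_list[OF finite_items] .
  then have "set (SOME xs. set xs = items) = items" by (rule someI_ex)
  then have Litems: "set L = items" by (simp add: L_def)
  then have L1: "set L = {x \<in> items. 1 \<le> snd x}" using items_A by force
  have LA: "fst ` set L \<subseteq> A" using items_A Litems by force
  have "sorted (map snd L)" by (simp add: L_def)
  then have "sorted_wrt (\<lambda>x y. snd x \<le> snd y) L" by (simp add: sorted_map)
  from box_growth[OF LA this] obtain d c where c: "c > 0" "\<And>n. n \<ge> 1 \<Longrightarrow> c * real n ^ d \<le> real (card (box L 1 n))"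
    and up: "\<And>C. C \<ge> 0 \<Longrightarrow> \<exists>c>0. \<forall>n\<ge>1. real (card (box L C n)) \<le> c * real n ^ d" by blast
  define k where "k = length ss"
  define Q where "Q = real k * exp (real k) + 1"
  have Q: "Q \<ge> 1" by (simp add: Q_def)
  obtain c2 where c2: "c2 > 0" "\<And>n. n \<ge> 1 \<Longrightarrow> real (card (box L (exp 1 * Q) n)) \<le> c2 * real n ^ d"
    using up[of "exp 1 * Q"] Q by auto
  define Es where "Es n = {es. set es \<subseteq> {- int n..int n} \<and> length es = k}" for n
  have finEs: "finite (Es n)" for n unfolding Es_def by (rule finite_lists_length_eq) simp
  have cardEs: "real (card (Es n)) = (2 * real n + 1) ^ k" for n
    unfolding Es_def by (simp add: card_lists_length_eq add.commute)
  define f where "f = (\<lambda>(es, a). power_prod ss es \<otimes> a)"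
  have ssc: "set ss \<subseteq> carrier G" "set ss \<subseteq> U" using ss U_carrier by auto
  have finS0: "finite S0" using finite_U finite_B by simp
  have upper: "real (card (word_ball G S0 n)) \<le> (3 ^ k * c2) * real n ^ (k + d)" if n: "n \<ge> 1" for n
  proof -
    have "word_ball G S0 n \<subseteq> f ` (Es n \<times> box L (exp 1 * Q) n)"
    proof
      fix g assume "g \<in> word_ball G S0 n"
      from power_prod_normal_form[OF ss n this le_refl] obtain es a where es: "length es = length ss" "\<forall>e\<in>set es. \<bar>e\<bar> \<le> int n"
        "g = power_prod ss es \<otimes> a" "cost 1 n a ((1 + 1 / real n) ^ n * (real n * Q / real n))"
        unfolding Q_def k_def by blast
      have "(1 + 1 / real n) ^ n * (real n * Q / real n) \<le> exp 1 * Q"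
        using one_plus_power_le_exp[of n n] n Q by (simp add: mult_right_mono)
      then have "cost 1 n a (exp 1 * Q)" by (rule cost_mono[OF es(4)])
      then have "a \<in> box L (exp 1 * Q) n" by (rule cost_in_box[OF L1 n])
      moreover have "es \<in> Es n" using es(1,2) by (auto simp: Es_def k_def abs_le_iff) 
      ultimately show "g \<in> f ` (Es n \<times> box L (exp 1 * Q) n)" unfolding es(3) f_def by force
    qed
    then have "card (word_ball G S0 n) \<le> card (f ` (Es n \<times> box L (exp 1 * Q) n))"
      by (intro card_mono finite_imageI finite_cartesian_product finEs finite_box)
    also have "\<dots> \<le> card (Es n \<times> box L (exp 1 * Q) n)"
      by (intro card_image_le finite_cartesian_product finEs finite_box)
    finally have "real (card (word_ball G S0 n)) \<le> real (card (Es n)) * real (card (box L (exp 1 * Q) n))"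
      by (simp add: card_cartesian_product of_nat_mult[symmetric] del: of_nat_mult)
    also have "\<dots> \<le> (3 * real n) ^ k * (c2 * real n ^ d)"
      unfolding cardEs using n c2(2)[OF n] by (intro mult_mono power_mono) auto
    finally show ?thesis by (simp add: power_mult_distrib power_add mult_ac)
  qed
  obtain D :: nat where D: "\<And>n. n \<ge> 1 \<Longrightarrow> box L 1 n \<subseteq> word_ball G S0 (D * n)"
    using box_subset_word_ball[of L 1] items_A distorted_items Litems by (metis prod.collapse)
  \<comment> \<open>\<open>k * n\<close> letters for the power product and \<open>D * n\<close> for
    the box; the extra 1 keeps the multiplier positive.\<close>
  have lower: "c * real n ^ (k + d) \<le> real (card (word_ball G S0 ((k + D + 1) * n)))" if n: "n \<ge> 1" for n
  proof -
    have "inj_on f (Es n \<times> box L 1 n)"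
    proof (rule inj_onI, clarify)
      fix es a es' a' assume *: "es \<in> Es n" "es' \<in> Es n" "a \<in> box L 1 n" "a' \<in> box L 1 n" "f (es, a) = f (es', a')"
      show "es = es' \<and> a = a'"
        using * box_A[OF LA] by (intro power_prod_inj[OF ind ssc(1)]) (auto simp: Es_def k_def f_def)
    qed
    then have "card (Es n) * card (box L 1 n) = card (f ` (Es n \<times> box L 1 n))"
      by (simp add: card_image card_cartesian_product)
    also have "\<dots> \<le> card (word_ball G S0 ((k + D + 1) * n))"
    proof (rule card_mono[OF finite_word_ball[OF finS0]])
      show "f ` (Es n \<times> box L 1 n) \<subseteq> word_ball G S0 ((k + D + 1) * n)"
      proof clarify
        fix es a assume es: "es \<in> Es n" and a: "a \<in> box L 1 n"
        have "power_prod ss es \<in> word_ball G U (length ss * n)"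
          using es by (intro power_prod_word_ball[OF ssc(2)]) (auto simp: Es_def k_def abs_le_iff)
        then have "power_prod ss es \<in> word_ball G S0 (k * n)" unfolding k_def by (rule U_word_S0)
        moreover have "a \<in> word_ball G S0 (D * n)" using D[OF n] a by blast
        ultimately have "power_prod ss es \<otimes> a \<in> word_ball G S0 (k * n + D * n)" by (rule word_ball_mult[OF S0_carrier])
        then show "f (es, a) \<in> word_ball G S0 ((k + D + 1) * n)"
          using word_ball_mono[of "k * n + D * n" "(k + D + 1) * n" S0] by (auto simp: f_def algebra_simps)
      qed
    qed
    finally have "real (card (Es n)) * real (card (box L 1 n)) \<le> real (card (word_ball G S0 ((k + D + 1) * n)))"
      by (simp only: of_nat_mult[symmetric] of_nat_le_iff)
    moreover have "real n ^ k * (c * real n ^ d) \<le> real (card (Es n)) * real (card (box L 1 n))"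
      unfolding cardEs using n c(1) c(2)[OF n] by (intro mult_mono power_mono) auto
    ultimately show ?thesis by (simp add: power_add mult_ac)
  qed
  have "\<exists>a>0. \<forall>m\<ge>1. a * real m ^ (k + d) \<le> real (card (word_ball G S0 m))"
  proof (rule lower_growth_from_multiples[OF c(1) lower])
    show "word_ball G S0 n \<noteq> {}" for n using word_ball_one by blast
  qed (use finite_word_ball[OF finS0] word_ball_mono in auto)
  then obtain a where "a > 0" "\<forall>m\<ge>1. a * real m ^ (k + d) \<le> real (card (word_ball G S0 m))" by blast
  then have "growth_bounds S0 (k + d) a (3 ^ k * c2)" using upper c2(1) unfolding growth_bounds_def by auto
  then show ?thesis by blast
qed

end

section \<open>Assembling the case of polynomial growth\<close>

context group begin

lemma sep_of_growth_bounds: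
  assumes S: "finite_generating_set G S" and growth: "growth_bounds S d a b"
  shows "(\<lambda>v. real (sep (cayley_graph G S) v)) \<asymp> growth_profile d"
proof -
  have Sc: "S \<subseteq> carrier G" "finite S" "generate G S = carrier G"
    using S by (auto simp: finite_generating_set_def)
  show ?thesis
  proof (cases "d = 0")
    case True
    then show ?thesis using sep_bounded_growth[OF Sc] growth by simp
  next
    case False
    then show ?thesis
      unfolding profile_equiv_def
      using sep_upper_polynomial_growth[OF Sc(1,2) growth] sep_lower_polynomial_growth[OF Sc(1,2) growth] by simp
  qed
qed

lemma growth_degree_of_growth_bounds:
  assumes S: "finite_generating_set G S" and growth: "growth_bounds S d a b"
  shows "growth_degree G d"
proof -
  have "S \<subseteq> carrier G" using S by (auto simp: finite_generating_set_def)
  then show ?thesis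
    unfolding growth_degree_def Let_def using S growth
    by (intro exI[of _ S] conjI exI[of _ a] exI[of _ b]) (auto simp: growth_bounds_def word_ball_eq_gdist)
qed

end

context metabelian_pair begin

lemma uniform_unipotent_power:
  assumes B: "finite B" "B \<subseteq> A" "generate G B = A"
    and r: "\<And>t a. t \<in> carrier G \<Longrightarrow> a \<in> A \<Longrightarrow> small_relation t a"
    and T: "finite T" "T \<subseteq> carrier G"
  shows "\<exists>M\<ge>1. \<exists>k. \<forall>t\<in>T. \<forall>a\<in>A. act t ((monom 1 M - 1) ^ k) a = \<one>"
  using T
proof (induction T rule: finite_induct)
  case (insert t T)
  have t: "t \<in> carrier G" and Tc: "T \<subseteq> carrier G" using insert.prems by auto
  from insert.IH[OF Tc] obtain M k where M: "M \<ge> 1" and k: "\<forall>s\<in>T. \<forall>a\<in>A. act s ((monom 1 M - 1) ^ k) a = \<one>"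
    by (elim exE conjE)
  note Mk = M k[rule_format]
  obtain M' k' where Mk': "M' \<ge> 1" "\<And>a. a \<in> A \<Longrightarrow> act t ((monom 1 M' - 1) ^ k') a = \<one>"
    using unipotent_power[OF B r t] by blast
  let ?q = "(monom 1 (M * M') - 1) ^ (k + k') :: int poly"
  have "(monom 1 M - 1) ^ k dvd ?q" by (rule monom_minus_one_power_dvd)
  moreover have "(monom 1 M' - 1) ^ k' dvd ?q"
    using monom_minus_one_power_dvd[of M' k' M k] by (simp only: mult.commute add.commute)
  ultimately have "act s ?q a = \<one>" if "s \<in> insert t T" "a \<in> A" for s a
    using act_dvd[of s a _ ?q] that Mk(2)[of s a] Mk'(2)[of a] t Tc by blast
  moreover have "M * M' \<ge> 1" using Mk(1) Mk'(1) by (simp add: Suc_leI)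
  ultimately show ?case by blast
qed auto

lemma virtually_nilpotent_case:
  assumes S: "finite S" "S \<subseteq> carrier G" "generate G S = carrier G"
    and A_min: "\<And>N. subgroup N G \<Longrightarrow> (\<And>g h. g \<in> carrier G \<Longrightarrow> h \<in> carrier G \<Longrightarrow> g \<otimes> h \<otimes> inv g \<otimes> inv h \<in> N) \<Longrightarrow> A \<subseteq> N"
    and r: "\<And>t a. t \<in> carrier G \<Longrightarrow> a \<in> A \<Longrightarrow> small_relation t a"
  shows "virtually_nilpotent G \<and> (\<exists>d. growth_degree G d \<and>
    (\<forall>S. finite_generating_set G S \<longrightarrow> (\<lambda>v. real (sep (cayley_graph G S) v)) \<asymp> growth_profile d))"
proof -
  obtain B where B: "finite B" "B \<subseteq> A" "generate G B = A"
    using finitely_generated_A[OF S A_min r] by blast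
  \<comment> \<open>Inverses are included because \<open>U\<close> has to be closed under
    inversion.\<close>
  have "finite (S \<union> m_inv G ` S)" "S \<union> m_inv G ` S \<subseteq> carrier G" using S by auto
  from uniform_unipotent_power[OF B r this] obtain M k where M: "M \<ge> 1"
    and nil: "\<And>t a. t \<in> S \<union> m_inv G ` S \<Longrightarrow> a \<in> A \<Longrightarrow> act t ((monom 1 M - 1) ^ k) a = \<one>" by blast
  obtain gs where gs: "set gs = S" using finite_list[OF S(1)] by blast
  have gsc: "set gs \<subseteq> carrier G" using gs S by simp
  from independent_powers[OF gsc M] obtain ss T where *: "set ss \<subseteq> (\<lambda>g. g [^] M) ` set gs \<and> independent ss \<and> finite T \<and> T \<subseteq> carrier G \<and>
    (\<forall>x\<in>generate G (set gs \<union> A). \<exists>h\<in>generate G (set ss \<union> A). \<exists>t\<in>T. x = h \<otimes> t)"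
    by (elim exE)
  note ss = *[THEN conjunct1] *[THEN conjunct2, THEN conjunct1]
  note T = *[THEN conjunct2, THEN conjunct2, THEN conjunct1] *[THEN conjunct2, THEN conjunct2, THEN conjunct2, THEN conjunct1]
  note cover = *[THEN conjunct2, THEN conjunct2, THEN conjunct2, THEN conjunct2, rule_format]
  define U where "U = set ss \<union> m_inv G ` set ss"
  have ssc: "set ss \<subseteq> carrier G" using ss(1) gsc by auto
  have U_pow: "\<exists>t\<in>S \<union> m_inv G ` S. u = t [^] M" if u: "u \<in> U" for u
  proof (cases "u \<in> set ss")
    case True
    then show ?thesis using ss(1) gs by auto
  next
    case False
    then obtain s where "s \<in> set ss" "u = inv s" using u by (auto simp: U_def)
    then obtain g where g: "g \<in> S" "u = inv (g [^] M)" using ss(1) gs by auto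
    then have "u = (inv g) [^] M" using S(2) by (simp add: nat_pow_inv subset_iff)
    then show ?thesis using g(1) by auto
  qed
  interpret unipotent_pair G A U B k
  proof
    show "finite U" by (simp add: U_def)
    show "U \<subseteq> carrier G" using ssc by (auto simp: U_def)
    show "inv u \<in> U" if "u \<in> U" for u using that ssc by (auto simp: U_def subset_iff)
    show "finite B" "generate G B = A" by (fact B)+
    show "(bra u ^^ k) a = \<one>" if u: "u \<in> U" and a: "a \<in> A" for u a
    proof -
      obtain t where t: "t \<in> S \<union> m_inv G ` S" "u = t [^] M" using U_pow[OF u] by blast
      have "t \<in> carrier G" using t(1) S(2) by auto
      then show ?thesis unfolding t(2) by (rule bra_pow_nilpotent[OF _ a nil[OF t(1) a]])
    qed
  qed
  have HU: "generate G (set ss \<union> A) \<subseteq> H" unfolding H_def by (rule mono_generate) (auto simp: U_def)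
  have gen_gs: "generate G (set gs \<union> A) = carrier G"
  proof
    show "generate G (set gs \<union> A) \<subseteq> carrier G" using gsc by (intro generate_incl) auto
    show "carrier G \<subseteq> generate G (set gs \<union> A)" using mono_generate[of S "set gs \<union> A"] S(3) gs by auto
  qed
  have coverH: "\<exists>h\<in>H. \<exists>t\<in>T. g = h \<otimes> t" if "g \<in> carrier G" for g
    using cover[of g] that gen_gs HU by blast
  have "rcosets H \<subseteq> (\<lambda>t. H #> t) ` T"
  proof
    fix R assume "R \<in> rcosets H"
    then obtain g where g: "g \<in> carrier G" "R = H #> g" by (auto simp: RCOSETS_def)
    obtain h t where ht: "h \<in> H" "t \<in> T" "g = h \<otimes> t" using coverH[OF g(1)] by blast
    have "H #> g = (H #> h) #> t"
      unfolding ht(3) using ht T(2) subgroup.subset[OF subgroup_H] by (intro coset_mult_assoc[symmetric]) auto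
    also have "H #> h = H" using ht(1) subgroup_H subgroup.mem_carrier[OF subgroup_H] by (intro coset_join2) auto
    finally show "R \<in> (\<lambda>t. H #> t) ` T" using g(2) ht(2) by blast
  qed
  then have "finite (rcosets H)" using T(1) finite_surj by blast
  then have vn: "virtually_nilpotent G"
    unfolding virtually_nilpotent_def using subgroup_H nilpotent_H by blast
  obtain d a b where growth: "growth_bounds S0 d a b" using growth_S0[OF U_def ss(2)] by blast
  have H_S0: "H \<subseteq> generate G S0"
    unfolding H_def
  proof (rule generate_subgroup_incl)
    show "subgroup (generate G S0) G" using S0_carrier by (rule generate_is_subgroup)
    show "U \<union> A \<subseteq> generate G S0"
      using mono_generate[of B S0] B(3) generate.incl[of _ S0 G] by auto
  qed
  have finS0: "finite S0" using finite_U finite_B by simp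
  have cover0: "\<exists>h\<in>generate G S0. \<exists>t\<in>T. g = h \<otimes> t" if "g \<in> carrier G" for g
    using coverH[OF that] H_S0 by blast
  note fi = growth_bounds_finite_index[OF S0_carrier finS0 T(2,1) cover0 growth]
  obtain a' b' where growth': "growth_bounds (S0 \<union> T) d a' b'" using fi(1) by blast
  have fgs: "finite_generating_set G (S0 \<union> T)"
    unfolding finite_generating_set_def using fi(2) S0_carrier finS0 T by auto
  have "(\<lambda>v. real (sep (cayley_graph G S') v)) \<asymp> growth_profile d" if "finite_generating_set G S'" for S'
    using growth_bounds_change_generators[OF fgs that growth'] sep_of_growth_bounds[OF that] by blast
  then show ?thesis using vn growth_degree_of_growth_bounds[OF fgs growth'] by blast
qed

end

section \<open>Embedded lamplighter groups\<close>

lemma lamplighter_generated: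
  "finite_generating_set lamplighter {(\<lambda>_. 0, 1), (\<lambda>j. if j = 0 then 1 else 0, 0)}" (is "finite_generating_set _ ?S")
proof -
  interpret L: group lamplighter by (rule group_lamplighter)
  have Sc: "?S \<subseteq> carrier lamplighter" by (auto simp: carrier_lamplighter)
  have sub: "subgroup (generate lamplighter ?S) lamplighter" by (rule L.generate_is_subgroup[OF Sc])
  let ?g = "generate lamplighter ?S"
  have zc: "(\<lambda>_. 0, m) \<in> carrier lamplighter" for m by (auto simp: carrier_lamplighter)
  have shift_nat: "(\<lambda>_. 0, int n) \<in> ?g" for n
  proof (induction n)
    case 0
    then show ?case using generate.one[of lamplighter ?S] by (simp add: one_lamplighter)
  next
    case (Suc n)
    have "(\<lambda>_. 0, 1) \<in> ?g" by (intro generate.incl) simp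
    from generate.eng[OF Suc this] show ?case by (simp add: mult_lamplighter add.commute)
  qed
  have shift: "(\<lambda>_. 0, m) \<in> ?g" for m
  proof (cases m rule: int_cases2)
    case (nonneg n)
    then show ?thesis using shift_nat by simp
  next
    case (nonpos n)
    have "inv\<^bsub>lamplighter\<^esub> (\<lambda>_. 0, int n) = (\<lambda>_. 0, m)"
      using nonpos by (intro L.inv_equality zc) (simp add: mult_lamplighter one_lamplighter)
    then show ?thesis using subgroup.m_inv_closed[OF sub shift_nat[of n]] by simp
  qed
  have lamps: "(\<lambda>j. if j \<in> U then 1 else 0, 0) \<in> ?g" if "finite U" for U :: "int set"
    using that
  proof (induction U rule: finite_induct)
    case empty
    then show ?case using shift[of 0] by simp
  next
    case (insert i U)
    let ?d = "(\<lambda>j. if j = 0 then 1 else 0, 0) :: (int \<Rightarrow> int) \<times> int"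
    have "?d \<in> ?g" by (intro generate.incl) simp
    then have "((\<lambda>_. 0, i) \<otimes>\<^bsub>lamplighter\<^esub> ?d \<otimes>\<^bsub>lamplighter\<^esub> (\<lambda>_. 0, - i)) \<otimes>\<^bsub>lamplighter\<^esub> (\<lambda>j. if j \<in> U then 1 else 0, 0) \<in> ?g"
      using shift insert.IH by (intro generate.eng)
    moreover have "((\<lambda>_. 0, i) \<otimes>\<^bsub>lamplighter\<^esub> ?d \<otimes>\<^bsub>lamplighter\<^esub> (\<lambda>_. 0, - i)) \<otimes>\<^bsub>lamplighter\<^esub> (\<lambda>j. if j \<in> U then 1 else 0, 0)
       = (\<lambda>j. if j \<in> insert i U then 1 else 0, 0)"
      using insert.hyps(2) by (auto simp: mult_lamplighter fun_eq_iff)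
    ultimately show ?case by simp
  qed
  have "x \<in> ?g" if x: "x \<in> carrier lamplighter" for x
  proof -
    obtain f m where fm: "x = (f, m)" "\<And>j. f j \<in> {0..<2}" "finite {j. f j \<noteq> 0}"
      using x by (auto simp: carrier_lamplighter)
    have f01: "f j = 0 \<or> f j = 1" for j using fm(2)[of j] by auto
    have "(\<lambda>j. if j \<in> {j. f j \<noteq> 0} then 1 else 0, 0) \<otimes>\<^bsub>lamplighter\<^esub> (\<lambda>_. 0, m) \<in> ?g"
      by (intro generate.eng lamps fm(3) shift)
    moreover have "(\<lambda>j. if j \<in> {j. f j \<noteq> 0} then 1 else 0, 0) \<otimes>\<^bsub>lamplighter\<^esub> (\<lambda>_. 0, m) = (f, m)"
      using f01 by (auto simp: mult_lamplighter fun_eq_iff)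
    ultimately show ?thesis using fm(1) by simp
  qed
  then have "generate lamplighter ?S = carrier lamplighter" using L.generate_incl[OF Sc] by blast
  then show ?thesis using Sc by (simp add: finite_generating_set_def)
qed

locale free_orbit = metabelian_pair G A for G (structure) and A +
  fixes t a :: 'a
  assumes t_closed [simp]: "t \<in> carrier G" and a_A [simp]: "a \<in> A" and no_relation: "\<not> small_relation t a"
begin

lemma relation_trivial: "small_coeffs p \<Longrightarrow> act t p a = \<one> \<Longrightarrow> p = 0"
  using no_relation unfolding small_relation_def by blast

text \<open>A power of \<open>t\<close> in \<open>A\<close> acts trivially on \<open>A\<close>, so
  X^n - 1 would be a small relation.\<close>

lemma int_pow_not_in_A:
  assumes "t [^] (m :: int) \<in> A"
  shows "m = 0"
proof -
  have nat_case: False if "t [^] n \<in> A" "n \<ge> 1" for n :: nat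
  proof -
    have "act t (monom 1 n + monom (-1) 0) a = conj (t [^] n) a [^] (1 :: int) \<otimes> conj (t [^] (0 :: nat)) a [^] (- 1 :: int)"
      by (simp only: act_add[OF t_closed a_A] act_monom[OF t_closed a_A])
    also have "conj (t [^] n) a = a" by (rule conj_by_A[OF that(1) a_A])
    also have "a [^] (1 :: int) \<otimes> conj (t [^] (0 :: nat)) a [^] (- 1 :: int) = \<one>"
      using int_pow_neg[of a 1] by simp
    finally have "monom 1 n + monom (-1) 0 = (0 :: int poly)"
      by (intro relation_trivial) (auto simp: small_coeffs_def)
    then have "coeff (monom 1 n + monom (-1) 0 :: int poly) 0 = 0" by simp
    then show False using that(2) by simp
  qed
  show ?thesis
  proof (cases m rule: int_cases2)
    case (nonneg n)
    then show ?thesis using nat_case[of n] assms by (cases "n = 0") (auto simp: int_pow_int)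
  next
    case (nonpos n)
    then have "inv (t [^] n) \<in> A" using assms by (simp add: int_pow_neg int_pow_int)
    then have "t [^] n \<in> A" using A_inv by fastforce
    then show ?thesis using nonpos nat_case[of n] by (cases "n = 0") auto
  qed
qed

abbreviation AG :: "('a, 'b) monoid_scheme" where "AG \<equiv> G\<lparr>carrier := A\<rparr>"

lemma comm_group_AG: "comm_group AG"
proof -
  interpret AG: group AG by (rule subgroup_imp_group[OF subgroup_A])
  show ?thesis by unfold_locales (simp add: comm_A)
qed

definition lamp_sum :: "int set \<Rightarrow> 'a" where
  "lamp_sum U = finprod AG (\<lambda>j. conj (t [^] j) a) U"

lemma conj_int_pow_a [simp]: "conj (t [^] (j :: int)) a \<in> A"
  by (intro conj_A) auto

lemma lamp_sum_empty [simp]: "lamp_sum {} = \<one>"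
proof -
  interpret AG: comm_group AG by (rule comm_group_AG)
  show ?thesis by (simp add: lamp_sum_def)
qed

lemma lamp_sum_insert: "finite U \<Longrightarrow> j \<notin> U \<Longrightarrow> lamp_sum (insert j U) = conj (t [^] j) a \<otimes> lamp_sum U"
proof -
  interpret AG: comm_group AG by (rule comm_group_AG)
  assume "finite U" "j \<notin> U"
  then have "finprod AG (\<lambda>j. conj (t [^] j) a) (insert j U) = conj (t [^] j) a \<otimes>\<^bsub>AG\<^esub> finprod AG (\<lambda>j. conj (t [^] j) a) U"
    using conj_int_pow_a by (intro AG.finprod_insert) auto
  then show ?thesis by (simp add: lamp_sum_def)
qed

lemma lamp_sum_A: "finite U \<Longrightarrow> lamp_sum U \<in> A"
  by (induction U rule: finite_induct) (auto simp: lamp_sum_insert simp del: conj_A)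

text \<open>A shift by \<open>t [^] k\<close> makes all exponents nonnegative, as the action of
  polynomials requires.\<close>

lemma conj_lamp_sum:
  assumes "finite U" "\<And>j. j \<in> U \<Longrightarrow> 0 \<le> j + k"
  shows "conj (t [^] k) (lamp_sum U) = act t (\<Sum>j\<in>U. monom 1 (nat (j + k))) a"
  using assms
proof (induction U rule: finite_induct)
  case (insert j U)
  have tk: "t [^] k \<in> carrier G" by simp
  have jk: "t [^] (k + j) = t [^] nat (j + k)"
    using insert.prems[of j] int_pow_int[of G t "nat (j + k)"] by (simp add: add.commute del: pow_nat)
  have "conj (t [^] k) (conj (t [^] j) a) = conj (t [^] nat (j + k)) a"
    unfolding jk[symmetric] int_pow_mult[OF t_closed] by (intro conj_conj) auto
  then have "conj (t [^] k) (lamp_sum (insert j U)) = conj (t [^] nat (j + k)) a \<otimes> act t (\<Sum>j\<in>U. monom 1 (nat (j + k))) a"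
    unfolding lamp_sum_insert[OF insert.hyps] conj_mult[OF tk A_closed[OF conj_int_pow_a] A_closed[OF lamp_sum_A[OF insert.hyps(1)]]]
    using insert by simp
  also have "conj (t [^] nat (j + k)) a = act t (monom 1 (nat (j + k))) a"
    unfolding act_monom[OF t_closed a_A] by (rule int_pow_1[symmetric]) (auto simp del: pow_nat)
  finally show ?case by (simp only: sum.insert[OF insert.hyps] act_add[OF t_closed a_A])
qed simp

text \<open>After a common shift both sums come from polynomials with coefficients 0 and 1, and
  their difference is a relation with small coefficients.\<close>

lemma lamp_sum_inj:
  assumes U: "finite U" "finite V" and eq: "lamp_sum U = lamp_sum V"
  shows "U = V"
proof -
  obtain k where k: "\<And>j. j \<in> U \<union> V \<Longrightarrow> 0 \<le> j + k"
  proof -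
    have "finite (U \<union> V)" using U by simp
    then obtain m where "\<forall>j\<in>U \<union> V. m \<le> j" by (meson bdd_below_def bdd_below_finite)
    then show thesis by (intro that[of "- m"]) auto
  qed
  define P where "P W = (\<Sum>j\<in>W. monom (1 :: int) (nat (j + k)))" for W
  have coeff: "coeff (P W) i = (if int i - k \<in> W then 1 else 0)" if "W = U \<or> W = V" for W i
  proof -
    have fin: "finite W" using that U by auto
    have "coeff (P W) i = (\<Sum>j\<in>W. if j = int i - k then 1 else 0)"
      unfolding P_def coeff_sum coeff_monom using that k by (intro sum.cong) auto
    then show ?thesis using fin by (simp add: sum.delta)
  qed
  have "act t (P U) a = act t (P V) a"
    using conj_lamp_sum[OF U(1), of k] conj_lamp_sum[OF U(2), of k] k eq by (simp add: P_def)
  moreover have "act t (P U) a = act t (P U - P V) a \<otimes> act t (P V) a"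
    using act_add[OF t_closed a_A, of "P U - P V" "P V"] by simp
  ultimately have "act t (P U - P V) a = \<one>" by simp
  then have "P U - P V = 0" by (intro relation_trivial) (auto simp: small_coeffs_def coeff)
  then have "coeff (P U) i = coeff (P V) i" for i by simp
  then have mem: "int i - k \<in> U \<longleftrightarrow> int i - k \<in> V" for i using coeff[of U i] coeff[of V i] by (simp split: if_splits)
  have "j \<in> U \<longleftrightarrow> j \<in> V" if "j \<in> U \<union> V" for j using mem[of "nat (j + k)"] k[OF that] by simp
  then show ?thesis by blast
qed

definition lamp_map :: "int set \<Rightarrow> int \<Rightarrow> 'a" where
  "lamp_map U m = lamp_sum U \<otimes> t [^] m"

lemma lamp_map_closed: "finite U \<Longrightarrow> lamp_map U m \<in> carrier G"
  unfolding lamp_map_def using lamp_sum_A[of U] by simp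

text \<open>Comparing both sides puts \<open>t [^] (n - m)\<close> into \<open>A\<close>, so the
  positions agree, and then the lamps can be compared.\<close>

lemma lamp_map_inj:
  assumes fin: "finite U" "finite V" and eq: "lamp_map U m = lamp_map V n"
  shows "U = V \<and> m = n"
proof -
  have A: "lamp_sum U \<in> A" "lamp_sum V \<in> A" using lamp_sum_A fin by auto
  have "inv (lamp_sum V) \<otimes> lamp_sum U \<otimes> t [^] m = t [^] n"
    using eq A unfolding lamp_map_def by (simp add: m_assoc)
  then have "inv (lamp_sum V) \<otimes> lamp_sum U = t [^] n \<otimes> inv (t [^] m)"
    using A by (metis (no_types) A_closed A_inv A_mult inv_solve_right int_pow_closed t_closed)
  also have "\<dots> = t [^] (n - m)" using int_pow_diff[of t n m] by simp
  finally have "t [^] (n - m) \<in> A" using A by (metis A_inv A_mult)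
  then have "m = n" using int_pow_not_in_A by fastforce
  then have "lamp_sum U = lamp_sum V" using eq A unfolding lamp_map_def by simp
  then show ?thesis using lamp_sum_inj fin \<open>m = n\<close> by blast
qed

lemma lamp_map_move: "finite U \<Longrightarrow> lamp_map U (m + 1) = lamp_map U m \<otimes> t"
  unfolding lamp_map_def using lamp_sum_A[of U] by (simp add: int_pow_mult m_assoc)

lemma lamp_map_switch:
  assumes "finite U" "m \<notin> U"
  shows "lamp_map (insert m U) m = lamp_map U m \<otimes> a"
proof -
  have A: "lamp_sum U \<in> A" using lamp_sum_A assms by auto
  have "lamp_map (insert m U) m = lamp_sum U \<otimes> conj (t [^] m) a \<otimes> t [^] m"
    unfolding lamp_map_def lamp_sum_insert[OF assms] by (simp only: comm_A[OF conj_int_pow_a A])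
  then show ?thesis unfolding lamp_map_def using A by (simp add: m_assoc)
qed

definition lamp_embedding :: "(int \<Rightarrow> int) \<times> int \<Rightarrow> 'a" where
  "lamp_embedding x = lamp_map {j. fst x j \<noteq> 0} (snd x)"

lemma lamp_embedding_inj: "inj_on lamp_embedding (carrier lamplighter)"
proof (rule inj_onI)
  fix x y assume x: "x \<in> carrier lamplighter" and y: "y \<in> carrier lamplighter" and eq: "lamp_embedding x = lamp_embedding y"
  obtain f m g n where fg: "x = (f, m)" "y = (g, n)" "\<And>j. f j \<in> {0..<2}" "\<And>j. g j \<in> {0..<2}" "finite {j. f j \<noteq> 0}" "finite {j. g j \<noteq> 0}"
    using x y by (auto simp: carrier_lamplighter)
  have *: "{j. f j \<noteq> 0} = {j. g j \<noteq> 0} \<and> m = n"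
    using eq fg(1,2) by (intro lamp_map_inj fg(5,6)) (simp add: lamp_embedding_def)
  have "f j = g j" for j
  proof -
    have "f j \<noteq> 0 \<longleftrightarrow> g j \<noteq> 0" using * by blast
    then show ?thesis using fg(3,4)[of j] by auto
  qed
  then show "x = y" using fg(1,2) * by auto
qed

lemma lamp_embedding_closed: "x \<in> carrier lamplighter \<Longrightarrow> lamp_embedding x \<in> carrier G"
  unfolding lamp_embedding_def by (rule lamp_map_closed) (auto simp: carrier_lamplighter)

text \<open>The lamp generator is an involution whereas \<open>a\<close> may have infinite order:
  lighting a lamp multiplies by \<open>a\<close>, extinguishing it by the inverse, hence the two
  alternatives.\<close>

lemma lamp_embedding_step:
  assumes x: "x \<in> carrier lamplighter" and s: "s \<in> {(\<lambda>_. 0, 1), (\<lambda>j. if j = 0 then 1 else 0, 0)}"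
  shows "\<exists>u\<in>{t, a}. lamp_embedding (x \<otimes>\<^bsub>lamplighter\<^esub> s) = lamp_embedding x \<otimes> u \<or> lamp_embedding x = lamp_embedding (x \<otimes>\<^bsub>lamplighter\<^esub> s) \<otimes> u"
proof -
  obtain f m where f: "x = (f, m)" "\<And>j. f j \<in> {0..<2}" "finite {j. f j \<noteq> 0}"
    using x by (auto simp: carrier_lamplighter)
  have f01: "f j = 0 \<or> f j = 1" for j using f(2)[of j] by auto
  then have fmod: "f j mod 2 = f j" for j by (metis mod_0 one_mod_two_eq_one)
  have f1: "f j = 1" if "f j \<noteq> 0" for j using f01[of j] that by auto
  let ?U = "{j. f j \<noteq> 0}"
  show ?thesis
  proof (cases "s = (\<lambda>_. 0, 1)")
    case True
    then have "lamp_embedding (x \<otimes>\<^bsub>lamplighter\<^esub> s) = lamp_embedding x \<otimes> t"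
      using lamp_map_move[OF f(3), of m] f(1) by (simp add: lamp_embedding_def mult_lamplighter fmod)
    then show ?thesis by blast
  next
    case False
    then have s: "s = (\<lambda>j. if j = 0 then 1 else 0, 0)" using s by blast
    define V where "V = {j. (f j + (if j - m = 0 then 1 else 0)) mod 2 \<noteq> 0}"
    have e: "lamp_embedding (x \<otimes>\<^bsub>lamplighter\<^esub> s) = lamp_map V m"
      by (simp add: lamp_embedding_def mult_lamplighter s f(1) V_def)
    show ?thesis
    proof (cases "m \<in> ?U")
      case True
      then have "f m = 1" using f01[of m] by auto
      then have V: "?U = insert m V" "m \<notin> V" using True fmod f1 by (auto simp: V_def)
      moreover have "finite V" using f(3) V(1) by (metis finite_insert)
      ultimately have "lamp_map ?U m = lamp_map V m \<otimes> a" using lamp_map_switch by simp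
      then show ?thesis using e f(1) by (intro bexI[of _ a]) (auto simp: lamp_embedding_def)
    next
      case False
      then have "V = insert m ?U" using fmod f1 by (auto simp: V_def)
      then have "lamp_map V m = lamp_map ?U m \<otimes> a" using lamp_map_switch[OF f(3) False] by simp
      then show ?thesis using e f(1) by (intro bexI[of _ a]) (auto simp: lamp_embedding_def)
    qed
  qed
qed

lemma regular_lamp_embedding:
  assumes S: "finite_generating_set G S"
  shows "regular_group_map lamplighter G lamp_embedding"
proof -
  let ?L = "{(\<lambda>_. 0, 1), (\<lambda>j. if j = 0 then 1 else 0, 0)} :: ((int \<Rightarrow> int) \<times> int) set"
  \<comment> \<open>With \<open>t\<close> and \<open>a\<close> among the generators, edges go to
    edges and the Lipschitz constant is 1.\<close>
  let ?T = "S \<union> {t, a}"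
  have Sc: "finite S" "S \<subseteq> carrier G" "generate G S = carrier G" using S by (auto simp: finite_generating_set_def)
  have Tc: "?T \<subseteq> carrier G" using Sc(2) by auto
  have "generate G ?T = carrier G"
    using mono_generate[of S ?T] Sc(3) generate_incl[OF Tc] by auto
  then have T: "finite_generating_set G ?T" using Sc(1) Tc by (simp add: finite_generating_set_def)
  let ?X = "cayley_graph lamplighter ?L"
  let ?Y = "cayley_graph G ?T"
  have edge: "(lamp_embedding x, lamp_embedding y) \<in> adjacency ?Y" if xy: "(x, y) \<in> adjacency ?X" for x y
  proof -
    have c: "x \<in> carrier lamplighter" "y \<in> carrier lamplighter" "x \<noteq> y"
      using xy by (auto simp: cayley_graph_def)
    have ne: "lamp_embedding x \<noteq> lamp_embedding y" using lamp_embedding_inj c by (auto dest: inj_onD)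
    obtain s where s: "s \<in> ?L" "y = x \<otimes>\<^bsub>lamplighter\<^esub> s \<or> x = y \<otimes>\<^bsub>lamplighter\<^esub> s"
      using xy unfolding cayley_graph_def by auto
    have "\<exists>u\<in>{t, a}. lamp_embedding y = lamp_embedding x \<otimes> u \<or> lamp_embedding x = lamp_embedding y \<otimes> u"
      using s(2)
    proof
      assume "y = x \<otimes>\<^bsub>lamplighter\<^esub> s"
      then show ?thesis using lamp_embedding_step[OF c(1) s(1)] by simp
    next
      assume "x = y \<otimes>\<^bsub>lamplighter\<^esub> s"
      then show ?thesis using lamp_embedding_step[OF c(2) s(1)] by blast
    qed
    then show ?thesis
      using ne c lamp_embedding_closed by (auto simp: cayley_graph_def)
  qed
  have relpow: "(lamp_embedding x, lamp_embedding y) \<in> adjacency ?Y ^^ n" if "(x, y) \<in> adjacency ?X ^^ n" for x y n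
    using that
  proof (induction n arbitrary: y)
    case (Suc n)
    from Suc.prems obtain z where z: "(x, z) \<in> adjacency ?X ^^ n" "(z, y) \<in> adjacency ?X" by (rule relpow_Suc_E)
    show ?case by (rule relpow_Suc_I[OF Suc.IH[OF z(1)] edge[OF z(2)]])
  qed simp
  have dist: "gdist ?Y (lamp_embedding x) (lamp_embedding y) \<le> gdist ?X x y" for x y
  proof -
    have "{n. (x, y) \<in> adjacency ?X ^^ n} \<subseteq> {n. (lamp_embedding x, lamp_embedding y) \<in> adjacency ?Y ^^ n}"
      by (intro Collect_mono impI relpow)
    then show ?thesis unfolding gdist_def by (rule INF_superset_mono) simp
  qed
  have fiber: "finite {x \<in> carrier lamplighter. lamp_embedding x = z} \<and> card {x \<in> carrier lamplighter. lamp_embedding x = z} \<le> 1" for z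
  proof (cases "{x \<in> carrier lamplighter. lamp_embedding x = z} = {}")
    case True
    show ?thesis unfolding True by simp
  next
    case False
    then obtain x where x: "x \<in> carrier lamplighter" "lamp_embedding x = z" by blast
    then have "{x \<in> carrier lamplighter. lamp_embedding x = z} = {x}" using lamp_embedding_inj by (auto dest: inj_onD)
    then show ?thesis by simp
  qed
  have "regular_map ?X ?Y lamp_embedding"
    unfolding regular_map_def
  proof (intro conjI exI[of _ 1] ballI)
    show "lamp_embedding ` vertices ?X \<subseteq> vertices ?Y" using lamp_embedding_closed by (auto simp: cayley_graph_def)
    show "ereal_of_enat (gdist ?Y (lamp_embedding x) (lamp_embedding y)) \<le> ereal 1 * ereal_of_enat (gdist ?X x y)" for x y
      using dist by (simp add: one_ereal_def[symmetric])
    show "finite {x \<in> vertices ?X. lamp_embedding x = z}" "real (card {x \<in> vertices ?X. lamp_embedding x = z}) \<le> 1" for z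
      using fiber[of z] by (simp_all add: cayley_graph_def)
  qed auto
  then show ?thesis unfolding regular_group_map_def using lamplighter_generated T by blast
qed

end

text \<open>\<open>n\<close> positions with \<open>2 ^ n\<close> configurations make
  \<open>n * 2 ^ n\<close> points; this is the largest such box with at most \<open>v\<close>
  points.\<close>

lemma exists_lamplighter_scale:
  fixes v :: nat
  assumes "v \<ge> 2"
  obtains n where "n \<ge> 1" "n * 2 ^ n \<le> v" "v < (n + 1) * 2 ^ (n + 1)"
proof -
  let ?P = "\<lambda>n. v < (n + 1) * 2 ^ (n + 1)"
  have "v < 2 ^ (v + 1)" using less_exp[of "v + 1"] by linarith
  also have "(2 :: nat) ^ (v + 1) \<le> (v + 1) * 2 ^ (v + 1)" by simp
  finally have ex: "?P v" .
  define n where "n = (LEAST n. ?P n)"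
  have n: "?P n" unfolding n_def using ex by (rule LeastI)
  have n1: "n \<noteq> 0" using n assms by (cases "n = 0") auto
  then have "\<not> ?P (n - 1)" unfolding n_def by (intro not_less_Least) (simp add: n_def[symmetric])
  then have "n * 2 ^ n \<le> v" using n1 by simp
  then show thesis using n n1 by (intro that[of n]) auto
qed

text \<open>\<open>2 ^ n \<le> v\<close> gives \<open>ln v \<ge> n / 2\<close>, while
  \<open>v\<close> is at most \<open>4 * n * 2 ^ n\<close>; hence the factor 8.\<close>

lemma lamplighter_scale_bound:
  fixes v n :: nat
  assumes n: "n \<ge> 1" "n * 2 ^ n \<le> v" "v < (n + 1) * 2 ^ (n + 1)"
  shows "real v / ln (real v) \<le> 8 * 2 ^ n"
proof -
  have ln2: "ln 2 \<ge> (1 / 2 :: real)" using ln_2_less_1 ln_add_one_self_le_self2 ln_le_minus_one[of "1/2 :: real"] by (simp add: ln_div)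
  have "(2 :: nat) ^ n \<le> n * 2 ^ n" using n(1) by simp
  then have "2 ^ n \<le> v" using n(2) by linarith
  then have v: "(2 :: real) ^ n \<le> real v" by (metis of_nat_le_iff of_nat_numeral of_nat_power)
  then have "ln ((2 :: real) ^ n) \<le> ln (real v)" by (intro ln_mono) auto
  then have "real n * ln 2 \<le> ln (real v)" by (simp add: ln_realpow)
  moreover have "real n * (1 / 2) \<le> real n * ln 2" using ln2 by (intro mult_left_mono) auto
  ultimately have ln: "real n / 2 \<le> ln (real v)" by linarith
  have "real v \<le> real ((n + 1) * 2 ^ (n + 1))" using n(3) by (simp only: of_nat_le_iff less_imp_le)
  also have "\<dots> = (real n + 1) * (2 * 2 ^ n)" by (simp add: algebra_simps)
  also have "\<dots> \<le> (2 * real n) * (2 * 2 ^ n)" using n(1) by (intro mult_right_mono) auto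
  also have "\<dots> = (8 * 2 ^ n) * (real n / 2)" by simp
  also have "\<dots> \<le> (8 * 2 ^ n) * ln (real v)" using ln by (intro mult_left_mono) auto
  finally have "real v \<le> (8 * 2 ^ n) * ln (real v)" .
  moreover have "ln (real v) > 0" using ln n(1) by linarith
  ultimately show ?thesis by (simp add: divide_le_eq)
qed

section \<open>Congestion in embedded lamplighter boxes\<close>

context free_orbit begin

text \<open>The lamp configuration on the way from \<open>U\<close> to \<open>V\<close> after the lamps before \<open>j\<close> have been set.\<close>

definition mix :: "nat \<Rightarrow> int set \<Rightarrow> int set \<Rightarrow> int set" where
  "mix j U V = (V \<inter> {..<int j}) \<union> (U - {..<int j})"

text \<open>The pair is recovered from the complementary mixtures \<open>mix j U V\<close> and
  \<open>mix j V U\<close>; the first is prescribed, the second is one of \<open>2 ^ n\<close>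
  sets.\<close>

lemma card_mix_le:
  "card {(U, V). U \<in> Pow {0..<int n} \<and> V \<in> Pow {0..<int n} \<and> mix j U V = P} \<le> 2 ^ n" (is "card ?Q \<le> _")
proof -
  have "inj_on (\<lambda>(U, V). mix j V U) ?Q"
  proof (rule inj_onI)
    fix q r assume qr: "q \<in> ?Q" "r \<in> ?Q" "(\<lambda>(U, V). mix j V U) q = (\<lambda>(U, V). mix j V U) r"
    obtain U V U' V' where e: "q = (U, V)" "r = (U', V')" by (cases q; cases r)
    have *: "mix j U V = mix j U' V'" "mix j V U = mix j V' U'" using qr by (simp_all add: e)
    have "(x \<in> U \<longleftrightarrow> x \<in> U') \<and> (x \<in> V \<longleftrightarrow> x \<in> V')" for x
    proof -
      have "x \<in> mix j U V \<longleftrightarrow> x \<in> mix j U' V'" "x \<in> mix j V U \<longleftrightarrow> x \<in> mix j V' U'" using * by simp_all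
      then show ?thesis by (cases "x < int j") (simp_all add: mix_def)
    qed
    then show "q = r" unfolding e by blast
  qed
  moreover have "(\<lambda>(U, V). mix j V U) ` ?Q \<subseteq> Pow {0..<int n}" by (auto simp: mix_def)
  ultimately have "card ?Q \<le> card (Pow {0..<int n})" by (rule card_inj_on_le) simp
  then show ?thesis by (simp add: card_Pow)
qed

definition box_points :: "nat \<Rightarrow> (int set \<times> nat) set" where
  "box_points n = Pow {0..<int n} \<times> {..<n}"

definition point :: "int set \<times> nat \<Rightarrow> 'a" where
  "point q = lamp_map (fst q) (int (snd q))"

lemma finite_box_points: "finite (box_points n)"
  by (simp add: box_points_def)

lemma card_box_points: "card (box_points n) = n * 2 ^ n"
  by (simp add: box_points_def card_cartesian_product card_Pow)

lemma finite_fst_box_points: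
  assumes "q \<in> box_points n" shows "finite (fst q)"
proof (rule finite_subset)
  show "fst q \<subseteq> {0..<int n}" using assms by (auto simp: box_points_def)
qed simp

lemma point_closed: "q \<in> box_points n \<Longrightarrow> point q \<in> carrier G"
  unfolding point_def by (intro lamp_map_closed finite_fst_box_points)

lemma inj_point: "inj_on point (box_points n)"
proof (rule inj_onI)
  fix q r assume "q \<in> box_points n" "r \<in> box_points n" "point q = point r"
  then have "fst q = fst r \<and> int (snd q) = int (snd r)"
    unfolding point_def by (intro lamp_map_inj finite_fst_box_points)
  then show "q = r" by (simp add: prod_eq_iff)
qed

text \<open>The walker goes along the row of \<open>U\<close> to position 0, sweeps to the right
  while replacing lamps, and returns along the row of \<open>V\<close>. Full rows are included, so
  the set does not depend on the positions of the end points.\<close>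

definition path_points :: "nat \<Rightarrow> int set \<Rightarrow> int set \<Rightarrow> (int set \<times> nat) set" where
  "path_points n U V = (\<Union>j<n. {(U, j), (mix j U V, j), (mix (Suc j) U V, j), (V, j)})"

lemma path_pointsI:
  assumes "j < n"
  shows "(U, j) \<in> path_points n U V" "(mix j U V, j) \<in> path_points n U V"
    "(mix (Suc j) U V, j) \<in> path_points n U V" "(V, j) \<in> path_points n U V"
  unfolding path_points_def using assms by blast+

lemma path_points_subset:
  "U \<in> Pow {0..<int n} \<Longrightarrow> V \<in> Pow {0..<int n} \<Longrightarrow> path_points n U V \<subseteq> box_points n"
  unfolding path_points_def box_points_def mix_def by blast

text \<open>A point with configuration \<open>P\<close> lies on the path only if \<open>U\<close>,
  \<open>V\<close> or one of two mixtures equals \<open>P\<close>, which leaves at most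
  \<open>4 * 2 ^ n\<close> pairs of configurations; the two positions are free.\<close>

lemma card_path_points_le:
  "card {(q, r) \<in> box_points n \<times> box_points n. p \<in> path_points n (fst q) (fst r)} \<le> 4 * n ^ 2 * 2 ^ n"
proof -
  obtain P i where p: "p = (P, i)" by (cases p)
  define N where "N = {0..<int n}"
  have finN: "finite (Pow N)" by (simp add: N_def)
  have cardN: "card (Pow N) = 2 ^ n" by (simp add: N_def card_Pow)
  define M where "M j = {(U, V). U \<in> Pow N \<and> V \<in> Pow N \<and> mix j U V = P}" for j
  have finM: "finite (M j)" for j
    by (rule finite_subset[of _ "Pow N \<times> Pow N"]) (auto simp: M_def N_def)
  have cardM: "card (M j) \<le> 2 ^ n" for j unfolding M_def N_def by (rule card_mix_le)
  define W where "W = ({P} \<times> Pow N) \<union> (Pow N \<times> {P}) \<union> M i \<union> M (Suc i)"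
  have finW: "finite W" using finN finM by (simp add: W_def)
  have "card W \<le> card ({P} \<times> Pow N) + card (Pow N \<times> {P}) + card (M i) + card (M (Suc i))"
    unfolding W_def by (meson add_le_mono card_Un_le le_refl order_trans)
  also have "\<dots> \<le> 4 * 2 ^ n"
    using cardM[of i] cardM[of "Suc i"] by (simp add: card_cartesian_product cardN)
  finally have cardW: "card W \<le> 4 * 2 ^ n" .
  let ?f = "\<lambda>((U, V), (k, l)). ((U, k), (V, l)) :: (int set \<times> nat) \<times> (int set \<times> nat)"
  have "{(q, r) \<in> box_points n \<times> box_points n. p \<in> path_points n (fst q) (fst r)} \<subseteq> ?f ` (W \<times> ({..<n} \<times> {..<n}))"
  proof clarify
    fix U k V l assume *: "(U, k) \<in> box_points n" "(V, l) \<in> box_points n" "p \<in> path_points n (fst (U, k)) (fst (V, l))"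
    then have UV: "U \<in> Pow N" "V \<in> Pow N" "k < n" "l < n" by (auto simp: box_points_def N_def)
    obtain j where "p \<in> {(U, j), (mix j U V, j), (mix (Suc j) U V, j), (V, j)}"
      using *(3) unfolding path_points_def fst_conv by blast
    then have "(U, V) \<in> W" using UV p by (auto simp: W_def M_def)
    then show "((U, k), (V, l)) \<in> ?f ` (W \<times> ({..<n} \<times> {..<n}))"
      using UV by (intro image_eqI[of _ _ "((U, V), (k, l))"]) auto
  qed
  then have "card {(q, r) \<in> box_points n \<times> box_points n. p \<in> path_points n (fst q) (fst r)} \<le> card (?f ` (W \<times> ({..<n} \<times> {..<n})))"
    using finW by (intro card_mono) auto
  also have "\<dots> \<le> card (W \<times> ({..<n} \<times> {..<n}))" using finW by (intro card_image_le) auto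
  also have "\<dots> = card W * (n * n)" by (simp add: card_cartesian_product)
  also have "\<dots> \<le> (4 * 2 ^ n) * (n * n)" using cardW by (rule mult_le_mono1)
  finally show ?thesis by (simp add: power2_eq_square mult_ac)
qed

lemma lamp_map_mix_step:
  assumes U: "U \<in> Pow {0..<int n}" and V: "V \<in> Pow {0..<int n}"
  shows "mix (Suc j) U V = mix j U V \<or>
    (point (mix (Suc j) U V, j) = point (mix j U V, j) \<otimes> a) \<or> (point (mix j U V, j) = point (mix (Suc j) U V, j) \<otimes> a)"
proof -
  have fin: "finite (mix i U V)" for i
  proof (rule finite_subset)
    show "mix i U V \<subseteq> {0..<int n}" using U V by (auto simp: mix_def)
  qed simp
  consider "int j \<in> U \<longleftrightarrow> int j \<in> V" | "int j \<in> U" "int j \<notin> V" | "int j \<notin> U" "int j \<in> V" by blast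
  then show ?thesis
  proof cases
    case 1
    have "x \<in> mix (Suc j) U V \<longleftrightarrow> x \<in> mix j U V" for x
      using 1 by (cases x "int j" rule: linorder_cases) (auto simp: mix_def)
    then show ?thesis by blast
  next
    case 2
    have "x \<in> mix j U V \<longleftrightarrow> x \<in> insert (int j) (mix (Suc j) U V)" for x
      using 2 by (cases x "int j" rule: linorder_cases) (auto simp: mix_def)
    then have "mix j U V = insert (int j) (mix (Suc j) U V)" by blast
    moreover have "int j \<notin> mix (Suc j) U V" using 2 by (auto simp: mix_def)
    ultimately show ?thesis using lamp_map_switch[OF fin[of "Suc j"]] by (simp add: point_def)
  next
    case 3
    have "x \<in> mix (Suc j) U V \<longleftrightarrow> x \<in> insert (int j) (mix j U V)" for x
      using 3 by (cases x "int j" rule: linorder_cases) (auto simp: mix_def)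
    then have "mix (Suc j) U V = insert (int j) (mix j U V)" by blast
    moreover have "int j \<notin> mix j U V" using 3 by (auto simp: mix_def)
    ultimately show ?thesis using lamp_map_switch[OF fin[of j]] by (simp add: point_def)
  qed
qed

text \<open>\<open>t\<close> and \<open>a\<close> are words over \<open>S\<close> of length up to
  \<open>\<rho>\<close>, so the box points are thickened by balls of that radius to make the paths
  connected, at the cost of constant factors. There are n^2 4^n pairs, and of the order of n^2 2^n
  paths through a vertex, so the profile is at least of order 2^n.\<close>

lemma lamplighter_congestion:
  assumes S: "S \<subseteq> carrier G" "finite S" and ta: "t \<in> word_ball G S \<rho>" "a \<in> word_ball G S \<rho>"
    and n: "n \<ge> 1" and k: "2 * card (word_ball G S \<rho>) \<le> 2 ^ k"
    and v: "n * 2 ^ n * card (word_ball G S \<rho>) \<le> v"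
  shows "2 ^ n \<le> 2 ^ (k + 4) * card (word_ball G S \<rho>) * sep (cayley_graph G S) v"
proof -
  let ?W = "word_ball G S \<rho>"
  let ?X = "cayley_graph G S"
  let ?J = "box_points n"
  have finW: "finite ?W" by (rule finite_word_ball[OF S(2)])
  have Wc: "?W \<subseteq> carrier G" by (rule word_ball_carrier[OF S(1)])
  define I where "I = point ` ?J"
  define F where "F = (\<Union>p\<in>I. translate p ?W)"
  have finI: "finite I" unfolding I_def by (intro finite_imageI finite_box_points)
  have Ic: "p \<in> carrier G" if "p \<in> I" for p using that point_closed unfolding I_def by blast
  have cardI: "card I = n * 2 ^ n" unfolding I_def card_image[OF inj_point] by (rule card_box_points)
  have finF: "finite F" using finI finW by (simp add: F_def)
  have Fc: "F \<subseteq> carrier G" using Ic Wc by (auto simp: F_def subset_iff)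
  have "card F \<le> (\<Sum>p\<in>I. card (translate p ?W))" unfolding F_def by (rule card_UN_le[OF finI])
  also have "\<dots> = (\<Sum>p\<in>I. card ?W)" by (intro sum.cong refl card_translate Ic Wc)
  finally have cardF: "card F \<le> card ?W * card I" by (simp add: mult.commute)
  define \<psi> where "\<psi> = inv_into ?J point"
  have \<psi>: "\<psi> x \<in> ?J" "point (\<psi> x) = x" if "x \<in> I" for x
    using that unfolding \<psi>_def I_def by (auto intro: inv_into_into f_inv_into_f)
  define B where "B x y = (\<Union>p\<in>path_points n (fst (\<psi> x)) (fst (\<psi> y)). translate (point p) ?W)" for x y
  define T where "T = card ?W * (4 * n ^ 2 * 2 ^ n)"
  have "card I ^ 2 \<le> 2 ^ (k + 2) * (sep ?X v * T)"
  proof (rule congestion_bound[where F = F and I = I and B = B and L = "card ?W" and X = ?X])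
    show "sym (adjacency ?X)" by (rule sym_cayley)
    show "F \<subseteq> vertices ?X" using Fc by (simp add: cayley_graph_def)
    show "finite F" by (rule finF)
    show "card F \<le> v" using cardF cardI v by (simp add: mult.commute)
    show "I \<subseteq> F"
    proof
      fix x assume x: "x \<in> I"
      then have "x = x \<otimes> \<one>" using Ic by simp
      then have "x \<in> translate x ?W" using word_ball_one by blast
      then show "x \<in> F" using x unfolding F_def by blast
    qed
    show "card F \<le> card ?W * card I" by (rule cardF)
    show "2 * card ?W \<le> 2 ^ k" by (rule k)
  next
    fix x y assume x: "x \<in> I" and y: "y \<in> I"
    have "\<psi> x \<in> path_points n (fst (\<psi> x)) (fst (\<psi> y))"
      using \<psi>(1)[OF x] unfolding path_points_def box_points_def by (cases "\<psi> x") auto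
    moreover have "x \<in> translate (point (\<psi> x)) ?W"
      using \<psi>(2)[OF x] Ic[OF x] word_ball_one[of S \<rho>] by (intro image_eqI[of _ _ \<one>]) auto
    ultimately show "x \<in> B x y" unfolding B_def by blast
  next
    fix x y C assume x: "x \<in> I" and y: "y \<in> I" and C: "C \<subseteq> F" "B x y \<inter> C = {}"
    obtain U i where U: "\<psi> x = (U, i)" by (cases "\<psi> x")
    obtain V l where V: "\<psi> y = (V, l)" by (cases "\<psi> y")
    have UV: "U \<in> Pow {0..<int n}" "V \<in> Pow {0..<int n}" "i < n" "l < n"
      using \<psi>(1)[OF x] \<psi>(1)[OF y] unfolding U V box_points_def by auto
    let ?PP = "path_points n U V"
    define con where "con p q \<longleftrightarrow> point q \<in> component ?X (F - C) (point p)" for p q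
    have sy: "con q p" if "con p q" for p q
    proof -
      have "component ?X (F - C) (point q) = component ?X (F - C) (point p)"
        using that unfolding con_def by (intro component_eq sym_cayley)
      then show ?thesis unfolding con_def by simp
    qed
    have tr: "con p r" if "con p q" "con q r" for p q r
      using that unfolding con_def by (auto intro: rtrancl_trans)
    have step: "con p q" if p: "p \<in> ?PP" and s: "s \<in> {t, a}" "point q = point p \<otimes> s" for p q s
    proof -
      have pI: "point p \<in> I" using path_points_subset[OF UV(1,2)] p unfolding I_def by blast
      have sub: "translate (point p) ?W \<subseteq> F - C"
        using pI p C unfolding F_def B_def U V fst_conv by blast
      have "s \<in> ?W" using s(1) ta by blast
      from word_path[OF S(1) this] obtain P where P: "P \<subseteq> ?W"
        "\<forall>x\<in>carrier G. \<forall>U. translate x P \<subseteq> U \<longrightarrow> x \<otimes> s \<in> component ?X U x" by (elim exE conjE)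
      have "translate (point p) P \<subseteq> F - C" using P(1) sub by blast
      then have "point p \<otimes> s \<in> component ?X (F - C) (point p)" using P(2)[rule_format, OF Ic[OF pI]] by blast
      then show ?thesis unfolding con_def s(2) .
    qed
    have finUV: "finite U" "finite V" using UV(1,2) finite_subset[of _ "{0..<int n}"] by auto
    have move: "con (W, j) (W, Suc j)" if "(W, j) \<in> ?PP" "finite W" for W j
      using lamp_map_move[OF that(2), of "int j"] by (intro step[OF that(1), of t]) (auto simp: point_def add.commute)
    have colU: "con (U, 0) (U, j)" if "j < n" for j
      using that
    proof (induction j)
      case (Suc j)
      have "(U, j) \<in> ?PP" using Suc.prems by (intro path_pointsI) simp
      then show ?case using tr[OF Suc.IH move] Suc.prems finUV by simp
    qed (simp add: con_def)
    have colV: "con (V, 0) (V, j)" if "j < n" for j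
      using that
    proof (induction j)
      case (Suc j)
      have "(V, j) \<in> ?PP" using Suc.prems by (intro path_pointsI) simp
      then show ?case using tr[OF Suc.IH move] Suc.prems finUV by simp
    qed (simp add: con_def)
    have finmix: "finite (mix j U V)" for j using finUV by (auto simp: mix_def)
    have switch: "con (mix j U V, j) (mix (Suc j) U V, j)" if "j < n" for j
    proof -
      have PP: "(mix j U V, j) \<in> ?PP" "(mix (Suc j) U V, j) \<in> ?PP" using path_pointsI[OF that] by blast+
      show ?thesis
        using lamp_map_mix_step[OF UV(1,2), of j]
      proof (elim disjE)
        assume "mix (Suc j) U V = mix j U V"
        then show ?thesis by (simp add: con_def)
      next
        assume "point (mix (Suc j) U V, j) = point (mix j U V, j) \<otimes> a"
        then show ?thesis by (intro step[OF PP(1), of a]) auto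
      next
        assume "point (mix j U V, j) = point (mix (Suc j) U V, j) \<otimes> a"
        then have "con (mix (Suc j) U V, j) (mix j U V, j)" by (intro step[OF PP(2), of a]) auto
        then show ?thesis by (rule sy)
      qed
    qed
    have mix0: "mix 0 U V = U" using UV(1,2) by (auto simp: mix_def)
    have mixn: "mix n U V = V" using UV(1,2) by (auto simp: mix_def)
    have diag: "con (U, 0) (mix (Suc j) U V, j)" if "j < n" for j
      using that
    proof (induction j)
      case 0
      then show ?case using switch[of 0] mix0 by simp
    next
      case (Suc j)
      have "(mix (Suc j) U V, j) \<in> ?PP" using Suc.prems by (intro path_pointsI) simp
      then have "con (mix (Suc j) U V, j) (mix (Suc j) U V, Suc j)" by (rule move[OF _ finmix])
      then show ?case using tr[OF tr[OF Suc.IH] switch[of "Suc j"]] Suc.prems by simp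
    qed
    have "con (U, 0) (V, n - 1)" using diag[of "n - 1"] n mixn by simp
    moreover have "con (V, n - 1) (V, l)" using tr[OF sy[OF colV[of "n - 1"]] colV[OF UV(4)]] n by simp
    ultimately have "con (U, i) (V, l)" using tr sy[OF colU[OF UV(3)]] by blast
    then show "y \<in> component ?X (F - C) x" using \<psi>(2)[OF x] \<psi>(2)[OF y] unfolding con_def U V by simp
  next
    fix c assume c: "c \<in> F"
    have cc: "c \<in> carrier G" using c Fc by blast
    let ?Q = "\<lambda>p. {(q, r) \<in> ?J \<times> ?J. p \<in> path_points n (fst q) (fst r)}"
    have finQ: "finite (?Q p)" for p
      by (rule finite_subset[of _ "?J \<times> ?J"]) (auto intro: finite_box_points)
    \<comment> \<open>For each \<open>g\<close> in the ball, \<open>c\<close> determines the box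
      point \<open>c \<otimes> inv g\<close>, hence one instance of
      \<open>card_path_points_le\<close>.\<close>
    have "{(x, y) \<in> I \<times> I. c \<in> B x y} \<subseteq> (\<Union>g\<in>?W. (\<lambda>(q, r). (point q, point r)) ` ?Q (\<psi> (c \<otimes> inv g)))"
    proof clarify
      fix x y assume x: "x \<in> I" and y: "y \<in> I" and cB: "c \<in> B x y"
      obtain p g where p: "p \<in> path_points n (fst (\<psi> x)) (fst (\<psi> y))" and g: "g \<in> ?W" "c = point p \<otimes> g"
        using cB unfolding B_def by blast
      have "path_points n (fst (\<psi> x)) (fst (\<psi> y)) \<subseteq> ?J"
        using \<psi>(1)[OF x] \<psi>(1)[OF y] by (intro path_points_subset) (auto simp: box_points_def)
      then have pJ: "p \<in> ?J" using p by blast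
      have "c \<otimes> inv g = point p" using g Wc point_closed[OF pJ] by (simp add: m_assoc subset_iff)
      then have "\<psi> (c \<otimes> inv g) = p" unfolding \<psi>_def using inv_into_f_f[OF inj_point pJ] by simp
      then have "(\<psi> x, \<psi> y) \<in> ?Q (\<psi> (c \<otimes> inv g))" using p \<psi>(1)[OF x] \<psi>(1)[OF y] by simp
      moreover have "(x, y) = (\<lambda>(q, r). (point q, point r)) (\<psi> x, \<psi> y)" using \<psi>(2)[OF x] \<psi>(2)[OF y] by simp
      ultimately show "(x, y) \<in> (\<Union>g\<in>?W. (\<lambda>(q, r). (point q, point r)) ` ?Q (\<psi> (c \<otimes> inv g)))" using g(1) by blast
    qed
    then have "card {(x, y) \<in> I \<times> I. c \<in> B x y} \<le> card (\<Union>g\<in>?W. (\<lambda>(q, r). (point q, point r)) ` ?Q (\<psi> (c \<otimes> inv g)))"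
      using finW finQ by (intro card_mono finite_UN_I finite_imageI)
    also have "\<dots> \<le> (\<Sum>g\<in>?W. card ((\<lambda>(q, r). (point q, point r)) ` ?Q (\<psi> (c \<otimes> inv g))))" by (rule card_UN_le[OF finW])
    also have "\<dots> \<le> (\<Sum>g\<in>?W. 4 * n ^ 2 * 2 ^ n)"
      by (intro sum_mono order_trans[OF card_image_le[OF finQ] card_path_points_le])
    finally show "card {(x, y) \<in> I \<times> I. c \<in> B x y} \<le> T" by (simp add: T_def)
  qed
  then have "(n ^ 2 * 2 ^ n) * 2 ^ n \<le> (n ^ 2 * 2 ^ n) * (2 ^ (k + 4) * card ?W * sep ?X v)"
    unfolding cardI T_def by (simp add: power_mult_distrib power_add power2_eq_square mult_ac)
  moreover have "n ^ 2 * 2 ^ n > 0" using n by simp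
  ultimately show ?thesis by (simp only: mult_le_cancel1)
qed

lemma lamplighter_sep_lower:
  assumes S: "finite_generating_set G S"
  shows "(\<lambda>v. real v / ln (real v)) \<preceq> (\<lambda>v. real (sep (cayley_graph G S) v))"
proof -
  let ?X = "cayley_graph G S"
  have Sc: "finite S" "S \<subseteq> carrier G" "generate G S = carrier G" using S by (auto simp: finite_generating_set_def)
  have "{t, a} \<subseteq> generate G S" using Sc(3) by simp
  then obtain \<rho> where \<rho>: "{t, a} \<subseteq> word_ball G S \<rho>"
    using finite_subset_word_ball[OF Sc(2), of "{t, a}"] by blast
  define w where "w = card (word_ball G S \<rho>)"
  define k where "k = 2 * w"
  have k: "2 * w \<le> 2 ^ k" unfolding k_def by (rule less_imp_le[OF less_exp])
  \<comment> \<open>The first summand is the constant of the inequality, \<open>w\<close> makes room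
    for the thickened box, and 2 ensures \<open>v \<ge> 2\<close>.\<close>
  define C where "C = 8 * 2 ^ (k + 4) * w + w + 2"
  show ?thesis
  proof (rule profile_leI[of C])
    fix v assume v: "v \<ge> C"
    then have "v \<ge> 2" by (simp add: C_def)
    then obtain n where n: "n \<ge> 1" "n * 2 ^ n \<le> v" "v < (n + 1) * 2 ^ (n + 1)" by (rule exists_lamplighter_scale)
    have "n * 2 ^ n * w \<le> v * C" using n(2) by (intro mult_le_mono) (auto simp: C_def)
    then have "2 ^ n \<le> 2 ^ (k + 4) * w * sep ?X (C * v)"
      unfolding w_def using \<rho> k n(1) by (intro lamplighter_congestion[OF Sc(2,1)]) (auto simp: w_def mult.commute)
    then have "8 * 2 ^ n \<le> 8 * (2 ^ (k + 4) * w * sep ?X (C * v))" by (rule mult_le_mono2)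
    also have "\<dots> = 8 * 2 ^ (k + 4) * w * sep ?X (C * v)" by (simp only: mult.assoc)
    also have "\<dots> \<le> C * sep ?X (C * v)" by (rule mult_le_mono1) (simp add: C_def)
    finally have "real (8 * 2 ^ n) \<le> real (C * sep ?X (C * v))" by (simp only: of_nat_le_iff)
    then have "8 * 2 ^ n \<le> real C * real (sep ?X (C * v))" by simp
    then show "real v / ln (real v) \<le> real C * real (sep ?X (C * v))"
      using lamplighter_scale_bound[OF n] by linarith
  qed (simp add: C_def)
qed

end

section \<open>The dichotomy\<close>

theorem corollary1p4:
  fixes G :: "('a, 'm) monoid_scheme"
  assumes "finitely_generated_group G" and "metabelian G"
  shows "(virtually_nilpotent G \<and>
            (\<exists>d. growth_degree G d \<and>
               (\<forall>S. finite_generating_set G S \<longrightarrow>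
                  (\<lambda>v. real (sep (cayley_graph G S) v)) \<asymp> growth_profile d)))
       \<or> ((\<exists>\<phi>. regular_group_map lamplighter G \<phi>) \<and>
            (\<forall>S. finite_generating_set G S \<longrightarrow>
               (\<lambda>v. real v / ln (real v)) \<preceq> (\<lambda>v. real (sep (cayley_graph G S) v))))"
proof -
  interpret group G using assms(2) by (simp add: metabelian_def)
  define A where "A = derived G (carrier G)"
  have commutator: "g \<otimes>\<^bsub>G\<^esub> h \<otimes>\<^bsub>G\<^esub> inv\<^bsub>G\<^esub> g \<otimes>\<^bsub>G\<^esub> inv\<^bsub>G\<^esub> h \<in> A" if "g \<in> carrier G" "h \<in> carrier G" for g h
    unfolding A_def derived_def using that by (intro generate.incl) auto
  have A_min: "A \<subseteq> N" if "subgroup N G"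
    "\<And>g h. g \<in> carrier G \<Longrightarrow> h \<in> carrier G \<Longrightarrow> g \<otimes>\<^bsub>G\<^esub> h \<otimes>\<^bsub>G\<^esub> inv\<^bsub>G\<^esub> g \<otimes>\<^bsub>G\<^esub> inv\<^bsub>G\<^esub> h \<in> N" for N
    unfolding A_def derived_def using that by (intro generate_subgroup_incl) auto
  have AG: "comm_group (G\<lparr>carrier := A\<rparr>)" using assms(2) by (simp add: metabelian_def A_def)
  interpret metabelian_pair G A
  proof (intro metabelian_pair.intro metabelian_pair_axioms.intro)
    show "group G" by (rule group_axioms)
    show "subgroup A G" unfolding A_def by (rule derived_is_subgroup) simp
    show "x \<otimes>\<^bsub>G\<^esub> y = y \<otimes>\<^bsub>G\<^esub> x" if "x \<in> A" "y \<in> A" for x y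
      using comm_monoid.m_comm[OF comm_group.axioms(1)[OF AG], of x y] that by simp
  qed (rule commutator)
  obtain S where S: "finite_generating_set G S" using assms(1) by (auto simp: finitely_generated_group_def)
  then have Sc: "finite S" "S \<subseteq> carrier G" "generate G S = carrier G" by (auto simp: finite_generating_set_def)
  show ?thesis
  proof (cases "\<forall>t\<in>carrier G. \<forall>a\<in>A. small_relation t a")
    case True
    then show ?thesis using virtually_nilpotent_case[OF Sc A_min] by blast
  next
    case False
    then obtain t a where ta: "t \<in> carrier G" "a \<in> A" "\<not> small_relation t a" by blast
    interpret free_orbit G A t a
      by unfold_locales (use ta in auto)
    show ?thesis using regular_lamp_embedding[OF S] lamplighter_sep_lower by blast
  qed
qed

end
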